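(* Suppose $\epsilon_n\to0$ ($\epsilon_n\ge0$) and $\{W_i\}$ is an i.i.d. sequence of $\mathcal{W}$-valued random variables with law $\lambda_0$. Let $\mathcal{N}^{\epsilon_n}_n$ denote the set of empirical distributions $\frac1n\sum_{i=1}^n\delta_{(W_i,x_i)}$ over all $\epsilon_n$-Nash equilibria $(x_1,\dots,x_n)$ with type vector $(W_1,\dots,W_n)$. Then $\{\mathcal{N}^{\epsilon_n}_n\}$ satisfies a large deviation principle on $\mathfrak{C}$ (with the upper Vietoris topology) with good rate function $$J(A)=\inf\{H(\lambda|\lambda_0):\lambda\in\mathcal{P}(\mathcal{W}),\ \mathcal{M}(\lambda)=A\}.$$
   Context: Standing assumptions: $\mathcal{X}$ compact metric space, $\mathcal{W}$ complete separable metric space; $\mathcal{P}(S)$ = Borel probability measures on $S$ with the weak topology. $\mathcal{C}$ maps $w$ to a nonempty closed $\mathcal{C}(w)\subset\mathcal{X}$, continuous in the sense that $\mathrm{Gr}(\mathcal{C})=\{(w,x):x\in\mathcal{C}(w)\}$ is closed and whenever $w_n\to w$, $x\in\mathcal{C}(w)$ there exist $n_k$, $x_{n_k}\in\mathcal{C}(w_{n_k})$ with $x_{n_k}\to x$. $F:\mathcal{P}(\mathcal{W}\times\mathcal{X})\times\mathcal{W}\times\mathcal{X}\to\mathbb{R}$ bounded continuous. For $\epsilon\ge0$, an $\epsilon$-Nash equilibrium with type vector $(w_1,\dots,w_n)$ is $(x_1,\dots,x_n)$ with $x_i\in\mathcal{C}(w_i)$ and, with $m=\frac1n\sum_k\delta_{(w_k,x_k)}$,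 $F(m,w_i,x_i)-\inf_{y\in\mathcal{C}(w_i)}F(m+\frac1n(\delta_{(w_i,y)}-\delta_{(w_i,x_i)}),w_i,y)\le\epsilon$ for all $i$; (exact, $\epsilon=0$) Nash equilibria are assumed to exist for all $n$ and type vectors. These sets of empirical distributions are closed. $\mathcal{M}(\lambda)$ = (closed) set of $m\in\mathcal{P}(\mathcal{W}\times\mathcal{X})$ with first marginal $\lambda$ such that for $m$-a.e. $(w,x)$, $x\in\mathcal{C}(w)$ and $F(m,w,x)=\inf_{y\in\mathcal{C}(w)}F(m,w,y)$. $\mathfrak{C}$ = closed subsets of $\mathcal{P}(\mathcal{W}\times\mathcal{X})$, with upper Vietoris topology generated by the base $\{A\in\mathfrak{C}:A\subset E\}$, $E$ open. $H$ = relative entropy. An LDP with good rate function $I$ means: sublevel sets of $I$ compact, $\limsup\frac1n\log\mathbb{P}(\cdot\in\mathfrak{U})\le-\inf_{\overline{\mathfrak{U}}}I$ and $\liminf\frac1n\log\mathbb{P}(\cdot\in\mathfrak{U})\ge-\inf_{\mathfrak{U}^\circ}I$ for Borel $\mathfrak{U}$. *)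

theory Defs
  imports "HOL-Probability.Probability"
begin

definition Prob_space :: "'a::topological_space measure set" where
  "Prob_space = {m. prob_space m \<and> sets m = sets borel}"

definition weak_top :: "'a::topological_space measure topology" where
  "weak_top = topology_generated_by
     {{m \<in> Prob_space. (\<integral>z. f z \<partial>m) \<in> U} | (f :: 'a \<Rightarrow> real) U.
        continuous_on UNIV f \<and> bounded (range f) \<and> open U}"

definition borel_of :: "'a topology \<Rightarrow> 'a measure" where
  "borel_of T = sigma (topspace T) {U. openin T U}"

definition closed_sets_P :: "'a::topological_space measure set set" where
  "closed_sets_P = {A. closedin weak_top A}"

definition upper_vietoris :: "'a::topological_space measure set topology" where
  "upper_vietoris = topology_generated_by
     {{A \<in> closed_sets_P. A \<subseteq> E} | E. openin weak_top E}"

definition empirical :: "nat \<Rightarrow> (nat \<Rightarrow> 'a::topological_space) \<Rightarrow> 'a measure" where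
  "empirical n z = measure_of UNIV (sets borel)
     (\<lambda>A. ennreal ((\<Sum>i<n. indicator A (z i)) / real n))"

text \<open>The profile x (only x 0, ..., x (n-1) matter) is an eps-Nash equilibrium for
  the type vector w 0, ..., w (n-1).  The deviated measure
  m + (1/n)(delta_{(w_i,y)} - delta_{(w_i,x_i)}) is exactly the empirical measure of the
  profile with x i replaced by y.\<close>
definition eps_Nash ::
  "(('w::topological_space \<times> 'x::topological_space) measure \<Rightarrow> 'w \<Rightarrow> 'x \<Rightarrow> real)
     \<Rightarrow> ('w \<Rightarrow> 'x set) \<Rightarrow> real \<Rightarrow> nat
     \<Rightarrow> (nat \<Rightarrow> 'w) \<Rightarrow> (nat \<Rightarrow> 'x) \<Rightarrow> bool"
  where "eps_Nash F C \<epsilon> n w x \<longleftrightarrow>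
    (\<forall>i<n. x i \<in> C (w i)) \<and>
    (\<forall>i<n. F (empirical n (\<lambda>k. (w k, x k))) (w i) (x i)
            - (INF y\<in>C (w i). F (empirical n (\<lambda>k. (w k, (x(i := y)) k))) (w i) y) \<le> \<epsilon>)"

definition Nash_set ::
  "(('w::topological_space \<times> 'x::topological_space) measure \<Rightarrow> 'w \<Rightarrow> 'x \<Rightarrow> real)
     \<Rightarrow> ('w \<Rightarrow> 'x set) \<Rightarrow> real \<Rightarrow> nat \<Rightarrow> (nat \<Rightarrow> 'w) \<Rightarrow> ('w \<times> 'x) measure set" where
  "Nash_set F C \<epsilon> n w = {empirical n (\<lambda>k. (w k, x k)) | x. eps_Nash F C \<epsilon> n w x}"

definition MFE ::
  "(('w::topological_space \<times> 'x::topological_space) measure \<Rightarrow> 'w \<Rightarrow> 'x \<Rightarrow> real)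
     \<Rightarrow> ('w \<Rightarrow> 'x set) \<Rightarrow> 'w measure \<Rightarrow> ('w \<times> 'x) measure set" where
  "MFE F C lam = {m \<in> Prob_space. distr m borel fst = lam \<and>
      (AE z in m. snd z \<in> C (fst z) \<and>
                  F m (fst z) (snd z) = (INF y\<in>C (fst z). F m (fst z) y))}"

text \<open>H(nu | mu) = integral of f log f d mu with f = d nu / d mu if nu << mu, and infinity
  otherwise; the integral is split into positive and negative parts (the negative part
  is always finite).\<close>
definition rel_entropy :: "'a measure \<Rightarrow> 'a measure \<Rightarrow> ereal" where
  "rel_entropy \<nu> \<mu> =
    (if sets \<nu> = sets \<mu> \<and> absolutely_continuous \<mu> \<nu> then
       (let f = (\<lambda>z. enn2real (RN_deriv \<mu> \<nu> z)) in
          enn2ereal (\<integral>\<^sup>+ z. ennreal (f z * ln (f z)) \<partial>\<mu>)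
        - enn2ereal (\<integral>\<^sup>+ z. ennreal (- (f z * ln (f z))) \<partial>\<mu>))
     else \<infinity>)"

definition logp :: "real \<Rightarrow> ereal" where
  "logp p = (if p \<le> 0 then - \<infinity> else ereal (ln p))"

definition LDP :: "'b topology \<Rightarrow> 'o measure \<Rightarrow> (nat \<Rightarrow> 'o \<Rightarrow> 'b) \<Rightarrow> ('b \<Rightarrow> ereal) \<Rightarrow> bool"
  where "LDP T M Z I \<longleftrightarrow>
    (\<forall>a::real. compactin T {A \<in> topspace T. I A \<le> ereal a}) \<and>
    (\<forall>n\<ge>1. Z n \<in> M \<rightarrow>\<^sub>M borel_of T) \<and>
    (\<forall>U \<in> sets (borel_of T).
       limsup (\<lambda>n. ereal (1 / real n) * logp (measure M {\<omega> \<in> space M. Z n \<omega> \<in> U}))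
         \<le> - (INF A \<in> T closure_of U. I A) \<and>
       liminf (\<lambda>n. ereal (1 / real n) * logp (measure M {\<omega> \<in> space M. Z n \<omega> \<in> U}))
         \<ge> - (INF A \<in> T interior_of U. I A))"

end

theory Submission
  imports Defs
begin

text \<open>The idea is a contraction principle. If the empirical measure of the types is close to \<open>\<lambda>\<close> and
  \<open>n\<close> is large, every \<open>\<epsilon>\<^sub>n\<close>-Nash equilibrium lies in a given neighbourhood of \<open>\<M>(\<lambda>)\<close>: the action space
  being compact, the empirical measures of such equilibria have cluster points, and these are mean
  field equilibria for \<open>\<lambda>\<close>, since a single deviation moves the empirical measure by at most \<open>2/n\<close>.
  Hence \<open>\<lambda> \<mapsto> \<M>(\<lambda>)\<close> is continuous into the upper Vietoris topology, and Sanov's theorem for the types is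
  transported to the sets of equilibria. Since \<open>\<lambda>\<close> is the first marginal of every element of \<open>\<M>(\<lambda>)\<close>,
  the rate function \<open>J\<close> is the relative entropy at the unique preimage.

  Compactness of sets of measures always comes from the same source: a cluster point of the integration
  functionals is represented by a measure as soon as it is continuous along decreasing sequences of
  functions. This replaces Prohorov's theorem, and it applies to relative entropy sublevels via the
  Donsker--Varadhan inequality.\<close>

section \<open>Weak convergence\<close>

text \<open>The upper Vietoris topology is not Hausdorff: if \<open>A \<subseteq> B\<close>, every
  open set around \<open>B\<close> contains \<open>A\<close>. Open covers are therefore pulled back
  to laws by hand, both for compactness of the sublevels of \<open>J\<close> and for the upper
  bound. Continuity of \<open>MFE\<close> alone would not suffice, since for finite \<open>n\<close>
  the random set is \<open>Nash_set\<close> and not \<open>MFE\<close> of the empirical law. Both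
  are put under a single condition \<open>near_MFE \<delta>\<close>, which lets the measure itself
  be perturbed when a player deviates, and one compactness argument over pairs of a neighbourhood of
  the law and a tolerance \<delta> yields a neighbourhood serving both.

  \<open>weak_top\<close> is given by test functions and is not metrised here, so limits are taken
  along filters. The Daniell condition is tested on one decreasing sequence at a time; exponential
  moments (for entropy), tight families and convergent marginals each deliver it directly.\<close>

definition Cb :: "('a::topological_space \<Rightarrow> real) set" where
  "Cb = {f. continuous_on UNIV f \<and> bounded (range f)}"

lemma CbI: "continuous_on UNIV f \<Longrightarrow> (\<And>x. \<bar>f x\<bar> \<le> B) \<Longrightarrow> f \<in> Cb"
  by (auto simp: Cb_def bounded_iff)

lemma Cb_continuous: "f \<in> Cb \<Longrightarrow> continuous_on UNIV f"
  by (simp add: Cb_def)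

lemma Cb_bound: "f \<in> Cb \<Longrightarrow> \<exists>B\<ge>0. \<forall>x. \<bar>f x\<bar> \<le> B"
  proof -
  assume "f \<in> Cb"
  then obtain B where B: "\<And>x. \<bar>f x\<bar> \<le> B" by (auto simp: Cb_def bounded_iff)
  then have "B \<ge> 0" using abs_ge_zero[of "f undefined"] order_trans by blast
  with B show ?thesis by blast
qed

lemma Cb_measurable [measurable_dest]: "f \<in> Cb \<Longrightarrow> f \<in> borel_measurable borel"
  by (simp add: Cb_def borel_measurable_continuous_onI)

lemma Cb_const: "(\<lambda>_. c) \<in> Cb"
  by (rule CbI[of _ "\<bar>c\<bar>"]) auto

lemma Cb_add: "f \<in> Cb \<Longrightarrow> g \<in> Cb \<Longrightarrow> (\<lambda>x. f x + g x) \<in> Cb"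
  by (auto simp: Cb_def intro!: continuous_on_add bounded_plus_comp)

lemma Cb_mult: assumes "f \<in> Cb" "g \<in> Cb" shows "(\<lambda>x. f x * g x) \<in> Cb"
proof -
  obtain A B where "A\<ge>0" "\<forall>x. \<bar>f x\<bar> \<le> A" "\<forall>x. \<bar>g x\<bar> \<le> B" using Cb_bound[OF assms(1)] Cb_bound[OF assms(2)] by blast
  then show ?thesis using assms
    by (intro CbI[of _ "A * B"]) (auto simp: abs_mult Cb_def intro!: continuous_intros mult_mono)
qed

lemma Cb_scale: "f \<in> Cb \<Longrightarrow> (\<lambda>x. c * f x) \<in> Cb"
  by (rule Cb_mult[OF Cb_const])

lemma Cb_diff: "f \<in> Cb \<Longrightarrow> g \<in> Cb \<Longrightarrow> (\<lambda>x. f x - g x) \<in> Cb"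
  using Cb_add[of f "\<lambda>x. - 1 * g x"] Cb_scale[of g "-1"] by simp

lemma Cb_min: assumes "f \<in> Cb" "g \<in> Cb" shows "(\<lambda>x. min (f x) (g x)) \<in> Cb"
proof -
  obtain A B where AB: "\<forall>x. \<bar>f x\<bar> \<le> A" "\<forall>x. \<bar>g x\<bar> \<le> B" using Cb_bound[OF assms(1)] Cb_bound[OF assms(2)] by blast
  have "\<bar>min (f x) (g x)\<bar> \<le> A + B" for x
    using AB(1)[rule_format, of x] AB(2)[rule_format, of x] by linarith
  then show ?thesis using assms
    by (intro CbI[of _ "A + B"]) (auto simp: Cb_def intro!: continuous_on_min)
qed

lemma Cb_max: assumes "f \<in> Cb" "g \<in> Cb" shows "(\<lambda>x. max (f x) (g x)) \<in> Cb"
proof -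
  have "(\<lambda>x. max (f x) (g x)) = (\<lambda>x. f x + g x - min (f x) (g x))" by auto
  then show ?thesis using assms by (auto intro!: Cb_diff Cb_add Cb_min)
qed

lemma Cb_sum: "(\<And>i. i \<in> I \<Longrightarrow> f i \<in> Cb) \<Longrightarrow> (\<lambda>x. \<Sum>i\<in>I. f i x) \<in> Cb"
  by (induction I rule: infinite_finite_induct) (auto intro: Cb_add Cb_const)

lemma Cb_compose: "f \<in> Cb \<Longrightarrow> continuous_on UNIV g \<Longrightarrow> (\<lambda>x. f (g x)) \<in> Cb"
  using Cb_bound[of f] by (auto simp: Cb_def bounded_iff intro!: continuous_on_compose2[of UNIV f])

lemma Prob_spaceD:
  assumes "m \<in> Prob_space"
  shows "prob_space m" "sets m = sets borel" "space m = UNIV"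
  using assms sets_eq_imp_space_eq[of m borel] by (auto simp: Prob_space_def)

lemma Prob_space_measurable: "m \<in> Prob_space \<Longrightarrow> measurable m N = measurable borel N"
  by (rule measurable_cong_sets) (auto simp: Prob_spaceD)

lemma Cb_integrable:
  assumes "m \<in> Prob_space" "f \<in> Cb"
  shows "integrable m f"
proof -
  interpret prob_space m using assms Prob_spaceD by auto
  obtain B where "\<forall>x. \<bar>f x\<bar> \<le> B" using Cb_bound[OF assms(2)] by blast
  then show ?thesis
    using assms Cb_measurable[of f]
    by (intro integrable_const_bound[of _ B]) (auto simp: Prob_space_measurable)
qed

lemma topspace_weak_top [simp]: "topspace weak_top = Prob_space"
proof -
  have "Prob_space \<in> {{m \<in> Prob_space. (\<integral>z. f z \<partial>m) \<in> U} | (f :: 'a \<Rightarrow> real) U.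
        continuous_on UNIV f \<and> bounded (range f) \<and> open U}"
    by (rule CollectI, rule exI[of _ "\<lambda>_. 0"], rule exI[of _ UNIV]) auto
  then show ?thesis
    unfolding weak_top_def topology_generated_by_topspace by auto
qed

lemma openin_weak_top_vimage:
  "f \<in> Cb \<Longrightarrow> open U \<Longrightarrow> openin weak_top {m \<in> Prob_space. (\<integral>z. f z \<partial>m) \<in> U}"
  unfolding weak_top_def by (rule topology_generated_by_Basis) (auto simp: Cb_def)

lemma continuous_map_integral:
  "f \<in> Cb \<Longrightarrow> continuous_map weak_top euclideanreal (\<lambda>m. \<integral>z. f z \<partial>m)"
  by (auto simp: continuous_map_def openin_weak_top_vimage)

text \<open>\<open>weak_top\<close> is the initial topology of the integration functionals: its
  generators are their preimages, so it is enough to test one function at a time.\<close>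

lemma continuous_map_into_weak_top:
  fixes g :: "'b \<Rightarrow> 'a::topological_space measure"
  assumes "\<And>x. x \<in> topspace X \<Longrightarrow> g x \<in> Prob_space"
    and "\<And>f. f \<in> Cb \<Longrightarrow> continuous_map X euclideanreal (\<lambda>x. \<integral>z. f z \<partial>g x)"
  shows "continuous_map X weak_top g"
  unfolding weak_top_def
proof (rule continuous_on_generated_topo)
  fix U :: "'a measure set" assume "U \<in> {{m \<in> Prob_space. (\<integral>z. f z \<partial>m) \<in> U} | (f :: 'a \<Rightarrow> real) U.
        continuous_on UNIV f \<and> bounded (range f) \<and> open U}"
  then obtain f V where U: "U = {m \<in> Prob_space. (\<integral>z. f z \<partial>m) \<in> V}" "f \<in> Cb" "open V"
    by (auto simp: Cb_def)
  have "g -` U \<inter> topspace X = {x \<in> topspace X. (\<integral>z. f z \<partial>g x) \<in> V}"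
    using assms(1) U by auto
  then show "openin X (g -` U \<inter> topspace X)"
    using assms(2)[OF U(2)] U(3) by (auto simp: continuous_map_def)
next
  show "g ` topspace X \<subseteq> \<Union> {{m \<in> Prob_space. (\<integral>z. f z \<partial>m) \<in> U} | (f :: 'a \<Rightarrow> real) U.
        continuous_on UNIV f \<and> bounded (range f) \<and> open U}"
    using assms(1) topspace_weak_top[where 'a='a]
    unfolding weak_top_def topology_generated_by_topspace by auto
qed

text \<open>The filter is arbitrary because closedness and compactness are later decided along
  cluster filters rather than sequences. The converse is an induction over the generation of the
  topology from its subbase.\<close>

lemma limitin_weak_top_iff:
  fixes g :: "'b \<Rightarrow> 'a::topological_space measure"
  shows
  "limitin weak_top g l F \<longleftrightarrow> l \<in> Prob_space \<and> eventually (\<lambda>x. g x \<in> Prob_space) F \<and>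
     (\<forall>f\<in>Cb. ((\<lambda>x. \<integral>z. f z \<partial>g x) \<longlongrightarrow> (\<integral>z. f z \<partial>l)) F)" (is "?L = ?R")
proof
  assume L: ?L
  have "((\<lambda>x. \<integral>z. f z \<partial>g x) \<longlongrightarrow> (\<integral>z. f z \<partial>l)) F" if "f \<in> Cb" for f
  proof (rule topological_tendstoI)
    fix U :: "real set" assume "open U" "(\<integral>z. f z \<partial>l) \<in> U"
    then have "eventually (\<lambda>x. g x \<in> {m \<in> Prob_space. (\<integral>z. f z \<partial>m) \<in> U}) F"
      using L that by (intro limitinD[OF L] openin_weak_top_vimage) (auto simp: limitin_def)
    then show "eventually (\<lambda>x. (\<integral>z. f z \<partial>g x) \<in> U) F" by (rule eventually_mono) auto
  qed
  moreover have "eventually (\<lambda>x. g x \<in> Prob_space) F"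
    using L unfolding limitin_def using openin_topspace[of weak_top] by (auto simp del: openin_topspace)
  ultimately show ?R using L by (auto simp: limitin_def)
next
  assume R: ?R
  have "eventually (\<lambda>x. g x \<in> U) F"
    if "generate_topology_on {{m \<in> Prob_space. (\<integral>z. f z \<partial>m) \<in> U} | (f :: 'a \<Rightarrow> real) U.
        continuous_on UNIV f \<and> bounded (range f) \<and> open U} U" "l \<in> U" for U
    using that
  proof (induction rule: generate_topology_on.induct)
    case (Basis s)
    then obtain f V where s: "s = {m \<in> Prob_space. (\<integral>z. f z \<partial>m) \<in> V}" "f \<in> Cb" "open V"
      by (auto simp: Cb_def)
    then have "eventually (\<lambda>x. (\<integral>z. f z \<partial>g x) \<in> V) F"
      using R Basis(2) by (auto simp: tendsto_def)
    with R s show ?case by (auto elim: eventually_elim2)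
  next
    case (UN K)
    then obtain X where "X \<in> K" "eventually (\<lambda>x. g x \<in> X) F" by auto
    then show ?case by (auto elim!: eventually_mono)
  qed (auto intro: eventually_conj)
  then show ?L using R
    by (auto simp: limitin_def) (auto simp: weak_top_def openin_topology_generated_by_iff)
qed

section \<open>Closed sets and filters\<close>

lemma limitin_nhdsin: "l \<in> topspace T \<Longrightarrow> limitin T (\<lambda>x. x) l (nhdsin T l)"
  unfolding limitin_def by (auto simp: eventually_nhdsin)

lemma closure_of_inf_principal:
  assumes "l \<in> T closure_of S"
  shows "inf (nhdsin T l) (principal S) \<noteq> bot"
proof
  assume "inf (nhdsin T l) (principal S) = bot"
  then have "eventually (\<lambda>x. x \<notin> S) (nhdsin T l)"
    by (simp add: trivial_limit_def eventually_inf_principal)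
  then show False using assms by (auto simp: eventually_nhdsin in_closure_of)
qed

text \<open>For a point of the closure, its neighbourhood filter restricted to \<open>S\<close> is
  proper and converges to it; this is the filter to which the hypothesis is applied.\<close>

lemma closedin_by_limits:
  assumes "S \<subseteq> topspace T"
    and "\<And>l G. G \<noteq> bot \<Longrightarrow> limitin T (\<lambda>x. x) l G \<Longrightarrow> eventually (\<lambda>x. x \<in> S) G \<Longrightarrow> l \<in> S"
  shows "closedin T S"
proof -
  have "l \<in> S" if l: "l \<in> T closure_of S" for l
  proof (rule assms(2)[OF closure_of_inf_principal[OF l]])
    have "l \<in> topspace T" using l by (simp add: in_closure_of)
    then show "limitin T (\<lambda>x. x) l (inf (nhdsin T l) (principal S))"
      using limitin_nhdsin[of l T] by (auto simp: limitin_def intro: filter_leD[OF inf_le1])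
    show "eventually (\<lambda>x. x \<in> S) (inf (nhdsin T l) (principal S))"
      by (simp add: eventually_inf_principal)
  qed
  then have "T closure_of S = S" using closure_of_subset[OF assms(1)] by auto
  then show ?thesis by (metis closedin_closure_of)
qed

lemma limit_in_closed:
  assumes "closedin T S" "limitin T (\<lambda>x. x) l G" "frequently (\<lambda>x. x \<in> S) G"
  shows "l \<in> S"
proof (rule ccontr)
  assume "l \<notin> S"
  then have "eventually (\<lambda>x. x \<in> topspace T - S) G"
    using assms by (auto simp: limitin_def closedin_def)
  then have "eventually (\<lambda>x. x \<notin> S) G" by (rule eventually_mono) auto
  then show False using assms(3) by (simp add: frequently_def)
qed

text \<open>Lipschitz functions increasing to the indicator of an open set. \<open>UNIV\<close> is a
  separate case because \<open>infdist\<close> to the empty set is 0 by convention, which would make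
  the function vanish.\<close>

definition bump :: "'a::metric_space set \<Rightarrow> nat \<Rightarrow> 'a \<Rightarrow> real" where
  "bump S k x = (if S = UNIV then 1 else min 1 (real k * infdist x (- S)))"

lemma bump_Cb: "bump S k \<in> Cb"
proof (rule CbI[of _ 1])
  show "continuous_on UNIV (bump S k)"
    unfolding bump_def by (cases "S = UNIV") (auto intro!: continuous_intros)
  show "\<bar>bump S k x\<bar> \<le> 1" for x
    using mult_nonneg_nonneg[OF of_nat_0_le_iff[of k] infdist_nonneg[of x "-S"]]
    by (auto simp: bump_def abs_le_iff)
qed

lemma bump_bounds: "0 \<le> bump S k x" "bump S k x \<le> 1" "x \<notin> S \<Longrightarrow> bump S k x = 0"
  by (auto simp: bump_def infdist_nonneg)

lemma bump_mono: "j \<le> k \<Longrightarrow> bump S j x \<le> bump S k x"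
  using mult_right_mono[of "real j" "real k" "infdist x (- S)"]
  by (auto simp: bump_def infdist_nonneg intro: min.coboundedI2)

lemma bump_le_indicator: "bump S k x \<le> indicator S x"
  using bump_bounds[where S=S and k=k and x=x] by (auto simp: indicator_def)

lemma bump_eventually:
  fixes S :: "'a::metric_space set"
  assumes "open S" "x \<in> S"
  shows "eventually (\<lambda>k. bump S k x = 1) sequentially"
proof (cases "S = UNIV")
  case False
  then have "infdist x (- S) > 0"
    using assms by (intro infdist_pos_not_in_closed) auto
  then obtain N where N: "real N * infdist x (- S) \<ge> 1"
    by (meson reals_Archimedean3 less_imp_le)
  show ?thesis
    using eventually_ge_at_top[of N]
  proof eventually_elim
    case (elim k)
    then have "real k * infdist x (- S) \<ge> 1"
      using N mult_right_mono[of "real N" "real k" "infdist x (-S)"] by (simp add: infdist_nonneg)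
    then show ?case by (simp add: bump_def)
  qed
qed (simp add: bump_def)

lemma bump_tendsto:
  fixes S :: "'a::metric_space set"
  shows "open S \<Longrightarrow> (\<lambda>k. bump S k x) \<longlonglongrightarrow> indicator S x"
  by (cases "x \<in> S") (auto simp: bump_bounds intro: tendsto_eventually bump_eventually)

lemma integral_bump_tendsto:
  fixes S :: "'a::metric_space set"
  assumes "m \<in> Prob_space" "open S"
  shows "(\<lambda>k. \<integral>z. bump S k z \<partial>m) \<longlonglongrightarrow> measure m S"
proof -
  interpret prob_space m using assms Prob_spaceD by auto
  have "(\<lambda>k. \<integral>z. bump S k z \<partial>m) \<longlonglongrightarrow> (\<integral>z. indicator S z \<partial>m)"
    using assms Cb_measurable[OF bump_Cb[of S]] bump_bounds[where S=S]
    by (intro integral_dominated_convergence[where w="\<lambda>_. 1"])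
       (simp_all add: Prob_space_measurable bump_tendsto)
  then show ?thesis using assms by (simp add: Prob_spaceD)
qed

text \<open>Bumps recover the mass of open sets by dominated convergence, and the open sets are an
  intersection-stable generator of the Borel sets.\<close>

lemma Prob_space_eqI:
  fixes m m' :: "'a::metric_space measure"
  assumes m: "m \<in> Prob_space" "m' \<in> Prob_space" and "\<And>f. f \<in> Cb \<Longrightarrow> (\<integral>z. f z \<partial>m) = (\<integral>z. f z \<partial>m')"
  shows "m = m'"
proof (rule measure_eqI_generator_eq[where E="{S. open S}" and \<Omega>=UNIV and A="\<lambda>_. UNIV"])
  interpret m: prob_space m using m Prob_spaceD by auto
  interpret m': prob_space m' using m Prob_spaceD by auto
  show "emeasure m X = emeasure m' X" if "X \<in> {S. open S}" for X
  proof -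
    have "open X" using that by simp
    then have "measure m X = measure m' X"
      using LIMSEQ_unique[OF integral_bump_tendsto[OF m(1), of X]] integral_bump_tendsto[OF m(2), of X]
      unfolding assms(3)[OF bump_Cb] by blast
    then show ?thesis by (simp add: m.emeasure_eq_measure m'.emeasure_eq_measure)
  qed
  show "emeasure m UNIV \<noteq> \<infinity>" by simp
  show "sets m = sigma_sets UNIV {S. open S}" "sets m' = sigma_sets UNIV {S. open S}"
    using m by (simp_all add: Prob_spaceD borel_def)
qed (auto simp: Int_stable_def)

lemma Hausdorff_weak_top: "Hausdorff_space (weak_top :: 'a::metric_space measure topology)"
  unfolding Hausdorff_space_def
proof (intro allI impI)
  fix m m' :: "'a measure"
  assume *: "m \<in> topspace weak_top \<and> m' \<in> topspace weak_top \<and> m \<noteq> m'"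
  then have m: "m \<in> Prob_space" "m' \<in> Prob_space" by simp_all
  have "\<exists>f\<in>Cb. (\<integral>z. f z \<partial>m) \<noteq> (\<integral>z. f z \<partial>m')"
  proof (rule ccontr)
    assume "\<not> ?thesis"
    then have "m = m'" by (intro Prob_space_eqI[OF m]) auto
    with * show False by simp
  qed
  then obtain f where f: "f \<in> Cb" "(\<integral>z. f z \<partial>m) \<noteq> (\<integral>z. f z \<partial>m')" by blast
  obtain U V where UV: "open U" "open V" "(\<integral>z. f z \<partial>m) \<in> U" "(\<integral>z. f z \<partial>m') \<in> V" "U \<inter> V = {}"
    using hausdorff[OF f(2)] by blast
  let ?U = "{m \<in> Prob_space. (\<integral>z. f z \<partial>m) \<in> U}" and ?V = "{m \<in> Prob_space. (\<integral>z. f z \<partial>m) \<in> V}"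
  have "m \<in> ?U" "m' \<in> ?V" "disjnt ?U ?V" using m UV by (auto simp: disjnt_def)
  then show "\<exists>U V. openin weak_top U \<and> openin weak_top V \<and> m \<in> U \<and> m' \<in> V \<and> disjnt U V"
    using openin_weak_top_vimage[OF f(1) UV(1)] openin_weak_top_vimage[OF f(1) UV(2)] by blast
qed

text \<open>The open-set half of the portmanteau theorem: the mass of an open set is the supremum of
  the weakly continuous integrals of its bumps, hence lower semicontinuous.\<close>

lemma open_mass_positive:
  fixes m :: "'a::metric_space measure"
  assumes "limitin weak_top (\<lambda>x. x) m G" "open S" "measure m S > c"
  shows "eventually (\<lambda>m'. measure m' S > c) G"
proof -
  have m: "m \<in> Prob_space" using assms by (simp add: limitin_weak_top_iff)
  have "eventually (\<lambda>k. (\<integral>z. bump S k z \<partial>m) > c) sequentially"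
    using order_tendstoD(1)[OF integral_bump_tendsto[OF m assms(2)] assms(3)] .
  then obtain k where k: "(\<integral>z. bump S k z \<partial>m) > c"
    by (auto simp: eventually_sequentially)
  have "eventually (\<lambda>m'. (\<integral>z. bump S k z \<partial>m') > c) G" "eventually (\<lambda>m'. m' \<in> Prob_space) G"
    using assms(1) order_tendstoD(1)[OF _ k, of "\<lambda>m'. \<integral>z. bump S k z \<partial>m'" G]
    by (auto simp: limitin_weak_top_iff bump_Cb)
  then show ?thesis
  proof eventually_elim
    case (elim m')
    interpret prob_space m' using elim Prob_spaceD by auto
    have "(\<integral>z. bump S k z \<partial>m') \<le> (\<integral>z. indicator S z \<partial>m')"
      using elim assms(2) by (intro integral_mono bump_le_indicator Cb_integrable[OF _ bump_Cb])
        (auto simp: Prob_spaceD integrable_indicator_iff emeasure_eq_measure)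
    then show ?case using elim assms(2) by (simp add: Prob_spaceD)
  qed
qed

section \<open>Image measures and empirical measures\<close>

lemma distr_Prob_space:
  fixes g :: "'a::topological_space \<Rightarrow> 'b::topological_space"
  assumes "m \<in> Prob_space" "continuous_on UNIV g"
  shows "distr m borel g \<in> Prob_space"
proof -
  have "g \<in> m \<rightarrow>\<^sub>M borel"
    unfolding Prob_space_measurable[OF assms(1)] by (rule borel_measurable_continuous_onI[OF assms(2)])
  then show ?thesis
    using Prob_spaceD(1)[OF assms(1)] by (auto simp: Prob_space_def intro: prob_space.prob_space_distr)
qed

lemma integral_distr_continuous:
  fixes g :: "'a::topological_space \<Rightarrow> 'b::topological_space"
  assumes "m \<in> Prob_space" "continuous_on UNIV g" "f \<in> Cb"
  shows "(\<integral>z. f z \<partial>distr m borel g) = (\<integral>z. f (g z) \<partial>m)"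
proof (rule integral_distr)
  show "g \<in> m \<rightarrow>\<^sub>M borel"
    unfolding Prob_space_measurable[OF assms(1)] by (rule borel_measurable_continuous_onI[OF assms(2)])
qed (rule Cb_measurable[OF assms(3)])

text \<open>\<open>measure_of\<close> yields the intended values only for a countably additive set
  function; recognising the image of the uniform measure on the indices supplies this and reduces
  integrals to finite averages. For \<open>n = 0\<close> the set function is zero, not a
  probability.\<close>

lemma empirical_eq:
  assumes "n \<ge> 1"
  shows "empirical n z = distr (uniform_count_measure {..<n}) borel z"
proof -
  let ?D = "distr (uniform_count_measure {..<n}) borel z"
  have e: "emeasure ?D A = ennreal ((\<Sum>i<n. indicator A (z i)) / real n)" if "A \<in> sets borel" for A
  proof -
    have "emeasure ?D A = emeasure (uniform_count_measure {..<n}) (z -` A \<inter> {..<n})"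
      using that by (subst emeasure_distr) (auto simp: uniform_count_measure_def space_point_measure)
    also have "\<dots> = ennreal (real (card (z -` A \<inter> {..<n})) / real n)"
      by (subst emeasure_uniform_count_measure) auto
    also have "real (card (z -` A \<inter> {..<n})) = (\<Sum>i<n. indicator A (z i))"
      by (simp add: indicator_def sum.If_cases Int_def vimage_def conj_commute flip: of_nat_sum)
    finally show ?thesis .
  qed
  have "sigma_sets UNIV (sets borel) = (sets borel :: 'a set set)"
    using sets.sigma_sets_eq[of "borel :: 'a measure"] by simp
  then have "empirical n z = measure_of UNIV (sets borel) (emeasure ?D)"
    unfolding empirical_def using e by (intro measure_of_eq) auto
  also have "\<dots> = ?D"
    using measure_of_of_measure[of ?D] by simp
  finally show ?thesis .
qed

lemma uniform_count_measure_prob: "n \<ge> 1 \<Longrightarrow> prob_space (uniform_count_measure {..<n::nat})"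
  by (intro prob_space_uniform_count_measure) (auto simp: lessThan_empty_iff)

lemma measurable_uniform_count_measure:
  "measurable (uniform_count_measure {..<n::nat}) (borel :: 'a::topological_space measure) = UNIV"
  by (auto simp: measurable_def space_uniform_count_measure sets_uniform_count_measure)

lemma empirical_Prob_space: "n \<ge> 1 \<Longrightarrow> empirical n z \<in> Prob_space"
  unfolding Prob_space_def empirical_eq
  by (auto intro!: prob_space.prob_space_distr uniform_count_measure_prob
      simp: measurable_uniform_count_measure)

lemma integral_empirical:
  fixes f :: "'a::topological_space \<Rightarrow> real"
  assumes "n \<ge> 1" "f \<in> borel_measurable borel"
  shows "(\<integral>x. f x \<partial>empirical n z) = (\<Sum>i<n. f (z i)) / real n"
proof -
  have "(\<integral>x. f x \<partial>empirical n z) = (\<integral>i. f (z i) \<partial>uniform_count_measure {..<n})"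
    unfolding empirical_eq[OF assms(1)]
    by (rule integral_distr[OF _ assms(2)]) (simp add: measurable_uniform_count_measure)
  also have "\<dots> = (\<Sum>i<n. f (z i)) / real n"
    by (simp add: uniform_count_measure_def lebesgue_integral_point_measure_finite sum_divide_distrib)
  finally show ?thesis .
qed

lemma measure_empirical:
  assumes "n \<ge> 1" "A \<in> sets borel"
  shows "measure (empirical n z) A = (\<Sum>i<n. indicator A (z i)) / real n"
proof -
  have "A \<in> sets (empirical n z)" "space (empirical n z) = UNIV"
    using Prob_spaceD[OF empirical_Prob_space[OF assms(1), of z]] assms(2) by auto
  then have "measure (empirical n z) A = (\<integral>x. indicator A x \<partial>empirical n z)" by simp
  also have "\<dots> = (\<Sum>i<n. indicator A (z i)) / real n"
    using assms by (intro integral_empirical) auto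
  finally show ?thesis .
qed

text \<open>Finite sets are closed in a T1 space, so the complement of the atoms is a Borel null
  set; \<open>P\<close> itself need not be measurable.\<close>

lemma AE_empirical:
  fixes z :: "nat \<Rightarrow> 'a::t1_space"
  assumes "n \<ge> 1" "\<And>i. i < n \<Longrightarrow> P (z i)"
  shows "AE x in empirical n z. P x"
proof (rule AE_I)
  let ?N = "- (z ` {..<n})"
  have N: "?N \<in> sets borel" by (intro borel_open open_Compl finite_imp_closed) auto
  then show "?N \<in> sets (empirical n z)"
    using Prob_spaceD(2)[OF empirical_Prob_space[OF assms(1)]] by blast
  interpret prob_space "empirical n z" using Prob_spaceD(1)[OF empirical_Prob_space[OF assms(1)]] .
  show "emeasure (empirical n z) ?N = 0"
    unfolding emeasure_eq_measure measure_empirical[OF assms(1) N] by simp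
  show "{x \<in> space (empirical n z). \<not> P x} \<subseteq> ?N" using assms(2) by auto
qed

lemma empirical_cong:
  assumes "n \<ge> 1" "\<And>i. i < n \<Longrightarrow> z i = z' i"
  shows "empirical n z = empirical n z'"
  unfolding empirical_eq[OF assms(1)]
  by (intro distr_cong) (use assms(2) in \<open>auto simp: space_uniform_count_measure\<close>)

lemma distr_empirical:
  fixes z :: "nat \<Rightarrow> 'a::topological_space" and g :: "'a \<Rightarrow> 'b::topological_space"
  assumes "n \<ge> 1" "continuous_on UNIV g"
  shows "distr (empirical n z) borel g = empirical n (\<lambda>i. g (z i))"
proof -
  have "g \<in> borel_measurable borel" by (rule borel_measurable_continuous_onI[OF assms(2)])
  then show ?thesis unfolding empirical_eq[OF assms(1)]
    by (subst distr_distr) (auto simp: measurable_uniform_count_measure o_def)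
qed

lemma continuous_map_empirical:
  fixes h :: "'b \<Rightarrow> nat \<Rightarrow> 'a::topological_space"
  assumes "n \<ge> 1" "\<And>i. i < n \<Longrightarrow> continuous_map X euclidean (\<lambda>x. h x i)"
  shows "continuous_map X weak_top (\<lambda>x. empirical n (h x))"
proof (rule continuous_map_into_weak_top)
  show "empirical n (h x) \<in> Prob_space" for x by (rule empirical_Prob_space[OF assms(1)])
  fix f :: "'a \<Rightarrow> real" assume f: "f \<in> Cb"
  then have *: "continuous_map euclidean euclideanreal f" by (simp add: Cb_def)
  then have "continuous_map X euclideanreal (\<lambda>x. f (h x i))" if "i < n" for i
    using continuous_map_compose[OF assms(2)[OF that] *] by (simp add: o_def)
  then have "continuous_map X euclideanreal (\<lambda>x. (\<Sum>i<n. f (h x i)) / real n)"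
    unfolding divide_inverse
    by (intro continuous_map_real_mult continuous_map_sum) auto
  then show "continuous_map X euclideanreal (\<lambda>x. \<integral>z. f z \<partial>empirical n (h x))"
    unfolding integral_empirical[OF assms(1) Cb_measurable[OF f]] .
qed

section \<open>A Daniell representation theorem\<close>

text \<open>On a noncompact space a positive normalised functional on \<open>Cb\<close> may come
  from a merely finitely additive set function; \<open>L_daniell\<close> excludes this. It is the
  countable additivity of the measure to be built.\<close>

locale daniell_functional =
  fixes L :: "('a::metric_space \<Rightarrow> real) \<Rightarrow> real"
  assumes L_add: "f \<in> Cb \<Longrightarrow> g \<in> Cb \<Longrightarrow> L (\<lambda>x. f x + g x) = L f + L g"
    and L_scale: "f \<in> Cb \<Longrightarrow> L (\<lambda>x. c * f x) = c * L f"
    and L_nonneg: "f \<in> Cb \<Longrightarrow> (\<And>x. 0 \<le> f x) \<Longrightarrow> 0 \<le> L f"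
    and L_one: "L (\<lambda>_. 1) = 1"
    and L_daniell: "(\<And>k. h k \<in> Cb) \<Longrightarrow> (\<And>x. decseq (\<lambda>k. h k x)) \<Longrightarrow>
      (\<And>x. (\<lambda>k. h k x) \<longlonglongrightarrow> 0) \<Longrightarrow> (\<lambda>k. L (h k :: 'a \<Rightarrow> real)) \<longlonglongrightarrow> 0"
begin

lemma L_diff: "f \<in> Cb \<Longrightarrow> g \<in> Cb \<Longrightarrow> L (\<lambda>x. f x - g x) = L f - L g"
  using L_add[of f "\<lambda>x. - 1 * g x"] L_scale[of g "-1"] Cb_scale[of g "-1"] by simp

lemma L_mono: "f \<in> Cb \<Longrightarrow> g \<in> Cb \<Longrightarrow> (\<And>x. f x \<le> g x) \<Longrightarrow> L f \<le> L g"
  using L_nonneg[of "\<lambda>x. g x - f x"] L_diff[of g f] Cb_diff[of g f] by simp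

lemma L_const: "L (\<lambda>_. c) = c"
  using L_scale[OF Cb_const[of 1], of c] L_one by simp

lemma L_sum: "(\<And>i. i \<in> I \<Longrightarrow> f i \<in> Cb) \<Longrightarrow> L (\<lambda>x. \<Sum>i\<in>I. f i x) = (\<Sum>i\<in>I. L (f i))"
  by (induction I rule: infinite_finite_induct) (auto simp: L_const L_add Cb_sum)

definition sub_indicator :: "'a set \<Rightarrow> ('a \<Rightarrow> real) set" where
  "sub_indicator U = {f \<in> Cb. \<forall>x. 0 \<le> f x \<and> f x \<le> indicator U x}"

text \<open>With \<open>outer_mass\<close> this is the Riesz construction: open sets are measured
  from inside by functions, then arbitrary sets from outside by open sets. The functions are not
  asked to have compact support, as the space need not be locally compact.\<close>

definition inner_mass :: "'a set \<Rightarrow> ennreal" where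
  "inner_mass U = (SUP f\<in>sub_indicator U. ennreal (L f))"

definition outer_mass :: "'a set \<Rightarrow> ennreal" where
  "outer_mass A = (INF U\<in>{U. open U \<and> A \<subseteq> U}. inner_mass U)"

lemma sub_indicatorD:
  assumes "f \<in> sub_indicator U"
  shows "f \<in> Cb" "0 \<le> f x" "f x \<le> indicator U x" "f x \<le> 1" "x \<notin> U \<Longrightarrow> f x = 0" "0 \<le> L f" "L f \<le> 1"
proof -
  show *: "f \<in> Cb" "0 \<le> f x" "f x \<le> indicator U x" "0 \<le> L f" for x
    using assms by (auto simp: sub_indicator_def intro: L_nonneg)
  show **: "f x \<le> 1" for x using *(3)[of x] by (rule order_trans) (simp add: indicator_def)
  show "x \<notin> U \<Longrightarrow> f x = 0" using *(2,3)[of x] by simp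
  show "L f \<le> 1" using L_mono[OF *(1) Cb_const[of 1]] ** by (simp add: L_one)
qed

lemma bump_sub_indicator: "bump U k \<in> sub_indicator U"
  by (auto simp: sub_indicator_def bump_Cb bump_bounds bump_le_indicator)

lemma sub_indicator_mono:
  assumes "U \<subseteq> U'"
  shows "sub_indicator U \<subseteq> sub_indicator U'"
proof
  fix f assume f: "f \<in> sub_indicator U"
  have "indicator U x \<le> (indicator U' x :: real)" for x
    using assms by (auto simp: indicator_def)
  then have "f x \<le> indicator U' x" for x
    using sub_indicatorD(3)[OF f, of x] order_trans by blast
  then show "f \<in> sub_indicator U'"
    using sub_indicatorD(1,2)[OF f] by (simp add: sub_indicator_def)
qed

lemma inner_mass_upper: "f \<in> sub_indicator U \<Longrightarrow> ennreal (L f) \<le> inner_mass U"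
  unfolding inner_mass_def by (rule SUP_upper)

lemma inner_mass_mono: "U \<subseteq> U' \<Longrightarrow> inner_mass U \<le> inner_mass U'"
  unfolding inner_mass_def by (intro SUP_subset_mono sub_indicator_mono) auto

lemma inner_mass_le_1: "inner_mass U \<le> 1"
  unfolding inner_mass_def by (rule SUP_least) (use sub_indicatorD(7) in \<open>auto simp flip: ennreal_1 intro: ennreal_leI\<close>)

lemma inner_mass_empty: "inner_mass {} = 0"
proof -
  have "L f = 0" if "f \<in> sub_indicator {}" for f
  proof -
    have "f = (\<lambda>_. 0)" using sub_indicatorD(5)[OF that] by auto
    then show ?thesis by (simp add: L_const)
  qed
  then have "inner_mass {} \<le> 0" unfolding inner_mass_def by (intro SUP_least) simp
  then show ?thesis by simp
qed

lemma outer_mass_open: "open U \<Longrightarrow> outer_mass U = inner_mass U"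
  unfolding outer_mass_def by (rule antisym) (auto intro: INF_lower INF_greatest inner_mass_mono)

lemma outer_mass_le_inner_mass: "open U \<Longrightarrow> A \<subseteq> U \<Longrightarrow> outer_mass A \<le> inner_mass U"
  unfolding outer_mass_def by (rule INF_lower) auto

lemma outer_mass_le_1: "outer_mass A \<le> 1"
  using order_trans[OF outer_mass_le_inner_mass[of UNIV A] inner_mass_le_1] by auto

lemma outer_mass_mono: "A \<subseteq> B \<Longrightarrow> outer_mass A \<le> outer_mass B"
  unfolding outer_mass_def by (rule INF_superset_mono) auto

text \<open>Countable additivity enters here, through \<open>L_daniell\<close>: a function below the
  indicator of the union is exhausted by its minima with finite sums of bumps, and each such sum is
  charged to the individual sets.\<close>

lemma inner_mass_countable_subadditive:
  fixes U :: "nat \<Rightarrow> 'a set"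
  assumes U: "\<And>i. open (U i)"
  shows "inner_mass (\<Union>i. U i) \<le> (\<Sum>i. inner_mass (U i))"
  unfolding inner_mass_def[of "\<Union>i. U i"]
proof (rule SUP_least)
  fix f assume f: "f \<in> sub_indicator (\<Union>i. U i)"
  note fD = sub_indicatorD[OF f]
  \<comment> \<open>A single index \<open>k\<close> bounds both the number of sets and the steepness
    of the bumps. So \<open>h\<close> increases with \<open>k\<close>, and at each point it
    eventually equals \<open>f\<close>.\<close>
  define h where "h k x = min (f x) (\<Sum>i<k. bump (U i) k x)" for k x
  have hCb: "h k \<in> Cb" for k
    unfolding h_def by (intro Cb_min fD Cb_sum bump_Cb)
  have h_mono: "h j x \<le> h k x" if "j \<le> k" for j k x
  proof -
    have "(\<Sum>i<j. bump (U i) j x) \<le> (\<Sum>i<j. bump (U i) k x)"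
      by (intro sum_mono bump_mono that)
    also have "\<dots> \<le> (\<Sum>i<k. bump (U i) k x)"
      by (intro sum_mono2) (use that in \<open>auto simp: bump_bounds\<close>)
    finally show ?thesis unfolding h_def by (intro min.mono) auto
  qed
  have "(\<lambda>k. L (\<lambda>x. f x - h k x)) \<longlonglongrightarrow> 0"
  proof (rule L_daniell)
    show "(\<lambda>x. f x - h k x) \<in> Cb" for k by (intro Cb_diff fD hCb)
    show "decseq (\<lambda>k. f x - h k x)" for x by (auto simp: decseq_def intro: h_mono)
    show "(\<lambda>k. f x - h k x) \<longlonglongrightarrow> 0" for x
    proof (cases "x \<in> (\<Union>i. U i)")
      case True
      then obtain i where i: "x \<in> U i" by auto
      have "eventually (\<lambda>k. f x - h k x = 0) sequentially"
        using bump_eventually[OF U i] eventually_gt_at_top[of i]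
      proof eventually_elim
        case (elim k)
        have "bump (U i) k x \<le> (\<Sum>i<k. bump (U i) k x)"
          using elim(2) by (intro member_le_sum) (auto simp: bump_bounds)
        then show ?case using elim(1) fD(4)[of x] by (simp add: h_def)
      qed
      then show ?thesis by (rule tendsto_eventually)
    next
      case False
      then have "f x = 0" "h k x = 0" for k
        using fD(5) False by (auto simp: h_def bump_bounds)
      then show ?thesis by simp
    qed
  qed
  then have "(\<lambda>k. (\<Sum>i. inner_mass (U i)) + ennreal (L (\<lambda>x. f x - h k x))) \<longlonglongrightarrow> (\<Sum>i. inner_mass (U i)) + ennreal 0"
    by (intro tendsto_add tendsto_const tendsto_ennrealI)
  moreover have "ennreal (L f) \<le> (\<Sum>i. inner_mass (U i)) + ennreal (L (\<lambda>x. f x - h k x))" for k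
  proof -
    have "L (h k) \<le> L (\<lambda>x. \<Sum>i<k. bump (U i) k x)"
      by (rule L_mono[OF hCb]) (auto simp: h_def intro: Cb_sum bump_Cb)
    also have "\<dots> = (\<Sum>i<k. L (bump (U i) k))"
      by (intro L_sum bump_Cb)
    finally have "ennreal (L (h k)) \<le> (\<Sum>i<k. ennreal (L (bump (U i) k)))"
      by (subst sum_ennreal) (auto intro: ennreal_leI sub_indicatorD(6)[OF bump_sub_indicator])
    also have "\<dots> \<le> (\<Sum>i<k. inner_mass (U i))"
      by (intro sum_mono inner_mass_upper bump_sub_indicator)
    also have "\<dots> \<le> (\<Sum>i. inner_mass (U i))" by (rule sum_le_suminf) auto
    finally have *: "ennreal (L (h k)) \<le> (\<Sum>i. inner_mass (U i))" .
    have "0 \<le> L (\<lambda>x. f x - h k x)" by (intro L_nonneg Cb_diff fD hCb) (simp add: h_def)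
    moreover have "0 \<le> L (h k)"
      by (intro L_nonneg hCb) (auto simp: h_def fD bump_bounds intro!: sum_nonneg)
    ultimately have "ennreal (L f) = ennreal (L (h k)) + ennreal (L (\<lambda>x. f x - h k x))"
      using L_diff[OF fD(1) hCb, of k] by (simp flip: ennreal_plus)
    with * show ?thesis by (simp add: add_right_mono)
  qed
  ultimately show "ennreal (L f) \<le> (\<Sum>i. inner_mass (U i))"
    by (intro LIMSEQ_le_const[where X="\<lambda>k. (\<Sum>i. inner_mass (U i)) + ennreal (L (\<lambda>x. f x - h k x))"]) auto
qed

lemma outer_measure_space_outer_mass: "outer_measure_space (Pow UNIV) outer_mass"
  unfolding outer_measure_space_def
proof (intro conjI)
  show "positive (Pow UNIV) outer_mass" by (simp add: positive_def outer_mass_open inner_mass_empty)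
  show "increasing (Pow UNIV) outer_mass" by (auto simp: increasing_def outer_mass_mono)
  show "countably_subadditive (Pow UNIV) outer_mass"
    unfolding countably_subadditive_def
  proof safe
    fix A :: "nat \<Rightarrow> 'a set"
    show "outer_mass (\<Union>i. A i) \<le> (\<Sum>i. outer_mass (A i))"
    proof (rule ennreal_le_epsilon)
      fix e :: real assume e: "0 < e"
      have "\<exists>U. open U \<and> A n \<subseteq> U \<and> inner_mass U \<le> outer_mass (A n) + ennreal (e * (1/2)^Suc n)" for n
      proof -
        have "outer_mass (A n) < outer_mass (A n) + ennreal (e * (1/2)^Suc n)"
          using outer_mass_le_1[of "A n"] e
          by (cases "outer_mass (A n)" rule: ennreal_cases) (auto simp: ennreal_less_iff top_unique simp flip: ennreal_plus)
        then have "\<exists>U\<in>{U. open U \<and> A n \<subseteq> U}. inner_mass U < outer_mass (A n) + ennreal (e * (1/2)^Suc n)"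
          unfolding outer_mass_def[of "A n"] INF_less_iff .
        then show ?thesis by (auto intro: less_imp_le)
      qed
      then obtain U where U: "\<And>n. open (U n)" "\<And>n. A n \<subseteq> U n"
        "\<And>n. inner_mass (U n) \<le> outer_mass (A n) + ennreal (e * (1/2)^Suc n)" by metis
      have "outer_mass (\<Union>i. A i) \<le> inner_mass (\<Union>i. U i)"
        using U by (intro outer_mass_le_inner_mass) (blast, blast)
      also have "\<dots> \<le> (\<Sum>i. inner_mass (U i))" by (rule inner_mass_countable_subadditive[OF U(1)])
      also have "\<dots> \<le> (\<Sum>n. outer_mass (A n) + ennreal (e * (1/2)^Suc n))"
        by (intro suminf_le U) auto
      also have "\<dots> = (\<Sum>n. outer_mass (A n)) + (\<Sum>n. ennreal e * ennreal ((1/2)^Suc n))"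
        using e by (subst suminf_add[symmetric])
          (auto simp del: ennreal_suminf_cmult simp add: ennreal_mult[symmetric])
      also have "\<dots> = (\<Sum>n. outer_mass (A n)) + ennreal e"
        unfolding ennreal_suminf_cmult
        by (subst suminf_ennreal_eq[OF zero_le_power power_half_series]) auto
      finally show "outer_mass (\<Union>i. A i) \<le> (\<Sum>n. outer_mass (A n)) + ennreal e" .
    qed
  qed
qed

text \<open>A function \<open>f\<close> carried by \<open>U \<inter> Q\<close> and a function
  \<open>h\<close> carried near the rest of \<open>A\<close> may overlap where \<open>f\<close> is
  small. Cutting \<open>f\<close> off at level \<open>e\<close> removes the overlap:
  \<open>max (f x - e) 0\<close> vanishes on \<open>Q'\<close>, so the sum stays below the indicator
  of \<open>Q\<close>, at the price of at most \<open>e\<close> in \<open>L f\<close>.\<close>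

lemma outer_mass_split_open:
  assumes "open U"
  shows "outer_mass (U \<inter> A) + outer_mass (A - U) \<le> outer_mass A"
  unfolding outer_mass_def[of A]
proof (rule INF_greatest)
  fix Q assume "Q \<in> {U. open U \<and> A \<subseteq> U}"
  then have Q: "open Q" "A \<subseteq> Q" by auto
  have 1: "ennreal (L f) + outer_mass (A - U) \<le> inner_mass Q" if f: "f \<in> sub_indicator (U \<inter> Q)" for f
  proof (rule ennreal_le_epsilon)
    fix e :: real assume e: "0 < e"
    note fD = sub_indicatorD[OF f]
    define Q' where "Q' = Q \<inter> {x. f x < e}"
    have "open Q'" unfolding Q'_def
      using Q(1) Cb_continuous[OF fD(1)] by (intro open_Int open_Collect_less) auto
    moreover have "A - U \<subseteq> Q'" using Q(2) fD(5) e by (auto simp: Q'_def)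
    ultimately have "outer_mass (A - U) \<le> inner_mass Q'" by (intro outer_mass_le_inner_mass)
    have "ennreal (L f) + ennreal (L h) \<le> inner_mass Q + ennreal e" if h: "h \<in> sub_indicator Q'" for h
    proof -
      note hD = sub_indicatorD[OF h]
      have 0: "(\<lambda>x. max (f x - e) 0) \<in> Cb" by (intro Cb_max Cb_diff fD Cb_const)
      have "(\<lambda>x. max (f x - e) 0 + h x) \<in> sub_indicator Q"
        unfolding sub_indicator_def
      proof (intro CollectI conjI allI)
        show "(\<lambda>x. max (f x - e) 0 + h x) \<in> Cb" by (intro Cb_add 0 hD)
        fix x
        show "0 \<le> max (f x - e) 0 + h x" using hD(2)[of x] by simp
        show "max (f x - e) 0 + h x \<le> indicator Q x"
        proof (cases "f x < e")
          case True
          have "indicator Q' x \<le> (indicator Q x :: real)" by (auto simp: Q'_def indicator_def)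
          with hD(3)[of x] True show ?thesis by simp
        next
          case False
          then have "h x = 0" using hD(5)[of x] by (auto simp: Q'_def)
          moreover have "indicator (U \<inter> Q) x \<le> (indicator Q x :: real)" by (auto simp: indicator_def)
          ultimately show ?thesis using fD(3)[of x] False e by simp
        qed
      qed
      from inner_mass_upper[OF this] have "ennreal (L (\<lambda>x. max (f x - e) 0) + L h) \<le> inner_mass Q"
        by (simp add: L_add 0 hD)
      moreover have "L f \<le> L (\<lambda>x. max (f x - e) 0 + e)"
        by (intro L_mono fD Cb_add 0 Cb_const) simp
      then have "L f + L h \<le> L (\<lambda>x. max (f x - e) 0) + L h + e"
        by (simp add: L_add 0 Cb_const L_const)
      moreover have "0 \<le> L (\<lambda>x. max (f x - e) 0)" by (intro L_nonneg 0) simp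
      ultimately show ?thesis
        using e fD(6) hD(6)
        by (smt (verit) add_mono ennreal_leI ennreal_plus order_refl order_trans)
    qed
    then have "ennreal (L f) + inner_mass Q' \<le> inner_mass Q + ennreal e"
      unfolding inner_mass_def[of Q'] using bump_sub_indicator[of Q' 0]
      by (subst ennreal_SUP_add_right) (auto intro!: SUP_least)
    with \<open>outer_mass (A - U) \<le> inner_mass Q'\<close> show "ennreal (L f) + outer_mass (A - U) \<le> inner_mass Q + ennreal e"
      by (meson add_left_mono order_trans)
  qed
  have "outer_mass (U \<inter> A) \<le> inner_mass (U \<inter> Q)"
    using Q assms by (intro outer_mass_le_inner_mass) auto
  moreover have "inner_mass (U \<inter> Q) + outer_mass (A - U) \<le> inner_mass Q"
    unfolding inner_mass_def[of "U \<inter> Q"] using bump_sub_indicator[of "U \<inter> Q" 0] 1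
    by (subst ennreal_SUP_add_left[symmetric]) (auto intro!: SUP_least)
  ultimately show "outer_mass (U \<inter> A) + outer_mass (A - U) \<le> inner_mass Q"
    by (meson add_right_mono order_trans)
qed

lemma measure_space_outer: "measure_space UNIV (sets borel) outer_mass"
proof -
  interpret sigma_algebra UNIV "Pow UNIV :: 'a set set" by (rule sigma_algebra_Pow)
  have ms: "measure_space UNIV (lambda_system UNIV (Pow UNIV) outer_mass) outer_mass"
    by (rule caratheodory_lemma[OF outer_measure_space_outer_mass])
  then have sa: "sigma_algebra UNIV (lambda_system UNIV (Pow UNIV) outer_mass)"
    by (simp add: measure_space_def)
  have op: "U \<in> lambda_system UNIV (Pow UNIV) outer_mass" if "open U" for U
  proof -
    have "outer_mass A \<le> outer_mass (U \<inter> A) + outer_mass (A - U)" for A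
    proof -
      have sub: "subadditive (Pow UNIV) outer_mass"
        using outer_measure_space_outer_mass
        by (intro countably_subadditive_subadditive) (auto simp: outer_measure_space_def)
      have "outer_mass ((U \<inter> A) \<union> (A - U)) \<le> outer_mass (U \<inter> A) + outer_mass (A - U)"
        by (rule subadditiveD[OF sub]) auto
      moreover have "(U \<inter> A) \<union> (A - U) = A" by auto
      ultimately show ?thesis by simp
    qed
    then have "outer_mass (U \<inter> A) + outer_mass ((UNIV - U) \<inter> A) = outer_mass A" for A
      using outer_mass_split_open[OF that, of A] by (metis Diff_Compl Compl_eq_Diff_UNIV Diff_eq inf_commute antisym)
    then show ?thesis by (simp add: lambda_system_def)
  qed
  have "sets borel \<subseteq> lambda_system UNIV (Pow UNIV) outer_mass"
    unfolding borel_def using sigma_algebra.sigma_sets_subset[OF sa, of "{S. open S}"] op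
    by (auto simp: sets_measure_of_conv)
  moreover have "sigma_algebra UNIV (sets (borel :: 'a measure))"
    using sets.sigma_algebra_axioms[of "borel :: 'a measure"] by simp
  ultimately show ?thesis by (intro measure_down[OF ms])
qed

theorem representation:
  obtains m where "m \<in> Prob_space" "\<And>f. f \<in> Cb \<Longrightarrow> (\<integral>x. f x \<partial>m) = L f"
proof -
  define m where "m = measure_of UNIV (sets borel) outer_mass"
  have sb: "sigma_sets UNIV (sets borel) = (sets borel :: 'a set set)"
    using sets.sigma_sets_eq[of "borel :: 'a measure"] by simp
  have sm: "sets m = sets borel" "space m = UNIV"
    unfolding m_def by (simp_all add: sb)
  have em: "emeasure m A = outer_mass A" if "A \<in> sets borel" for A
    unfolding m_def using measure_space_outer that
    by (intro emeasure_measure_of_sigma) (auto simp: measure_space_def)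
  have "inner_mass UNIV = 1"
  proof (rule antisym[OF inner_mass_le_1])
    have "(\<lambda>_. 1) \<in> sub_indicator UNIV" by (auto simp: sub_indicator_def Cb_const)
    from inner_mass_upper[OF this] show "1 \<le> inner_mass UNIV" by (simp add: L_one)
  qed
  then interpret prob_space m
    by (intro prob_spaceI) (simp add: sm em outer_mass_open)
  have m: "m \<in> Prob_space" using prob_space_axioms sm by (simp add: Prob_space_def)
  have mo: "ennreal (measure m U) = inner_mass U" if "open U" for U
    using em[of U] that by (simp add: emeasure_eq_measure outer_mass_open)
  text \<open>Slicing \<open>f\<close> into \<open>N\<close> layers of height \<open>1/N\<close> gives \<open>L f \<le> \<integral>f + 1/N\<close>; the
    reverse inequality is this one for \<open>1 - f\<close>.\<close>
  have le: "L f \<le> (\<integral>x. f x \<partial>m)" if f: "f \<in> Cb" "\<And>x. 0 \<le> f x" "\<And>x. f x \<le> 1" for f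
  proof -
    have "L f \<le> (\<integral>x. f x \<partial>m) + 1 / real (Suc N)" for N
    proof -
      define g where "g j x = min (max (f x * Suc N - real j) 0) 1" for j x
      define U where "U j = {x. real j < f x * Suc N}" for j
      have U: "open (U j)" for j
        unfolding U_def using Cb_continuous[OF f(1)] by (intro open_Collect_less continuous_intros) auto
      have gCb: "g j \<in> Cb" for j
        unfolding g_def using f(1) Cb_scale[OF f(1), of "real (Suc N)"]
        by (intro Cb_min Cb_max Cb_diff Cb_const) (simp add: mult.commute)
      have gsub: "g j \<in> sub_indicator (U j)" for j
        unfolding sub_indicator_def using gCb by (auto simp: g_def U_def indicator_def)
      have fg: "(\<Sum>j<Suc N. g j x) = f x * Suc N" for x
      proof -
        have ind: "(\<Sum>j<n. min (max (s - real j) 0) 1) = min (max s 0) (real n)" for s :: real and n :: nat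
          by (induction n) auto
        show ?thesis
          using ind[of "f x * Suc N" "Suc N"]
            f(2,3)[of x] mult_right_mono[of "f x" 1 "Suc N"] by (simp add: g_def del: sum.lessThan_Suc of_nat_Suc)
      qed
      have LU: "L (g j) \<le> measure m (U j)" for j
        using inner_mass_upper[OF gsub] by (simp flip: mo[OF U])
      have "L (\<lambda>x. \<Sum>j<Suc N. g j x) = real (Suc N) * L f"
        unfolding fg using L_scale[OF f(1), of "real (Suc N)"] by (simp add: mult.commute)
      then have "real (Suc N) * L f = (\<Sum>j<Suc N. L (g j))" by (simp only: L_sum[OF gCb])
      also have "\<dots> \<le> (\<Sum>j<Suc N. measure m (U j))" by (intro sum_mono LU)
      also have "\<dots> = (\<integral>x. (\<Sum>j<Suc N. indicator (U j) x) \<partial>m)"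
        by (subst Bochner_Integration.integral_sum) (use U sm in \<open>auto intro!: integrable_real_indicator simp: emeasure_eq_measure\<close>)
      also have "\<dots> \<le> (\<integral>x. f x * Suc N + 1 \<partial>m)"
      proof (rule integral_mono)
        show "integrable m (\<lambda>x. \<Sum>j<Suc N. indicator (U j) x :: real)"
          using U sm by (intro Bochner_Integration.integrable_sum integrable_real_indicator) (auto simp: emeasure_eq_measure)
        show "integrable m (\<lambda>x. f x * Suc N + 1)"
          using Cb_integrable[OF m f(1)] by auto
        fix x
        show "(\<Sum>j<Suc N. indicator (U j) x) \<le> f x * Suc N + 1"
        proof -
          have ind: "(\<Sum>j<n. if real j < t then 1 else 0) \<le> min (t + 1) (real n)" if "t \<ge> 0" for t :: real and n
            using that by (induction n) auto
          have "indicator (U j) x = (if real j < f x * Suc N then 1 else 0 :: real)" for j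
            by (simp add: U_def indicator_def)
          then show ?thesis
            using ind[of "f x * Suc N" "Suc N"] f(2)[of x] by (simp only: min.bounded_iff mult_nonneg_nonneg of_nat_0_le_iff)
        qed
      qed
      also have "\<dots> = (\<integral>x. f x \<partial>m) * Suc N + 1"
        using Cb_integrable[OF m f(1)] prob_space by (simp del: of_nat_Suc)
      finally show ?thesis by (simp add: field_simps)
    qed
    moreover have "(\<lambda>N. (\<integral>x. f x \<partial>m) + 1 / real (Suc N)) \<longlonglongrightarrow> (\<integral>x. f x \<partial>m)"
      using tendsto_add[OF tendsto_const LIMSEQ_inverse_real_of_nat, of "\<integral>x. f x \<partial>m"]
      by (simp add: inverse_eq_divide)
    ultimately show ?thesis by (intro LIMSEQ_le_const) auto
  qed
  have eq01: "L f = (\<integral>x. f x \<partial>m)" if f: "f \<in> Cb" "\<And>x. 0 \<le> f x" "\<And>x. f x \<le> 1" for f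
  proof (rule antisym[OF le[OF f]])
    have "L (\<lambda>x. 1 - f x) \<le> (\<integral>x. 1 - f x \<partial>m)"
      using f by (intro le Cb_diff Cb_const) auto
    then show "(\<integral>x. f x \<partial>m) \<le> L f"
      using f Cb_integrable[OF m f(1)] prob_space by (simp add: L_diff Cb_const L_const)
  qed
  have "L f = (\<integral>x. f x \<partial>m)" if f: "f \<in> Cb" for f
  proof -
    obtain B where B: "B \<ge> 0" "\<And>x. \<bar>f x\<bar> \<le> B" using Cb_bound[OF f] by blast
    \<comment> \<open>\<open>(f + B) / c\<close> takes values between 0 and 1; the
      \<open>+ 1\<close> keeps \<open>c\<close> positive when \<open>B = 0\<close>.\<close>
    define c where "c = 2 * B + 1"
    have c: "c > 0" using B by (simp add: c_def)
    define g where "g x = (1 / c) * (f x + B)" for x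
    have g: "g \<in> Cb" unfolding g_def by (intro Cb_scale Cb_add f Cb_const)
    have g01: "0 \<le> g x" "g x \<le> 1" for x
      using B(2)[of x] c by (auto simp: g_def field_simps c_def abs_le_iff)
    have fg: "f = (\<lambda>x. c * g x - B)" using c by (auto simp: g_def)
    have "L f = c * L g - B"
      by (subst fg) (simp add: L_diff L_scale L_const g Cb_scale Cb_const)
    also have "\<dots> = c * (\<integral>x. g x \<partial>m) - B" by (simp add: eq01[OF g g01])
    also have "\<dots> = (\<integral>x. c * g x - B \<partial>m)"
      using Cb_integrable[OF m g] prob_space by simp
    finally show ?thesis using fg by simp
  qed
  with m show thesis using that by metis
qed

end

section \<open>Cluster points of measures\<close>

lemma Prob_space_measure_UNIV: "m \<in> Prob_space \<Longrightarrow> measure m UNIV = 1"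
  using prob_space.prob_space[OF Prob_spaceD(1), of m] by (simp add: Prob_spaceD(3))

lemma compact_box:
  fixes B :: "'i \<Rightarrow> real"
  shows "compact (PiE UNIV (\<lambda>i. {- B i..B i}))"
proof -
  have "compactin (product_topology (\<lambda>_. euclideanreal) UNIV) (PiE UNIV (\<lambda>i. {- B i..B i}))"
    unfolding compactin_PiE by auto
  then show ?thesis by (simp add: euclidean_product_topology)
qed

text \<open>Integration embeds \<open>Prob_space\<close> into a product of compact intervals. A cluster point of the
  image filter there is a positive normalised functional, and the hypothesis makes it
  continuous along decreasing sequences, hence a measure.\<close>

lemma weak_cluster:
  fixes F :: "'a::metric_space measure filter"
  assumes "F \<noteq> bot" and P: "eventually (\<lambda>m. m \<in> Prob_space) F"
    and D: "\<And>h e. (\<And>k. h k \<in> Cb) \<Longrightarrow> (\<And>x. decseq (\<lambda>k. h k x)) \<Longrightarrow> (\<And>x. (\<lambda>k. h k x) \<longlonglongrightarrow> 0) \<Longrightarrow>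
      e > 0 \<Longrightarrow> \<exists>k. eventually (\<lambda>m. (\<integral>x. h k x \<partial>m) \<le> e) F"
  obtains m G where "m \<in> Prob_space" "G \<le> F" "G \<noteq> bot" "limitin weak_top (\<lambda>x. x) m G"
proof -
  \<comment> \<open>Outside \<open>Cb\<close> the coordinate is set to 0 and its interval shrinks to
    a point, so the index set is the whole function space and Tychonoff's theorem applies to a full
    product of intervals.\<close>
  define \<Phi> where "\<Phi> m f = (if f \<in> Cb then \<integral>x. f x \<partial>m else 0)" for m and f :: "'a \<Rightarrow> real"
  have "\<exists>B. \<forall>f\<in>Cb. \<forall>x. \<bar>f x :: real\<bar> \<le> B f" for f :: "'a \<Rightarrow> real"
    by (rule bchoice) (use Cb_bound in blast)
  then obtain B where B: "\<And>f x. f \<in> Cb \<Longrightarrow> \<bar>f x :: real\<bar> \<le> B (f :: 'a \<Rightarrow> real)" by blast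
  define B' where "B' f = (if f \<in> Cb then B f else 0)" for f
  let ?K = "PiE UNIV (\<lambda>f. {- B' f..B' f})"
  have "eventually (\<lambda>m. \<Phi> m \<in> ?K) F"
    using P
  proof eventually_elim
    case (elim m)
    interpret prob_space m using Prob_spaceD[OF elim] by simp
    have "\<bar>\<integral>x. f x \<partial>m\<bar> \<le> B f" if f: "f \<in> Cb" for f
    proof -
      have "\<bar>\<integral>x. f x \<partial>m\<bar> \<le> (\<integral>x. \<bar>f x\<bar> \<partial>m)" by (rule integral_abs_bound)
      also have "\<dots> \<le> (\<integral>x. B f \<partial>m)"
        using Cb_integrable[OF elim f] B[OF f] by (intro integral_mono) auto
      finally show ?thesis by (simp add: prob_space)
    qed
    then show ?case unfolding \<Phi>_def B'_def PiE_UNIV_domain Pi_iff by (auto simp: abs_le_iff minus_le_iff)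
  qed
  then have "eventually (\<lambda>y. y \<in> ?K) (filtermap \<Phi> F)" by (simp add: eventually_filtermap)
  moreover have "filtermap \<Phi> F \<noteq> bot" using assms(1) by (simp add: filtermap_bot_iff)
  ultimately obtain L where L: "inf (nhds L) (filtermap \<Phi> F) \<noteq> bot"
    using compact_box[of B'] unfolding compact_filter by blast
  \<comment> \<open>The cluster point lives in the product; intersecting \<open>F\<close> with the
    pullback of its neighbourhoods gives a finer filter of measures along which all integrals
    converge to \<open>L\<close>.\<close>
  define G where "G = inf (filtercomap \<Phi> (nhds L)) F"
  have "G \<le> F" by (simp add: G_def)
  have "G \<noteq> bot"
  proof
    assume "G = bot"
    then have "eventually (\<lambda>_. False) (inf (filtercomap \<Phi> (nhds L)) F)" by (simp add: G_def)
    then obtain Q R where QR: "eventually Q (filtercomap \<Phi> (nhds L))" "eventually R F" "\<And>x. Q x \<Longrightarrow> \<not> R x"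
      unfolding eventually_inf by blast
    then obtain Q' where Q': "eventually Q' (nhds L)" "\<And>x. Q' (\<Phi> x) \<Longrightarrow> Q x"
      unfolding eventually_filtercomap by blast
    have "eventually (\<lambda>y. \<not> Q' y) (filtermap \<Phi> F)"
      unfolding eventually_filtermap using QR(2) by (rule eventually_mono) (use QR(3) Q'(2) in blast)
    with Q'(1) have "eventually (\<lambda>_. False) (inf (nhds L) (filtermap \<Phi> F))"
      unfolding eventually_inf by blast
    with L show False by (simp add: trivial_limit_def)
  qed
  have PG: "eventually (\<lambda>m. m \<in> Prob_space) G" using P \<open>G \<le> F\<close> by (rule filter_leD[rotated])
  have "filterlim \<Phi> (nhds L) G"
    unfolding G_def by (rule filterlim_mono[OF filterlim_filtercomap order_refl inf_le1])
  then have \<Phi>_ev: "eventually (\<lambda>m. P (\<Phi> m)) G" if "eventually P (nhds L)" for P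
    using that by (simp add: filterlim_iff)
  have lim: "((\<lambda>m. \<integral>x. f x \<partial>m) \<longlongrightarrow> L f) G" if f: "f \<in> Cb" for f
  proof (rule topological_tendstoI)
    fix U assume U: "open U" "L f \<in> U"
    have "open ((\<lambda>y. y f) -` U)"
      by (rule open_vimage[OF U(1) continuous_on_product_coordinates])
    then have "eventually (\<lambda>y. y \<in> (\<lambda>y. y f) -` U) (nhds L)"
      using U(2) by (intro eventually_nhds_in_open) auto
    from \<Phi>_ev[OF this] show "eventually (\<lambda>m. (\<integral>x. f x \<partial>m) \<in> U) G"
      using f by (simp add: \<Phi>_def)
  qed
  interpret daniell_functional L
  proof
    fix f g :: "'a \<Rightarrow> real" assume f: "f \<in> Cb"
    show "L (\<lambda>x. f x + g x) = L f + L g" if g: "g \<in> Cb"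
    proof (rule tendsto_unique[OF \<open>G \<noteq> bot\<close> lim[OF Cb_add[OF f g]]])
      show "((\<lambda>m. \<integral>x. f x + g x \<partial>m) \<longlongrightarrow> L f + L g) G"
      proof (rule Lim_transform_eventually[OF tendsto_add[OF lim[OF f] lim[OF g]]])
        show "eventually (\<lambda>m. (\<integral>x. f x \<partial>m) + (\<integral>x. g x \<partial>m) = (\<integral>x. f x + g x \<partial>m)) G"
          using PG by eventually_elim (simp add: Cb_integrable[OF _ f] Cb_integrable[OF _ g])
      qed
    qed
    show "L (\<lambda>x. c * f x) = c * L f" for c
      by (rule tendsto_unique[OF \<open>G \<noteq> bot\<close> lim[OF Cb_scale[OF f]]])
        (use tendsto_mult_left[OF lim[OF f], of c] in simp)
    show "0 \<le> L f" if "\<And>x. 0 \<le> f x"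
      by (rule tendsto_lowerbound[OF lim[OF f] _ \<open>G \<noteq> bot\<close>]) (simp add: that)
  next
    show "L (\<lambda>_. 1) = 1"
    proof (rule tendsto_unique[OF \<open>G \<noteq> bot\<close> lim[OF Cb_const]])
      show "((\<lambda>m. \<integral>x. 1 \<partial>m) \<longlongrightarrow> (1::real)) G"
      proof (rule Lim_transform_eventually[OF tendsto_const])
        show "eventually (\<lambda>m. 1 = (\<integral>x. 1 \<partial>m :: real)) G"
          using PG by eventually_elim (simp add: Prob_spaceD(3) Prob_space_measure_UNIV)
      qed
    qed
  next
    fix h :: "nat \<Rightarrow> 'a \<Rightarrow> real"
    assume h: "\<And>k. h k \<in> Cb" "\<And>x. decseq (\<lambda>k. h k x)" "\<And>x. (\<lambda>k. h k x) \<longlonglongrightarrow> 0"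
    have nonneg: "0 \<le> h k x" for k x using decseq_ge[OF h(2,3)] .
    have L0: "0 \<le> L (h k)" for k
      by (rule tendsto_lowerbound[OF lim[OF h(1)] _ \<open>G \<noteq> bot\<close>]) (simp add: nonneg)
    have Lmono: "L (h k) \<le> L (h j)" if "j \<le> k" for j k
    proof (rule tendsto_le[OF \<open>G \<noteq> bot\<close> lim[OF h(1)] lim[OF h(1)]])
      show "eventually (\<lambda>m. (\<integral>x. h k x \<partial>m) \<le> (\<integral>x. h j x \<partial>m)) G"
        using PG
      proof eventually_elim
        case (elim m)
        show ?case
          by (rule integral_mono[OF Cb_integrable[OF elim h(1)] Cb_integrable[OF elim h(1)]])
            (rule decseqD[OF h(2) that])
      qed
    qed
    show "(\<lambda>k. L (h k)) \<longlonglongrightarrow> 0"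
    proof (rule LIMSEQ_I)
      fix e :: real assume e: "0 < e"
      then obtain k where "eventually (\<lambda>m. (\<integral>x. h k x \<partial>m) \<le> e / 2) F"
        using D[OF h(1) h(2) h(3), of "e / 2"] by auto
      then have "eventually (\<lambda>m. (\<integral>x. h k x \<partial>m) \<le> e / 2) G" using \<open>G \<le> F\<close> filter_leD by blast
      then have "L (h k) \<le> e / 2" by (rule tendsto_upperbound[OF lim[OF h(1)] _ \<open>G \<noteq> bot\<close>])
      then have "norm (L (h n) - 0) < e" if "n \<ge> k" for n
        using L0[of n] Lmono[OF that] e by simp
      then show "\<exists>k. \<forall>n\<ge>k. norm (L (h n) - 0) < e" by blast
    qed
  qed
  obtain m where m: "m \<in> Prob_space" "\<And>f. f \<in> Cb \<Longrightarrow> (\<integral>x. f x \<partial>m) = L f"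
    using representation by blast
  have "limitin weak_top (\<lambda>x. x) m G"
    unfolding limitin_weak_top_iff using m PG lim by simp
  with that m(1) \<open>G \<le> F\<close> \<open>G \<noteq> bot\<close> show thesis by blast
qed

text \<open>This condition plays the role of tightness.\<close>

definition uniformly_daniell :: "'a::metric_space measure set \<Rightarrow> bool" where
  "uniformly_daniell K \<longleftrightarrow> K \<subseteq> Prob_space \<and>
     (\<forall>h e. (\<forall>k. h k \<in> Cb) \<longrightarrow> (\<forall>x. decseq (\<lambda>k. h k x)) \<longrightarrow> (\<forall>x. (\<lambda>k. h k x) \<longlonglongrightarrow> 0) \<longrightarrow> e > 0 \<longrightarrow>
        (\<exists>k. \<forall>m\<in>K. (\<integral>x. h k x \<partial>m) \<le> e))"

text \<open>If every finite subfamily missed part of \<open>A \<inter> K\<close>, the missed parts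
  would generate a proper filter with a cluster point in \<open>A\<close>, and a member of the cover
  around that point would be hit and missed at once. The cluster point may lie outside
  \<open>K\<close>; this is harmless because all of \<open>A\<close> is covered, and it allows a
  tight \<open>K\<close> together with a large closed \<open>A\<close>.\<close>

lemma uniformly_daniell_finite_subcover:
  fixes K :: "'a::metric_space measure set"
  assumes K: "uniformly_daniell K" and A: "closedin weak_top A"
    and op: "\<And>V. V \<in> \<V> \<Longrightarrow> openin weak_top V" and cov: "A \<subseteq> \<Union>\<V>"
  shows "\<exists>\<F>. finite \<F> \<and> \<F> \<subseteq> \<V> \<and> A \<inter> K \<subseteq> \<Union>\<F>"
proof (rule ccontr)
  assume neg: "\<not> ?thesis"
  define S where "S \<F> = A \<inter> K - \<Union>\<F>" for \<F>
  define F where "F = (INF \<F>\<in>{\<F>. finite \<F> \<and> \<F> \<subseteq> \<V>}. principal (S \<F>))"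
  have ev: "eventually P F \<longleftrightarrow> (\<exists>\<F>. finite \<F> \<and> \<F> \<subseteq> \<V> \<and> (\<forall>m\<in>S \<F>. P m))" for P
    unfolding F_def
  proof (subst eventually_INF_base)
    show "\<exists>x\<in>{\<F>. finite \<F> \<and> \<F> \<subseteq> \<V>}. principal (S x) \<le> inf (principal (S a)) (principal (S b))"
      if "a \<in> {\<F>. finite \<F> \<and> \<F> \<subseteq> \<V>}" "b \<in> {\<F>. finite \<F> \<and> \<F> \<subseteq> \<V>}" for a b
      by (rule bexI[of _ "a \<union> b"]) (use that in \<open>auto simp: S_def\<close>)
  qed (auto simp: eventually_principal)
  have "S \<F> \<noteq> {}" if "finite \<F>" "\<F> \<subseteq> \<V>" for \<F>
    using neg that unfolding S_def by blast
  then have "F \<noteq> bot" unfolding trivial_limit_def ev by blast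
  moreover have "eventually (\<lambda>m. m \<in> Prob_space) F"
    unfolding ev using K by (intro exI[of _ "{}"]) (auto simp: S_def uniformly_daniell_def)
  moreover have "\<exists>k. eventually (\<lambda>m. (\<integral>x. h k x \<partial>m) \<le> e) F"
    if "\<And>k. h k \<in> Cb" "\<And>x. decseq (\<lambda>k. h k x)" "\<And>x. (\<lambda>k. h k x) \<longlonglongrightarrow> 0" "e > 0" for h and e :: real
  proof -
    have "\<exists>k. \<forall>m\<in>K. (\<integral>x. h k x \<partial>m) \<le> e"
      using conjunct2[OF K[unfolded uniformly_daniell_def], rule_format, of h e, OF that] .
    then obtain k where "\<forall>m\<in>K. (\<integral>x. h k x \<partial>m) \<le> e" by blast
    then show ?thesis unfolding ev by (intro exI[of _ k] exI[of _ "{}"]) (auto simp: S_def)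
  qed
  ultimately obtain m G where mG: "m \<in> Prob_space" "G \<le> F" "G \<noteq> bot" "limitin weak_top (\<lambda>x. x) m G"
    by (rule weak_cluster)
  have evG: "eventually (\<lambda>m. m \<in> S \<F>) G" if "finite \<F>" "\<F> \<subseteq> \<V>" for \<F>
    using that by (intro filter_leD[OF mG(2)]) (auto simp: ev)
  have "m \<in> A"
  proof (rule limit_in_closed[OF A mG(4)])
    have "eventually (\<lambda>x. x \<in> A) G"
      using evG[of "{}"] by (auto elim: eventually_mono simp: S_def)
    then show "frequently (\<lambda>x. x \<in> A) G"
      using mG(3) by (simp add: eventually_frequently)
  qed
  then obtain V where V: "V \<in> \<V>" "m \<in> V" using cov by blast
  have "eventually (\<lambda>x. x \<in> V) G" by (rule limitinD[OF mG(4) op[OF V(1)] V(2)])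
  moreover have "eventually (\<lambda>x. x \<in> S {V}) G" by (rule evG) (use V in auto)
  ultimately have "eventually (\<lambda>_. False) G" by eventually_elim (auto simp: S_def)
  with mG(3) show False by simp
qed

lemma uniformly_daniell_compactin:
  fixes K :: "'a::metric_space measure set"
  assumes "uniformly_daniell K" "closedin weak_top K"
  shows "compactin weak_top K"
  unfolding compactin_def
proof (intro conjI allI impI)
  show "K \<subseteq> topspace weak_top" using assms(2) by (rule closedin_subset)
  fix \<V> assume "Ball \<V> (openin weak_top) \<and> K \<subseteq> \<Union>\<V>"
  then show "\<exists>\<F>. finite \<F> \<and> \<F> \<subseteq> \<V> \<and> K \<subseteq> \<Union>\<F>"
    using uniformly_daniell_finite_subcover[OF assms, of \<V>] by auto
qed

section \<open>Relative entropy\<close>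

lemma neg_xlnx_le_1: "0 \<le> x \<Longrightarrow> - (x * ln x) \<le> (1::real)"
proof (cases "x = 0")
  case False
  assume "0 \<le> x"
  with False have x: "x > 0" by simp
  have "- ln x \<le> 1 / x - 1" using ln_le_minus_one[of "1 / x"] x by (simp add: ln_div)
  then have "x * (- ln x) \<le> x * (1 / x - 1)" using x by (intro mult_left_mono) auto
  also have "\<dots> = 1 - x" using x by (simp add: field_simps)
  finally show ?thesis using x by simp
qed simp

text \<open>Fenchel-Young inequality: \<open>x * ln x - x\<close> and \<open>exp y\<close> are
  convex conjugates.\<close>

lemma young_exp: "0 \<le> x \<Longrightarrow> x * y - x * ln x \<le> exp y - (x::real)"
proof (cases "x = 0")
  case False
  assume "0 \<le> x"
  with False have x: "x > 0" by simp
  have "y - ln x \<le> exp y / x - 1"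
    using ln_le_minus_one[of "exp y / x"] x by (simp add: ln_div)
  then have "x * (y - ln x) \<le> x * (exp y / x - 1)" using x by (intro mult_left_mono) auto
  also have "\<dots> = exp y - x" using x by (simp add: field_simps)
  finally show ?thesis by (simp add: algebra_simps)
qed simp

lemma absolutely_continuous_density:
  fixes \<mu> \<nu> :: "'a::topological_space measure"
  assumes P: "\<mu> \<in> Prob_space" "\<nu> \<in> Prob_space" and ac: "absolutely_continuous \<mu> \<nu>"
    and D_def: "D = (\<lambda>z. enn2real (RN_deriv \<mu> \<nu> z))"
  shows "D \<in> borel_measurable borel" "\<And>z. 0 \<le> D z" "\<nu> = density \<mu> (\<lambda>z. ennreal (D z))"
    "integrable \<mu> D" "(\<integral>z. D z \<partial>\<mu>) = 1"
proof -
  interpret mu: prob_space \<mu> using P Prob_spaceD by auto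
  interpret nu: prob_space \<nu> using P Prob_spaceD by auto
  have s: "sets \<nu> = sets \<mu>" using P by (simp add: Prob_spaceD)
  have Dm: "D \<in> borel_measurable \<mu>" unfolding D_def by measurable
  then show Dmb: "D \<in> borel_measurable borel" by (simp add: Prob_space_measurable[OF P(1)])
  show D0: "\<And>z. 0 \<le> D z" by (simp add: D_def)
  have "AE z in \<mu>. RN_deriv \<mu> \<nu> z \<noteq> \<infinity>"
    by (rule mu.RN_deriv_finite[OF _ ac s]) unfold_locales
  then have "AE z in \<mu>. RN_deriv \<mu> \<nu> z = ennreal (D z)"
    by eventually_elim (simp add: D_def less_top)
  then have "density \<mu> (RN_deriv \<mu> \<nu>) = density \<mu> (\<lambda>z. ennreal (D z))"
    using Dm by (intro density_cong) auto
  then show dens: "\<nu> = density \<mu> (\<lambda>z. ennreal (D z))"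
    by (simp add: mu.density_RN_deriv[OF ac s])
  have "(\<integral>\<^sup>+ z. ennreal (D z) \<partial>\<mu>) = emeasure \<nu> (space \<mu>)"
    using Dm by (subst dens) (simp add: emeasure_density cong: nn_integral_cong)
  also have "\<dots> = 1" using nu.emeasure_space_1 P by (simp add: Prob_spaceD)
  finally have n: "(\<integral>\<^sup>+ z. ennreal (D z) \<partial>\<mu>) = ennreal 1" by simp
  show "integrable \<mu> D"
    by (rule integrableI_nonneg) (use n Dm D0 in auto)
  show "(\<integral>z. D z \<partial>\<mu>) = 1"
    by (subst integral_eq_nn_integral) (use n Dm D0 in auto)
qed

lemma nn_integral_neg_xlnx_le_1:
  assumes "prob_space M" "\<And>z. 0 \<le> D z"
  shows "(\<integral>\<^sup>+ z. ennreal (- (D z * ln (D z))) \<partial>M) \<le> 1"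
proof -
  have "(\<integral>\<^sup>+ z. ennreal (- (D z * ln (D z))) \<partial>M) \<le> (\<integral>\<^sup>+ z. ennreal 1 \<partial>M)"
    by (intro nn_integral_mono ennreal_leI neg_xlnx_le_1 assms(2))
  also have "\<dots> = 1" using prob_space.emeasure_space_1[OF assms(1)] by simp
  finally show ?thesis .
qed

text \<open>The negative part of \<open>D ln D\<close> always has integral at most 1, so finite entropy means
  integrability.\<close>

lemma rel_entropy_finite:
  fixes \<mu> \<nu> :: "'a::topological_space measure"
  assumes P: "\<mu> \<in> Prob_space" "\<nu> \<in> Prob_space" and fin: "rel_entropy \<nu> \<mu> < \<infinity>"
  obtains D where "D \<in> borel_measurable borel" "\<And>z. 0 \<le> D z" "\<nu> = density \<mu> (\<lambda>z. ennreal (D z))"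
    "integrable \<mu> D" "(\<integral>z. D z \<partial>\<mu>) = 1"
    "integrable \<mu> (\<lambda>z. D z * ln (D z))" "rel_entropy \<nu> \<mu> = ereal (\<integral>z. D z * ln (D z) \<partial>\<mu>)"
proof -
  interpret mu: prob_space \<mu> using P Prob_spaceD by auto
  have ac: "absolutely_continuous \<mu> \<nu>" and s: "sets \<nu> = sets \<mu>"
    using fin by (auto simp: rel_entropy_def split: if_splits)
  define D where "D = (\<lambda>z. enn2real (RN_deriv \<mu> \<nu> z))"
  note D = absolutely_continuous_density[OF P ac D_def]
  have Dm: "D \<in> borel_measurable \<mu>" using D(1) by (simp add: Prob_space_measurable[OF P(1)])
  have N: "(\<integral>\<^sup>+ z. ennreal (- (D z * ln (D z))) \<partial>\<mu>) \<noteq> \<infinity>"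
    using nn_integral_neg_xlnx_le_1[of \<mu> D, OF mu.prob_space_axioms D(2)] by (auto simp: top_unique)
  have H: "rel_entropy \<nu> \<mu> = enn2ereal (\<integral>\<^sup>+ z. ennreal (D z * ln (D z)) \<partial>\<mu>)
        - enn2ereal (\<integral>\<^sup>+ z. ennreal (- (D z * ln (D z))) \<partial>\<mu>)"
    using ac s by (simp add: rel_entropy_def Let_def D_def)
  have Pf: "(\<integral>\<^sup>+ z. ennreal (D z * ln (D z)) \<partial>\<mu>) \<noteq> \<infinity>"
  proof
    assume "(\<integral>\<^sup>+ z. ennreal (D z * ln (D z)) \<partial>\<mu>) = \<infinity>"
    with fin N show False unfolding H
      by (cases "(\<integral>\<^sup>+ z. ennreal (- (D z * ln (D z))) \<partial>\<mu>)" rule: ennreal_cases) (auto simp: enn2ereal_ennreal)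
  qed
  have int: "integrable \<mu> (\<lambda>z. D z * ln (D z))"
    unfolding real_integrable_def using Dm N Pf by auto
  have "rel_entropy \<nu> \<mu> = ereal (\<integral>z. D z * ln (D z) \<partial>\<mu>)"
    unfolding H real_lebesgue_integral_def[OF int] using N Pf
    by (cases "(\<integral>\<^sup>+ z. ennreal (- (D z * ln (D z))) \<partial>\<mu>)" rule: ennreal_cases;
        cases "(\<integral>\<^sup>+ z. ennreal (D z * ln (D z)) \<partial>\<mu>)" rule: ennreal_cases)
      (auto simp: enn2ereal_ennreal)
  with that D int show thesis by blast
qed

section \<open>The Donsker-Varadhan variational formula\<close>

lemma bounded_measurable_integrable:
  assumes "m \<in> Prob_space" "f \<in> borel_measurable borel" "\<And>x. \<bar>f x\<bar> \<le> (B::real)"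
  shows "integrable m f"
proof -
  interpret prob_space m using Prob_spaceD[OF assms(1)] by simp
  show ?thesis using assms(2,3) by (intro integrable_const_bound[of _ B]) (simp_all add: Prob_space_measurable[OF assms(1)])
qed

lemma exp_integral_pos:
  assumes "m \<in> Prob_space" "f \<in> borel_measurable borel" "\<And>x. \<bar>f x\<bar> \<le> (B::real)"
  shows "integrable m (\<lambda>z. exp (f z))" "0 < (\<integral>z. exp (f z) \<partial>m)"
proof -
  interpret prob_space m using Prob_spaceD[OF assms(1)] by simp
  show i: "integrable m (\<lambda>z. exp (f z))"
    using assms(2,3) by (intro bounded_measurable_integrable[OF assms(1), of _ "exp B"]) (auto simp: abs_le_iff)
  have "(\<integral>z. exp (- B) \<partial>m) \<le> (\<integral>z. exp (f z) \<partial>m)"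
    using assms(3) by (intro integral_mono i) (auto simp: abs_le_iff minus_le_iff)
  then have "exp (- B) \<le> (\<integral>z. exp (f z) \<partial>m)" by (simp add: prob_space)
  then show "0 < (\<integral>z. exp (f z) \<partial>m)" by (rule less_le_trans[OF exp_gt_zero])
qed

text \<open>\<open>young_exp\<close> is applied pointwise to the density \<open>D\<close> and to
  \<open>g - ln Z\<close>. Normalising by \<open>Z\<close> makes the right-hand side integrate to
  \<open>1 - 1 = 0\<close>.\<close>

lemma donsker_varadhan_le:
  fixes \<mu> \<nu> :: "'a::topological_space measure"
  assumes P: "\<mu> \<in> Prob_space" "\<nu> \<in> Prob_space" and H: "rel_entropy \<nu> \<mu> \<le> ereal a"
    and g: "g \<in> Cb"
  shows "(\<integral>z. g z \<partial>\<nu>) \<le> a + ln (\<integral>z. exp (g z) \<partial>\<mu>)"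
proof -
  interpret mu: prob_space \<mu> using P Prob_spaceD by auto
  have "rel_entropy \<nu> \<mu> < \<infinity>" using H by (cases "rel_entropy \<nu> \<mu>") auto
  then obtain D where D: "D \<in> borel_measurable borel" "\<And>z. 0 \<le> D z" "\<nu> = density \<mu> (\<lambda>z. ennreal (D z))"
    "integrable \<mu> D" "(\<integral>z. D z \<partial>\<mu>) = 1"
    "integrable \<mu> (\<lambda>z. D z * ln (D z))" "rel_entropy \<nu> \<mu> = ereal (\<integral>z. D z * ln (D z) \<partial>\<mu>)"
    by (rule rel_entropy_finite[OF P]) (rule that)
  have Dm: "D \<in> borel_measurable \<mu>" using D(1) by (simp add: Prob_space_measurable[OF P(1)])
  have gm: "g \<in> borel_measurable \<mu>" using Cb_measurable[OF g] by (simp add: Prob_space_measurable[OF P(1)])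
  obtain B where B: "\<And>x. \<bar>g x\<bar> \<le> B" using Cb_bound[OF g] by blast
  define Z where "Z = (\<integral>z. exp (g z) \<partial>\<mu>)"
  have ie: "integrable \<mu> (\<lambda>z. exp (g z))" and Z: "Z > 0"
    unfolding Z_def by (rule exp_integral_pos[OF P(1) Cb_measurable[OF g] B])+
  have iDg: "integrable \<mu> (\<lambda>z. D z * g z)"
  proof (rule Bochner_Integration.integrable_bound)
    show "integrable \<mu> (\<lambda>z. B * D z)" using D(4) by simp
    show "(\<lambda>z. D z * g z) \<in> borel_measurable \<mu>" using Dm gm by measurable
    have "\<bar>D z * g z\<bar> \<le> \<bar>B * D z\<bar>" for z
      using mult_right_mono[OF B[of z] D(2)[of z]] D(2)[of z] B[of z]
      by (simp add: abs_mult mult.commute)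
    then show "AE z in \<mu>. norm (D z * g z) \<le> norm (B * D z)" by simp
  qed
  have eg: "(\<integral>z. g z \<partial>\<nu>) = (\<integral>z. D z * g z \<partial>\<mu>)"
    unfolding D(3) using gm Dm D(2) by (subst integral_density) auto
  have "(\<integral>z. D z * g z - ln Z * D z - D z * ln (D z) \<partial>\<mu>) \<le> (\<integral>z. exp (g z) / Z - D z \<partial>\<mu>)"
  proof (rule integral_mono)
    show "integrable \<mu> (\<lambda>z. D z * g z - ln Z * D z - D z * ln (D z))"
      using iDg D(4,6) by auto
    show "integrable \<mu> (\<lambda>z. exp (g z) / Z - D z)" using ie D(4) by auto
    show "D z * g z - ln Z * D z - D z * ln (D z) \<le> exp (g z) / Z - D z" for z
      using young_exp[OF D(2)[of z], of "g z - ln Z"] Z by (simp add: exp_diff algebra_simps)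
  qed
  moreover have "(\<integral>z. D z * g z - ln Z * D z - D z * ln (D z) \<partial>\<mu>)
      = (\<integral>z. D z * g z \<partial>\<mu>) - ln Z - (\<integral>z. D z * ln (D z) \<partial>\<mu>)"
    using iDg D(4,5,6) by simp
  moreover have "(\<integral>z. exp (g z) / Z - D z \<partial>\<mu>) = 0"
    using ie D(4,5) Z by (simp add: Z_def[symmetric])
  ultimately show ?thesis using H unfolding D(7) eg Z_def by simp
qed

section \<open>Continuous approximation of measurable functions\<close>

lemma inner_regular_approx:
  fixes m :: "'a::{second_countable_topology, complete_space} measure"
  assumes m: "m \<in> Prob_space" and A: "A \<in> sets borel" and e: "e > 0"
  shows "\<exists>K. K \<subseteq> A \<and> compact K \<and> measure m (A - K) < e"
proof -
  interpret prob_space m using Prob_spaceD[OF m] by simp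
  have sm: "sets m = sets borel" "emeasure m (space m) \<noteq> \<infinity>" using Prob_spaceD[OF m] by auto
  have "emeasure m A = (SUP K\<in>{K. K \<subseteq> A \<and> compact K}. emeasure m K)"
    by (rule inner_regular[OF sm A])
  moreover have "\<exists>K\<in>{K. K \<subseteq> A \<and> compact K}. emeasure m A < emeasure m K + ennreal e"
    by (rule SUP_approx_ennreal[OF _ _ calculation]) (use e in auto)
  ultimately obtain K where K: "K \<subseteq> A" "compact K" "emeasure m A < emeasure m K + ennreal e" by blast
  have Km: "K \<in> sets m" using K(2) sm by (simp add: compact_imp_closed borel_closed)
  have "measure m A < measure m K + e"
    using K(3) e by (simp add: emeasure_eq_measure ennreal_less_iff flip: ennreal_plus)
  then have "measure m (A - K) < e"
    using finite_measure_Diff[of A K] A sm Km K(1) by simp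
  with K show ?thesis by blast
qed

text \<open>One function has to serve both measures, so the compact sets from inner regularity under
  each are united; the indicator of the union is then approached from above by complements of
  bumps.\<close>

lemma indicator_approx:
  fixes \<mu> \<nu> :: "'a::{second_countable_topology, complete_space} measure"
  assumes P: "\<mu> \<in> Prob_space" "\<nu> \<in> Prob_space" and A: "A \<in> sets borel" and e: "e > 0"
  shows "\<exists>g\<in>Cb. (\<forall>x. 0 \<le> g x \<and> g x \<le> 1) \<and>
    (\<forall>m\<in>{\<mu>, \<nu>}. (\<integral>z. \<bar>indicator A z - g z\<bar> \<partial>m) \<le> e)"
proof -
  have "e / 2 > 0" using e by simp
  from inner_regular_approx[OF P(1) A this] inner_regular_approx[OF P(2) A this] obtain K1 K2 where
    K1: "K1 \<subseteq> A" "compact K1" "measure \<mu> (A - K1) < e / 2" and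
    K2: "K2 \<subseteq> A" "compact K2" "measure \<nu> (A - K2) < e / 2" by blast
  define K where "K = K1 \<union> K2"
  have K: "K \<subseteq> A" "closed K" using K1 K2 by (auto simp: K_def compact_imp_closed)
  have "eventually (\<lambda>n. (\<integral>z. \<bar>indicator A z - (1 - bump (- K) n z)\<bar> \<partial>m) \<le> e) sequentially"
    if m: "m \<in> Prob_space" and mK: "measure m (A - K) < e / 2" for m
  proof -
    interpret prob_space m using Prob_spaceD[OF m] by simp
    have sm: "sets m = sets borel" using Prob_spaceD[OF m] by auto
    have bi: "integrable m (\<lambda>z. bump (- K) n z)" for n by (rule Cb_integrable[OF m bump_Cb])
    have ii: "integrable m (indicator S :: 'a \<Rightarrow> real)" if "S \<in> sets borel" for S
      using that sm by (simp add: integrable_indicator_iff emeasure_eq_measure)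
    have Kb: "A - K \<in> sets borel" "K \<in> sets borel" "- K \<in> sets borel" using A K(2) by auto
    have "eventually (\<lambda>n. \<bar>(\<integral>z. bump (- K) n z \<partial>m) - measure m (- K)\<bar> < e / 2) sequentially"
      using tendstoD[OF integral_bump_tendsto[OF m, of "- K"], of "e / 2"] K(2) e
      by (simp add: dist_real_def open_Compl)
    then show ?thesis
    proof eventually_elim
      case (elim n)
      have "(\<integral>z. \<bar>indicator A z - (1 - bump (- K) n z)\<bar> \<partial>m)
          \<le> (\<integral>z. indicator (A - K) z + (indicator (- K) z - bump (- K) n z) \<partial>m)"
      proof (rule integral_mono)
        show "integrable m (\<lambda>z. \<bar>indicator A z - (1 - bump (- K) n z)\<bar>)"
          using ii[OF A] bi by auto
        show "integrable m (\<lambda>z. indicator (A - K) z + (indicator (- K) z - bump (- K) n z))"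
          using ii[OF Kb(1)] ii[OF Kb(3)] bi by auto
        show "\<bar>indicator A z - (1 - bump (- K) n z)\<bar> \<le> indicator (A - K) z + (indicator (- K) z - bump (- K) n z)" for z
          using bump_bounds(1,2)[of "- K" n z] bump_bounds(3)[of z "- K" n] K(1)
          by (auto simp: indicator_def)
      qed
      also have "\<dots> = measure m (A - K) + (measure m (- K) - (\<integral>z. bump (- K) n z \<partial>m))"
        using ii[OF Kb(1)] ii[OF Kb(3)] bi Kb sm by (simp add: Prob_spaceD(3)[OF m])
      also have "\<dots> \<le> e" using elim mK by linarith
      finally show ?case .
    qed
  qed note * = this
  interpret mu: prob_space \<mu> using Prob_spaceD[OF P(1)] by simp
  interpret nu: prob_space \<nu> using Prob_spaceD[OF P(2)] by simp
  have "measure \<mu> (A - K) < e / 2"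
    using K1 A K1(2)[THEN compact_imp_closed] Prob_spaceD[OF P(1)]
    by (intro order.strict_trans1[OF mu.finite_measure_mono K1(3)]) (auto simp: K_def)
  moreover have "measure \<nu> (A - K) < e / 2"
    using K2 A K2(2)[THEN compact_imp_closed] Prob_spaceD[OF P(2)]
    by (intro order.strict_trans1[OF nu.finite_measure_mono K2(3)]) (auto simp: K_def)
  ultimately have "eventually (\<lambda>n. \<forall>m\<in>{\<mu>, \<nu>}. (\<integral>z. \<bar>indicator A z - (1 - bump (- K) n z)\<bar> \<partial>m) \<le> e) sequentially"
    using *[OF P(1)] *[OF P(2)] by (simp add: eventually_conj_iff)
  then obtain n where n: "\<forall>m\<in>{\<mu>, \<nu>}. (\<integral>z. \<bar>indicator A z - (1 - bump (- K) n z)\<bar> \<partial>m) \<le> e"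
    by (auto simp: eventually_sequentially)
  show ?thesis
    by (rule bexI[of _ "\<lambda>z. 1 - bump (- K) n z"])
      (use n bump_bounds in \<open>auto intro: Cb_diff Cb_const bump_Cb\<close>)
qed

text \<open>The function \<open>f + B\<close> is cut into \<open>N\<close> layers of thickness
  \<open>c\<close>, and the indicator of each layer is replaced. The approximant keeps the bound
  \<open>B\<close>, which later makes \<open>exp\<close> Lipschitz with one constant.\<close>

lemma bounded_measurable_approx:
  fixes \<mu> \<nu> :: "'a::{second_countable_topology, complete_space} measure"
  assumes P: "\<mu> \<in> Prob_space" "\<nu> \<in> Prob_space" and f: "f \<in> borel_measurable borel"
    and B: "\<And>x. \<bar>f x\<bar> \<le> B" and e: "e > 0"
  shows "\<exists>g\<in>Cb. (\<forall>x. \<bar>g x\<bar> \<le> B) \<and> (\<forall>m\<in>{\<mu>, \<nu>}. (\<integral>z. \<bar>f z - g z\<bar> \<partial>m) \<le> e)"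
proof -
  have B0: "B \<ge> 0" using B[of undefined] by linarith
  obtain N where N: "real N > 4 * (B + 1) / e" using reals_Archimedean2 by blast
  define c where "c = 2 * B / real N"
  have "4 * (B + 1) / e > 0" using B0 e by simp
  then have N0: "real N > 0" using N by linarith
  have c0: "c \<ge> 0" using B0 by (simp add: c_def)
  have cN: "c * real N = 2 * B" using N0 by (simp add: c_def)
  have "4 * (B + 1) < e * real N" using N e by (simp add: field_simps)
  then have c_e: "c \<le> e / 2" using N0 B0 unfolding c_def by (simp add: field_simps)
  define A where "A j = {x. real (Suc j) * c \<le> f x + B}" for j :: nat
  have A: "A j \<in> sets borel" for j
    unfolding A_def using borel_measurable_le[of "\<lambda>_. real (Suc j) * c" borel "\<lambda>x. f x + B"] f by simp
  \<comment> \<open>The layer errors add up with total weight \<open>c * N = 2 * B\<close>, whatever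
    \<open>N\<close> is; they and the discretisation error \<open>c\<close> each receive
    \<open>e / 2\<close>, and the \<open>+ 1\<close> covers \<open>B = 0\<close>.\<close>
  define e' where "e' = e / (2 * (2 * B + 1))"
  have e': "e' > 0" using e B0 by (simp add: e'_def)
  have "\<exists>g\<in>Cb. (\<forall>x. 0 \<le> g x \<and> g x \<le> 1) \<and>
    (\<forall>m\<in>{\<mu>, \<nu>}. (\<integral>z. \<bar>indicator (A j) z - g z\<bar> \<partial>m) \<le> e')" for j
    by (rule indicator_approx[OF P A e'])
  then obtain g where g: "\<And>j. g j \<in> Cb" "\<And>j x. 0 \<le> g j x \<and> g j x \<le> 1"
    "\<And>j m. m \<in> {\<mu>, \<nu>} \<Longrightarrow> (\<integral>z. \<bar>indicator (A j) z - g j z\<bar> \<partial>m) \<le> e'" by metis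
  define G where "G x = (\<Sum>j<N. c * g j x) - B" for x
  have GCb: "G \<in> Cb" unfolding G_def by (intro Cb_diff Cb_sum Cb_scale g Cb_const)
  have Gb: "\<bar>G x\<bar> \<le> B" for x
  proof -
    have "(\<Sum>j<N. c * g j x) \<le> (\<Sum>j<N. c * 1)"
      using g(2) c0 by (intro sum_mono mult_left_mono) auto
    moreover have "0 \<le> (\<Sum>j<N. c * g j x)"
      using g(2) c0 by (intro sum_nonneg mult_nonneg_nonneg) auto
    ultimately show ?thesis using cN by (simp add: G_def abs_le_iff mult.commute)
  qed
  have layer: "\<bar>f x + B - (\<Sum>j<N. c * indicator (A j) x)\<bar> \<le> c" for x
  proof -
    have ind: "0 \<le> t \<Longrightarrow> t \<le> c * real n \<Longrightarrow>
        (\<Sum>j<n. c * (if real (Suc j) * c \<le> t then 1 else 0)) \<le> t \<and>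
        t \<le> (\<Sum>j<n. c * (if real (Suc j) * c \<le> t then 1 else 0)) + c" for t and n :: nat
    proof (induction n)
      case (Suc n)
      show ?case
      proof (cases "real (Suc n) * c \<le> t")
        case True
        have "real (Suc j) * c \<le> t" if "j < n" for j
          using mult_right_mono[of "real (Suc j)" "real (Suc n)" c] that c0 True by auto
        then have "(\<Sum>j<n. c * (if real (Suc j) * c \<le> t then 1 else 0)) = (\<Sum>j<n. c)"
          by (intro sum.cong) auto
        with True Suc.prems c0 show ?thesis by (simp add: algebra_simps)
      next
        case False
        then have t: "t \<le> c * real n + c" by (simp add: algebra_simps)
        show ?thesis
        proof (cases "t \<le> c * real n")
          case True
          with Suc False show ?thesis by simp
        next
          case F2: False
          have "real (Suc j) * c \<le> t" if "j < n" for j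
            using mult_right_mono[of "real (Suc j)" "real n" c] that c0 F2 by (auto simp: mult.commute)
          then have "(\<Sum>j<n. c * (if real (Suc j) * c \<le> t then 1 else 0)) = (\<Sum>j<n. c)"
            by (intro sum.cong) auto
          with False F2 t c0 show ?thesis by (simp add: mult.commute)
        qed
      qed
    qed (use c0 in auto)
    have fB: "0 \<le> f x + B" "f x + B \<le> c * real N" using B[of x] cN by (auto simp: abs_le_iff)
    have "indicator (A j) x = (if real (Suc j) * c \<le> f x + B then 1 else 0 :: real)" for j
      by (simp add: A_def indicator_def)
    then show ?thesis using ind[OF fB] by (simp only:) linarith
  qed
  have "(\<integral>z. \<bar>f z - G z\<bar> \<partial>m) \<le> e" if m: "m \<in> {\<mu>, \<nu>}" for m
  proof -
    have mP: "m \<in> Prob_space" using m P by auto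
    interpret prob_space m using Prob_spaceD[OF mP] by simp
    have fm: "f \<in> borel_measurable m" using f by (simp add: Prob_space_measurable[OF mP])
    have int_f: "integrable m f" using B by (intro integrable_const_bound[of _ B] fm) auto
    have ii: "integrable m (indicator (A j) :: 'a \<Rightarrow> real)" for j
      using A Prob_spaceD[OF mP] by (simp add: integrable_indicator_iff emeasure_eq_measure)
    have ia: "integrable m (\<lambda>z. \<bar>indicator (A j) z - g j z\<bar>)" for j
      using ii Cb_integrable[OF mP g(1)] by auto
    have "(\<integral>z. \<bar>f z - G z\<bar> \<partial>m) \<le> (\<integral>z. c + (\<Sum>j<N. c * \<bar>indicator (A j) z - g j z\<bar>) \<partial>m)"
    proof (rule integral_mono)
      show "integrable m (\<lambda>z. \<bar>f z - G z\<bar>)" using int_f Cb_integrable[OF mP GCb] by auto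
      show "integrable m (\<lambda>z. c + (\<Sum>j<N. c * \<bar>indicator (A j) z - g j z\<bar>))" using ia by auto
      fix z
      have "\<bar>(\<Sum>j<N. c * indicator (A j) z) - (\<Sum>j<N. c * g j z)\<bar> \<le> (\<Sum>j<N. c * \<bar>indicator (A j) z - g j z\<bar>)"
        unfolding sum_subtractf[symmetric] right_diff_distrib[symmetric]
        using c0 by (intro order_trans[OF sum_abs]) (simp add: abs_mult)
      with layer[of z] show "\<bar>f z - G z\<bar> \<le> c + (\<Sum>j<N. c * \<bar>indicator (A j) z - g j z\<bar>)"
        unfolding G_def by linarith
    qed
    also have "\<dots> = c + (\<Sum>j<N. c * (\<integral>z. \<bar>indicator (A j) z - g j z\<bar> \<partial>m))"
      using ia by (simp add: prob_space)
    also have "\<dots> \<le> c + (\<Sum>j<N. c * e')"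
      using c0 by (intro add_left_mono sum_mono mult_left_mono g(3)[OF m])
    also have "\<dots> = c + 2 * B * e'" using cN by (simp add: mult.commute mult.left_commute)
    also have "\<dots> \<le> e"
    proof -
      have "2 * B * e' \<le> (2 * B + 1) * e'" using e' by (intro mult_right_mono) auto
      also have "\<dots> = e / 2" unfolding e'_def using B0 by (simp add: field_simps)
      finally show ?thesis using c_e by linarith
    qed
    finally show ?thesis .
  qed
  with GCb Gb show ?thesis by blast
qed

text \<open>Both integrals are continuous in mean, the exponential one because \<open>exp\<close>
  has Lipschitz constant \<open>exp B\<close> between \<open>- B\<close> and \<open>B\<close>; a
  strict inequality therefore survives the approximation.\<close>

lemma donsker_varadhan_continuous:
  fixes \<mu> \<nu> :: "'a::{second_countable_topology, complete_space} measure"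
  assumes P: "\<mu> \<in> Prob_space" "\<nu> \<in> Prob_space" and f: "f \<in> borel_measurable borel"
    and B: "\<And>x. \<bar>f x\<bar> \<le> B" and gt: "(\<integral>z. f z \<partial>\<nu>) > a + ln (\<integral>z. exp (f z) \<partial>\<mu>)"
  shows "\<exists>g\<in>Cb. (\<integral>z. g z \<partial>\<nu>) > a + ln (\<integral>z. exp (g z) \<partial>\<mu>)"
proof -
  have "\<exists>g\<in>Cb. (\<forall>x. \<bar>g x\<bar> \<le> B) \<and> (\<forall>m\<in>{\<mu>, \<nu>}. (\<integral>z. \<bar>f z - g z\<bar> \<partial>m) \<le> inverse (real (Suc n)))" for n
    by (rule bounded_measurable_approx[OF P f B]) simp
  then have "\<forall>n. \<exists>g. g \<in> Cb \<and> (\<forall>x. \<bar>g x\<bar> \<le> B) \<and> (\<forall>m\<in>{\<mu>, \<nu>}. (\<integral>z. \<bar>f z - g z\<bar> \<partial>m) \<le> inverse (real (Suc n)))"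
    unfolding Bex_def ..
  from choice[OF this] obtain g where g': "\<forall>n. g n \<in> Cb \<and> (\<forall>x. \<bar>g n x\<bar> \<le> B) \<and>
    (\<forall>m\<in>{\<mu>, \<nu>}. (\<integral>z. \<bar>f z - g n z\<bar> \<partial>m) \<le> inverse (real (Suc n)))" ..
  have g: "g n \<in> Cb" "\<bar>g n x\<bar> \<le> B" "m \<in> {\<mu>, \<nu>} \<Longrightarrow> (\<integral>z. \<bar>f z - g n z\<bar> \<partial>m) \<le> inverse (real (Suc n))" for n x m
    using g'[rule_format, of n] by blast+
  have int: "integrable m f" "integrable m (g n)" "integrable m (\<lambda>z. \<bar>f z - g n z\<bar>)" if "m \<in> Prob_space" for m n
    using bounded_measurable_integrable[OF that f B] Cb_integrable[OF that g(1)[of n]] by simp_all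
  have lim: "X \<longlonglongrightarrow> L" if "\<And>n. \<bar>X n - L\<bar> \<le> K * inverse (real (Suc n))" for X and L K :: real
  proof -
    have "(\<lambda>n. K * inverse (real (Suc n))) \<longlonglongrightarrow> 0"
      using tendsto_mult[OF tendsto_const[of K] LIMSEQ_inverse_real_of_nat] unfolding mult_zero_right .
    moreover have "eventually (\<lambda>n. norm (X n - L) \<le> K * inverse (real (Suc n))) sequentially"
      unfolding real_norm_def using that by (rule always_eventually[OF allI])
    ultimately have "(\<lambda>n. X n - L) \<longlonglongrightarrow> 0"
      by (rule Lim_null_comparison[rotated])
    then show ?thesis by (rule LIM_zero_cancel)
  qed
  have 1: "(\<lambda>n. \<integral>z. g n z \<partial>\<nu>) \<longlonglongrightarrow> (\<integral>z. f z \<partial>\<nu>)"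
  proof (rule lim[of _ _ 1])
    fix n
    have "\<bar>(\<integral>z. g n z \<partial>\<nu>) - (\<integral>z. f z \<partial>\<nu>)\<bar> = \<bar>\<integral>z. f z - g n z \<partial>\<nu>\<bar>"
      unfolding Bochner_Integration.integral_diff[OF int(1,2)[OF P(2)]] by (rule abs_minus_commute)
    also have "\<dots> \<le> (\<integral>z. \<bar>f z - g n z\<bar> \<partial>\<nu>)" by (rule integral_abs_bound)
    also have "\<dots> \<le> 1 * inverse (real (Suc n))" using g(3)[of \<nu> n] by simp
    finally show "\<bar>(\<integral>z. g n z \<partial>\<nu>) - (\<integral>z. f z \<partial>\<nu>)\<bar> \<le> 1 * inverse (real (Suc n))" .
  qed
  note ie = exp_integral_pos[OF P(1) f B] exp_integral_pos(1)[OF P(1) Cb_measurable[OF g(1)] g(2)]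
  have 2: "(\<lambda>n. \<integral>z. exp (g n z) \<partial>\<mu>) \<longlonglongrightarrow> (\<integral>z. exp (f z) \<partial>\<mu>)"
  proof (rule lim[of _ _ "exp B"])
    fix n
    have "\<bar>(\<integral>z. exp (g n z) \<partial>\<mu>) - (\<integral>z. exp (f z) \<partial>\<mu>)\<bar> = \<bar>\<integral>z. exp (f z) - exp (g n z) \<partial>\<mu>\<bar>"
      unfolding Bochner_Integration.integral_diff[OF ie(1,3)] by (rule abs_minus_commute)
    also have "\<dots> \<le> (\<integral>z. \<bar>exp (f z) - exp (g n z)\<bar> \<partial>\<mu>)" by (rule integral_abs_bound)
    also have "\<dots> \<le> (\<integral>z. exp B * \<bar>f z - g n z\<bar> \<partial>\<mu>)"
    proof (rule integral_mono)
      show "integrable \<mu> (\<lambda>z. \<bar>exp (f z) - exp (g n z)\<bar>)" using ie(1) ie(3)[of n] by simp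
      show "integrable \<mu> (\<lambda>z. exp B * \<bar>f z - g n z\<bar>)" using int(3)[OF P(1), of n] by simp
      have ex: "exp x - exp y \<le> exp B * \<bar>x - y\<bar>" if "\<bar>x\<bar> \<le> B" for x y :: real
      proof (cases "y \<le> x")
        case True
        have "exp x * (1 + (y - x)) \<le> exp x * exp (y - x)"
          by (intro mult_left_mono exp_ge_add_one_self) auto
        then have "exp x - exp y \<le> exp x * (x - y)" by (simp add: exp_diff algebra_simps)
        also have "\<dots> \<le> exp B * (x - y)" using True that by (intro mult_right_mono) auto
        finally show ?thesis using True by simp
      next
        case False
        then have "exp x - exp y \<le> 0" by simp
        also have "0 \<le> exp B * \<bar>x - y\<bar>" by simp
        finally show ?thesis .
      qed
      show "\<bar>exp (f z) - exp (g n z)\<bar> \<le> exp B * \<bar>f z - g n z\<bar>" for z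
        using ex[OF B[of z], of "g n z"] ex[OF g(2)[of n z], of "f z"] by (simp add: abs_le_iff abs_minus_commute)
    qed
    also have "\<dots> \<le> exp B * inverse (real (Suc n))" using g(3)[of \<mu> n] by simp
    finally show "\<bar>(\<integral>z. exp (g n z) \<partial>\<mu>) - (\<integral>z. exp (f z) \<partial>\<mu>)\<bar> \<le> exp B * inverse (real (Suc n))" .
  qed
  have "(\<lambda>n. (\<integral>z. g n z \<partial>\<nu>) - ln (\<integral>z. exp (g n z) \<partial>\<mu>)) \<longlonglongrightarrow> (\<integral>z. f z \<partial>\<nu>) - ln (\<integral>z. exp (f z) \<partial>\<mu>)"
    using ie(2) by (intro tendsto_diff[OF 1 tendsto_ln[OF 2]]) simp
  moreover have "(\<integral>z. f z \<partial>\<nu>) - ln (\<integral>z. exp (f z) \<partial>\<mu>) > a" using gt by simp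
  ultimately have "eventually (\<lambda>n. (\<integral>z. g n z \<partial>\<nu>) - ln (\<integral>z. exp (g n z) \<partial>\<mu>) > a) sequentially"
    by (rule order_tendstoD(1))
  then obtain n where "(\<integral>z. g n z \<partial>\<nu>) - ln (\<integral>z. exp (g n z) \<partial>\<mu>) > a" by (auto simp: eventually_sequentially)
  then show ?thesis using g(1)[of n] by (intro bexI[of _ "g n"]) auto
qed

text \<open>When a density \<open>D\<close> exists, the optimal test function is
  \<open>ln D\<close>, which in general is neither bounded nor continuous. A bounded measurable
  substitute is built first, and \<open>donsker_varadhan_continuous\<close> then makes it
  continuous.\<close>

lemma donsker_varadhan_gt:
  fixes \<mu> \<nu> :: "'a::{second_countable_topology, complete_space} measure"
  assumes P: "\<mu> \<in> Prob_space" "\<nu> \<in> Prob_space" and H: "rel_entropy \<nu> \<mu> > ereal a"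
  shows "\<exists>g\<in>Cb. (\<integral>z. g z \<partial>\<nu>) > a + ln (\<integral>z. exp (g z) \<partial>\<mu>)"
proof -
  interpret mu: prob_space \<mu> using Prob_spaceD[OF P(1)] by simp
  interpret nu: prob_space \<nu> using Prob_spaceD[OF P(2)] by simp
  have s: "sets \<nu> = sets \<mu>" using P by (simp add: Prob_spaceD)
  have "\<exists>f B. f \<in> borel_measurable borel \<and> (\<forall>x. \<bar>f x\<bar> \<le> B) \<and>
      (\<integral>z. f z \<partial>\<nu>) > a + ln (\<integral>z. exp (f z) \<partial>\<mu>)"
  proof (cases "absolutely_continuous \<mu> \<nu>")
    case False
    then obtain A where A: "A \<in> null_sets \<mu>" "A \<notin> null_sets \<nu>"
      by (auto simp: absolutely_continuous_def)
    then have Ab: "A \<in> sets borel" "A \<in> sets \<mu>" "A \<in> sets \<nu>" using P s by (auto simp: Prob_spaceD)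
    have nA: "measure \<nu> A > 0"
      using A(2) Ab(3) by (simp add: null_sets_def nu.emeasure_eq_measure zero_less_measure_iff)
    \<comment> \<open>The indicator of \<open>A\<close> costs nothing under \<open>\<mu>\<close>, so
      its multiple can be chosen large: this \<open>t\<close> gives the integral
      \<open>\<bar>a\<bar> + 1\<close> under \<open>\<nu>\<close> against
      \<open>ln 1 = 0\<close>.\<close>
    define t where "t = (\<bar>a\<bar> + 1) / measure \<nu> A"
    let ?f = "\<lambda>z. t * indicator A z"
    have "AE z in \<mu>. exp (?f z) = 1"
      using AE_not_in[OF A(1)] by eventually_elim simp
    then have "(\<integral>z. exp (?f z) \<partial>\<mu>) = (\<integral>z. 1 \<partial>\<mu>)"
      using Ab by (intro integral_cong_AE) auto
    then have 1: "(\<integral>z. exp (?f z) \<partial>\<mu>) = 1" by (simp add: mu.prob_space)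
    have "(\<integral>z. ?f z \<partial>\<nu>) = t * measure \<nu> A" using Ab Prob_spaceD(3)[OF P(2)] by simp
    also have "\<dots> = \<bar>a\<bar> + 1" using nA by (simp add: t_def)
    finally have 2: "(\<integral>z. ?f z \<partial>\<nu>) = \<bar>a\<bar> + 1" .
    show ?thesis
      by (rule exI[of _ ?f], rule exI[of _ "\<bar>t\<bar>"]) (use 1 2 Ab in \<open>auto simp: indicator_def\<close>)
  next
    case ac: True
    define D where "D = (\<lambda>z. enn2real (RN_deriv \<mu> \<nu> z))"
    note D = absolutely_continuous_density[OF P ac D_def]
    have Dm: "D \<in> borel_measurable \<mu>" using D(1) by (simp add: Prob_space_measurable[OF P(1)])
    have "(\<integral>\<^sup>+ z. ennreal (- (D z * ln (D z))) \<partial>\<mu>) \<noteq> top"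
      using nn_integral_neg_xlnx_le_1[of \<mu> D, OF mu.prob_space_axioms D(2)] by (auto simp: top_unique)
    then obtain N where N: "N \<ge> 0" "(\<integral>\<^sup>+ z. ennreal (- (D z * ln (D z))) \<partial>\<mu>) = ennreal N"
      by (cases "(\<integral>\<^sup>+ z. ennreal (- (D z * ln (D z))) \<partial>\<mu>)" rule: ennreal_cases) auto
    have Heq: "rel_entropy \<nu> \<mu> = enn2ereal (\<integral>\<^sup>+ z. ennreal (D z * ln (D z)) \<partial>\<mu>) - ereal N"
      using ac s N by (simp add: rel_entropy_def Let_def D_def[symmetric] enn2ereal_ennreal)
    define neg where "neg z = max 0 (- (D z * ln (D z)))" for z
    have neg: "integrable \<mu> neg" "(\<integral>z. neg z \<partial>\<mu>) = N"
    proof -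
      have nm: "neg \<in> borel_measurable \<mu>" unfolding neg_def using Dm by measurable
      have nn: "(\<integral>\<^sup>+ z. ennreal (neg z) \<partial>\<mu>) = ennreal N"
        unfolding N(2)[symmetric] neg_def by (intro nn_integral_cong) (auto simp: max_def ennreal_neg)
      show "integrable \<mu> neg" by (rule integrableI_nonneg) (use nn nm in \<open>auto simp: neg_def\<close>)
      show "(\<integral>z. neg z \<partial>\<mu>) = N"
        by (subst integral_eq_nn_integral) (use nn nm N in \<open>auto simp: neg_def\<close>)
    qed
    \<comment> \<open>The positive part of \<open>D * ln D\<close> with the logarithm capped at
      \<open>k\<close>. Monotone convergence along \<open>k\<close> treats infinite and finite
      entropy in the same way.\<close>
    define p where "p k z = D z * min (max 0 (ln (D z))) (real k)" for k z
    have p0: "0 \<le> p k z" for k z using D(2)[of z] by (simp add: p_def)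
    have pm: "p k \<in> borel_measurable \<mu>" for k unfolding p_def using Dm by measurable
    have pint: "integrable \<mu> (p k)" for k
    proof (rule Bochner_Integration.integrable_bound)
      show "integrable \<mu> (\<lambda>z. real k * D z)" using D(4) by simp
      have "\<bar>p k z\<bar> \<le> \<bar>real k * D z\<bar>" for z
        using D(2)[of z] mult_left_mono[of "min (max 0 (ln (D z))) (real k)" "real k" "D z"] p0[of k z]
        by (simp add: p_def mult.commute)
      then show "AE z in \<mu>. norm (p k z) \<le> norm (real k * D z)" by simp
    qed (rule pm)
    have pmono: "p j z \<le> p k z" if "j \<le> k" for j k z
      unfolding p_def using that D(2)[of z] by (intro mult_left_mono) auto
    have "\<exists>k. (\<integral>z. p k z \<partial>\<mu>) > a + N"
    proof (rule ccontr)
      assume "\<not> ?thesis"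
      then have le: "(\<integral>z. p k z \<partial>\<mu>) \<le> a + N" for k by (auto simp: not_less)
      have aN: "0 \<le> a + N" using le[of 0] by (simp add: p_def)
      have "(\<integral>\<^sup>+ z. ennreal (D z * ln (D z)) \<partial>\<mu>) \<le> (\<integral>\<^sup>+ z. (SUP k. ennreal (p k z)) \<partial>\<mu>)"
      proof (rule nn_integral_mono)
        fix z
        obtain k where "ln (D z) \<le> real k" using real_arch_simple by blast
        then have "D z * ln (D z) \<le> p k z" unfolding p_def using D(2)[of z] by (intro mult_left_mono) auto
        then show "ennreal (D z * ln (D z)) \<le> (SUP k. ennreal (p k z))"
          by (intro SUP_upper2[of k]) (auto intro: ennreal_leI)
      qed
      also have "\<dots> = (SUP k. \<integral>\<^sup>+ z. ennreal (p k z) \<partial>\<mu>)"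
        using pmono pm by (intro nn_integral_monotone_convergence_SUP) (auto simp: incseq_def le_fun_def intro!: ennreal_leI)
      also have "\<dots> \<le> ennreal (a + N)"
      proof (rule SUP_least)
        show "(\<integral>\<^sup>+ z. ennreal (p k z) \<partial>\<mu>) \<le> ennreal (a + N)" for k
          using nn_integral_eq_integral[OF pint, of k] p0 le by (auto intro: ennreal_leI)
      qed
      finally have "enn2ereal (\<integral>\<^sup>+ z. ennreal (D z * ln (D z)) \<partial>\<mu>) \<le> ereal (a + N)"
        using aN by (metis enn2ereal_ennreal less_eq_ennreal.rep_eq)
      then have "rel_entropy \<nu> \<mu> \<le> ereal a"
        unfolding Heq by (cases "enn2ereal (\<integral>\<^sup>+ z. ennreal (D z * ln (D z)) \<partial>\<mu>)") auto
      with H show False by simp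
    qed
    then obtain k0 where k0: "(\<integral>z. p k0 z \<partial>\<mu>) > a + N" by blast
    \<comment> \<open>\<open>d\<close> is the surplus over \<open>a + N\<close>. Cutting the
      logarithm below at \<open>- k\<close> leaves the exponential moment at most
      \<open>1 + exp (- k)\<close>, so \<open>k\<close> is taken with
      \<open>exp (- k) < d\<close>.\<close>
    define d where "d = (\<integral>z. p k0 z \<partial>\<mu>) - (a + N)"
    have d: "d > 0" using k0 by (simp add: d_def)
    have "(\<lambda>k. exp (- real k)) \<longlonglongrightarrow> 0"
      using filterlim_compose[OF exp_at_bot filterlim_compose[OF filterlim_uminus_at_bot_at_top filterlim_real_sequentially]] .
    then have "eventually (\<lambda>k. exp (- real k) < d) sequentially" using d by (rule order_tendstoD(2))
    then obtain k1 where "\<And>k. k \<ge> k1 \<Longrightarrow> exp (- real k) < d" by (auto simp: eventually_sequentially)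
    then obtain k where k: "exp (- real k) < d" "k \<ge> k0" by (meson max.cobounded1 max.cobounded2)
    \<comment> \<open>Where \<open>D\<close> vanishes the lower cut-off is prescribed explicitly,
      since \<open>ln 0\<close> does not stand for minus infinity.\<close>
    define f where "f z = (if D z = 0 then - real k else max (- real k) (min (real k) (ln (D z))))" for z
    have fm: "f \<in> borel_measurable borel" unfolding f_def using D(1) by measurable
    have fb: "\<bar>f z\<bar> \<le> real k" for z by (auto simp: f_def)
    have "(\<integral>z. exp (f z) \<partial>\<mu>) \<le> (\<integral>z. D z + exp (- real k) \<partial>\<mu>)"
    proof (rule integral_mono[OF exp_integral_pos(1)[OF P(1) fm fb]])
      show "integrable \<mu> (\<lambda>z. D z + exp (- real k))" using D(4) by auto
      show "exp (f z) \<le> D z + exp (- real k)" for z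
      proof (cases "D z = 0")
        case False
        then have Dz: "D z > 0" using D(2)[of z] by simp
        have "f z \<le> ln (D z) \<or> f z = - real k" using False by (auto simp: f_def max_def min_def)
        then show ?thesis
        proof
          assume "f z \<le> ln (D z)"
          then have "exp (f z) \<le> exp (ln (D z))" by simp
          then show ?thesis using Dz by (simp add: add_increasing2)
        qed (use Dz in simp)
      qed (simp add: f_def)
    qed
    also have "\<dots> = 1 + exp (- real k)" using D(4,5) by (simp add: mu.prob_space)
    finally have "ln (\<integral>z. exp (f z) \<partial>\<mu>) \<le> ln (1 + exp (- real k))"
      using exp_integral_pos(2)[OF P(1) fm fb] by (simp add: add_pos_pos)
    also have "\<dots> \<le> exp (- real k)" by (rule ln_add_one_self_le_self) simp
    finally have 1: "ln (\<integral>z. exp (f z) \<partial>\<mu>) < d" using k(1) by simp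
    have fmu: "f \<in> borel_measurable \<mu>" using fm by (simp add: Prob_space_measurable[OF P(1)])
    have "(\<integral>z. p k0 z \<partial>\<mu>) - N = (\<integral>z. p k0 z - neg z \<partial>\<mu>)" using pint neg by simp
    also have "\<dots> \<le> (\<integral>z. D z * f z \<partial>\<mu>)"
    proof (rule integral_mono)
      show "integrable \<mu> (\<lambda>z. p k0 z - neg z)" using pint neg by auto
      show "integrable \<mu> (\<lambda>z. D z * f z)"
      proof (rule Bochner_Integration.integrable_bound)
        show "integrable \<mu> (\<lambda>z. real k * D z)" using D(4) by simp
        have "\<bar>D z * f z\<bar> \<le> \<bar>real k * D z\<bar>" for z
          using mult_right_mono[OF fb[of z] D(2)[of z]] D(2)[of z] by (simp add: abs_mult mult.commute)
        then show "AE z in \<mu>. norm (D z * f z) \<le> norm (real k * D z)" by simp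
      qed (use Dm fmu in measurable)
      fix z
      have "p k0 z \<le> p k z" by (rule pmono[OF k(2)])
      moreover have "p k z - neg z \<le> D z * f z"
      proof (cases "D z = 0")
        case False
        then have Dz: "D z > 0" using D(2)[of z] by simp
        show ?thesis
        proof (cases "ln (D z) \<ge> 0")
          case True
          then have "max (- real k) (min (real k) (ln (D z))) = min (max 0 (ln (D z))) (real k)"
            by (auto simp: max_def min_def)
          then have "D z * f z = p k z" using False by (simp add: p_def f_def)
          moreover have "0 \<le> neg z" by (simp add: neg_def)
          ultimately show ?thesis by simp
        next
          case neg': False
          then have "p k z = 0" by (simp add: p_def)
          moreover have "ln (D z) \<le> f z" using False neg' by (auto simp: f_def)
          then have "D z * ln (D z) \<le> D z * f z" using Dz by (intro mult_left_mono) auto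
          ultimately show ?thesis by (simp add: neg_def)
        qed
      qed (simp add: p_def neg_def)
      ultimately show "p k0 z - neg z \<le> D z * f z" by simp
    qed
    also have "\<dots> = (\<integral>z. f z \<partial>\<nu>)"
      unfolding D(3) using fmu Dm D(2) by (subst integral_density) auto
    finally have "(\<integral>z. f z \<partial>\<nu>) > a + ln (\<integral>z. exp (f z) \<partial>\<mu>)" using 1 by (simp add: d_def)
    with fm fb show ?thesis by blast
  qed
  then obtain f B where "f \<in> borel_measurable borel" "\<And>x. \<bar>f x\<bar> \<le> B"
      "(\<integral>z. f z \<partial>\<nu>) > a + ln (\<integral>z. exp (f z) \<partial>\<mu>)" by blast
  then show ?thesis by (rule donsker_varadhan_continuous[OF P])
qed

text \<open>Entropy is lower semicontinuous as a supremum of continuous functionals: a test function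
  that detects \<open>rel_entropy l \<mu> > a\<close> detects it near \<open>l\<close> as
  well.\<close>

lemma closedin_entropy_sublevel:
  fixes \<mu> :: "'a::{second_countable_topology, complete_space} measure"
  assumes "\<mu> \<in> Prob_space"
  shows "closedin weak_top {\<nu> \<in> Prob_space. rel_entropy \<nu> \<mu> \<le> ereal a}"
proof (rule closedin_by_limits)
  fix l :: "'a measure" and G
  assume G: "G \<noteq> bot" "limitin weak_top (\<lambda>x. x) l G"
    and ev: "eventually (\<lambda>x. x \<in> {\<nu> \<in> Prob_space. rel_entropy \<nu> \<mu> \<le> ereal a}) G"
  have l: "l \<in> Prob_space" using G(2) by (simp add: limitin_weak_top_iff)
  have "\<not> rel_entropy l \<mu> > ereal a"
  proof
    assume "rel_entropy l \<mu> > ereal a"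
    then obtain g where g: "g \<in> Cb" "(\<integral>z. g z \<partial>l) > a + ln (\<integral>z. exp (g z) \<partial>\<mu>)"
      using donsker_varadhan_gt[OF assms l] by blast
    have "((\<lambda>x. \<integral>z. g z \<partial>x) \<longlongrightarrow> (\<integral>z. g z \<partial>l)) G"
      using G(2) g(1) by (simp add: limitin_weak_top_iff)
    moreover have "eventually (\<lambda>x. (\<integral>z. g z \<partial>x) \<le> a + ln (\<integral>z. exp (g z) \<partial>\<mu>)) G"
      using ev by (rule eventually_mono) (use donsker_varadhan_le[OF assms _ _ g(1)] in auto)
    ultimately have "(\<integral>z. g z \<partial>l) \<le> a + ln (\<integral>z. exp (g z) \<partial>\<mu>)"
      by (rule tendsto_upperbound[OF _ _ G(1)])
    with g(2) show False by simp
  qed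
  with l show "l \<in> {\<nu> \<in> Prob_space. rel_entropy \<nu> \<mu> \<le> ereal a}" by (auto simp: not_less)
qed auto

text \<open>Donsker-Varadhan with \<open>t * h k\<close> bounds \<open>t\<close> times the integral
  of \<open>h k\<close> by \<open>a\<close> plus the logarithm of an exponential moment that tends
  to 1. Once the moment is below \<open>exp 1\<close> the bound is \<open>\<bar>a\<bar> + 1\<close>,
  which dictates \<open>t\<close>.\<close>

lemma uniformly_daniell_entropy_sublevel:
  fixes \<mu> :: "'a::metric_space measure"
  assumes P: "\<mu> \<in> Prob_space"
  shows "uniformly_daniell {\<nu> \<in> Prob_space. rel_entropy \<nu> \<mu> \<le> ereal a}"
  unfolding uniformly_daniell_def
proof (intro conjI allI impI)
  interpret mu: prob_space \<mu> using Prob_spaceD[OF P] by simp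
  fix h :: "nat \<Rightarrow> 'a \<Rightarrow> real" and e :: real
  assume h: "\<forall>k. h k \<in> Cb" "\<forall>x. decseq (\<lambda>k. h k x)" "\<forall>x. (\<lambda>k. h k x) \<longlonglongrightarrow> 0" and e: "0 < e"
  have nonneg: "0 \<le> h k x" for k x using decseq_ge[OF h(2)[rule_format] h(3)[rule_format]] .
  define t where "t = (\<bar>a\<bar> + 1) / e"
  have t: "t > 0" using e by (simp add: t_def)
  obtain B where B: "\<And>x. \<bar>h 0 x\<bar> \<le> B" using Cb_bound h(1) by blast
  have hB: "h k x \<le> B" for k x
    using B[of x] decseqD[OF h(2)[rule_format], of 0 k x] by simp
  have m: "h k \<in> borel_measurable \<mu>" for k
    using Cb_measurable[OF h(1)[rule_format]] by (simp add: Prob_space_measurable[OF P])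
  have "(\<lambda>k. \<integral>z. exp (t * h k z) \<partial>\<mu>) \<longlonglongrightarrow> (\<integral>z. exp (t * 0) \<partial>\<mu>)"
  proof (rule integral_dominated_convergence[where w="\<lambda>_. exp (t * B)"])
    show "AE z in \<mu>. (\<lambda>k. exp (t * h k z)) \<longlonglongrightarrow> exp (t * 0)"
      using h(3) by (intro AE_I2 tendsto_exp tendsto_mult tendsto_const) auto
    show "AE z in \<mu>. norm (exp (t * h k z)) \<le> exp (t * B)" for k using hB t by simp
  qed (use m in measurable)
  then have "eventually (\<lambda>k. (\<integral>z. exp (t * h k z) \<partial>\<mu>) < exp 1) sequentially"
    by (rule order_tendstoD(2)) (simp add: mu.prob_space)
  then obtain k where k: "(\<integral>z. exp (t * h k z) \<partial>\<mu>) < exp 1" by (auto simp: eventually_sequentially)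
  have hk: "(\<lambda>z. t * h k z) \<in> Cb" using h(1) by (intro Cb_scale) auto
  obtain B' where "\<And>x. \<bar>t * h k x\<bar> \<le> B'" using Cb_bound[OF hk] by blast
  note pos = exp_integral_pos(2)[OF P Cb_measurable[OF hk] this]
  have "(\<integral>z. h k z \<partial>\<nu>) \<le> e" if "\<nu> \<in> Prob_space" "rel_entropy \<nu> \<mu> \<le> ereal a" for \<nu>
  proof -
    have "t * (\<integral>z. h k z \<partial>\<nu>) \<le> a + ln (\<integral>z. exp (t * h k z) \<partial>\<mu>)"
      using donsker_varadhan_le[OF P that hk] by simp
    also have "\<dots> \<le> \<bar>a\<bar> + 1"
      using ln_less_cancel_iff[OF pos, of "exp 1"] k by simp
    also have "\<dots> = t * e" using e by (simp add: t_def)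
    finally show ?thesis using t by simp
  qed
  then show "\<exists>k. \<forall>m\<in>{\<nu> \<in> Prob_space. rel_entropy \<nu> \<mu> \<le> ereal a}. (\<integral>x. h k x \<partial>m) \<le> e" by blast
qed auto

section \<open>Independent samples\<close>

text \<open>Finitely many test functions with a single radius: the form in which concentration
  inequalities and total variation bounds can be used.\<close>

lemma weak_top_nbhd:
  fixes l :: "'a::topological_space measure"
  assumes "openin weak_top V" "l \<in> V"
  shows "\<exists>\<Phi> r. finite \<Phi> \<and> \<Phi> \<subseteq> Cb \<and> r > 0 \<and>
    (\<forall>m\<in>Prob_space. (\<forall>f\<in>\<Phi>. \<bar>(\<integral>z. f z \<partial>m) - (\<integral>z. f z \<partial>l)\<bar> < r) \<longrightarrow> m \<in> V)"
proof -
  have "generate_topology_on {{m \<in> Prob_space. (\<integral>z. f z \<partial>m) \<in> U} | (f :: 'a \<Rightarrow> real) U.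
        continuous_on UNIV f \<and> bounded (range f) \<and> open U} V"
    using assms(1) by (simp add: weak_top_def openin_topology_generated_by_iff)
  then show ?thesis using assms(2)
  proof (induction rule: generate_topology_on.induct)
    case (Int a b)
    from Int obtain A r where A: "finite A" "A \<subseteq> Cb" "r > 0"
      "\<forall>m\<in>Prob_space. (\<forall>f\<in>A. \<bar>(\<integral>z. f z \<partial>m) - (\<integral>z. f z \<partial>l)\<bar> < r) \<longrightarrow> m \<in> a" by blast
    from Int obtain B s where B: "finite B" "B \<subseteq> Cb" "s > 0"
      "\<forall>m\<in>Prob_space. (\<forall>f\<in>B. \<bar>(\<integral>z. f z \<partial>m) - (\<integral>z. f z \<partial>l)\<bar> < s) \<longrightarrow> m \<in> b" by blast
    show ?case
      by (rule exI[of _ "A \<union> B"], rule exI[of _ "min r s"]) (use A B in auto)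
  next
    case (UN K)
    then obtain X where X: "X \<in> K" "l \<in> X" by blast
    from UN.IH[OF X] obtain A r where A: "finite A" "A \<subseteq> Cb" "r > 0"
      "\<forall>m\<in>Prob_space. (\<forall>f\<in>A. \<bar>(\<integral>z. f z \<partial>m) - (\<integral>z. f z \<partial>l)\<bar> < r) \<longrightarrow> m \<in> X" by blast
    show ?case
      by (rule exI[of _ A], rule exI[of _ r]) (use A X(1) in blast)
  next
    case (Basis s)
    then obtain f V where s: "s = {m \<in> Prob_space. (\<integral>z. f z \<partial>m) \<in> V}" "f \<in> Cb" "open V"
      by (auto simp: Cb_def)
    with Basis(2) obtain r where r: "r > 0" "ball (\<integral>z. f z \<partial>l) r \<subseteq> V"
      using openE by blast
    show ?case
      by (rule exI[of _ "{f}"], rule exI[of _ r])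
        (use s r in \<open>auto simp: subset_eq dist_real_def abs_minus_commute\<close>)
  qed simp
qed

text \<open>Only \<open>n\<close> variables are constrained, so the coordinates of a finite product
  are an instance too; this allows passing from the given sample to the product space and
  back.\<close>

locale iid_sample = prob_space M
  for M :: "'o measure" and W :: "nat \<Rightarrow> 'o \<Rightarrow> 'w::{second_countable_topology, metric_space}"
    and n :: nat and \<mu> :: "'w measure" +
  assumes n: "n \<ge> 1"
    and indep: "indep_vars (\<lambda>_. borel) W {..<n}"
    and law: "i < n \<Longrightarrow> distr M borel (W i) = \<mu>"
begin

definition emp :: "'o \<Rightarrow> 'w measure" where
  "emp \<omega> = empirical n (\<lambda>i. W i \<omega>)"

lemma W_measurable: "i < n \<Longrightarrow> W i \<in> borel_measurable M"
  using indep by (auto simp: indep_vars_def)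

lemma mu_Prob_space: "\<mu> \<in> Prob_space"
  using prob_space_distr[OF W_measurable[of 0]] law[of 0] n by (auto simp: Prob_space_def)

lemma emp_Prob_space: "emp \<omega> \<in> Prob_space"
  unfolding emp_def by (rule empirical_Prob_space[OF n])

lemma integral_emp:
  fixes f :: "'w \<Rightarrow> real"
  shows "f \<in> borel_measurable borel \<Longrightarrow> (\<integral>z. f z \<partial>emp \<omega>) = (\<Sum>i<n. f (W i \<omega>)) / real n"
  unfolding emp_def by (rule integral_empirical[OF n])

lemma sample_vimage_sets:
  fixes S :: "(nat \<Rightarrow> 'w) set"
  assumes "open S" "\<And>w w'. (\<And>i. i < n \<Longrightarrow> w i = w' i) \<Longrightarrow> w \<in> S \<longleftrightarrow> w' \<in> S"
  shows "{\<omega> \<in> space M. (\<lambda>i. W i \<omega>) \<in> S} \<in> events"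
proof -
  \<comment> \<open>Measurability is known for indices below \<open>n\<close> only; the remaining
    coordinates are frozen, and \<open>S\<close> does not notice.\<close>
  let ?h = "\<lambda>\<omega> i. if i < n then W i \<omega> else undefined"
  have "?h \<in> borel_measurable M"
  proof (rule measurable_coordinatewise_then_product)
    show "(\<lambda>\<omega>. ?h \<omega> i) \<in> borel_measurable M" for i
      using W_measurable[of i] by (cases "i < n") auto
  qed
  then have "?h -` S \<inter> space M \<in> events"
    using assms(1) by (intro measurable_sets) auto
  moreover have "?h \<omega> \<in> S \<longleftrightarrow> (\<lambda>i. W i \<omega>) \<in> S" for \<omega>
    by (rule assms(2)) simp
  then have "?h -` S \<inter> space M = {\<omega> \<in> space M. (\<lambda>i. W i \<omega>) \<in> S}" by blast
  ultimately show ?thesis by simp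
qed

lemma emp_open_sets:
  assumes "openin weak_top G"
  shows "{\<omega> \<in> space M. emp \<omega> \<in> G} \<in> events"
proof -
  have "continuous_map euclidean weak_top (\<lambda>w :: nat \<Rightarrow> 'w. empirical n w)"
    by (rule continuous_map_empirical[OF n]) simp
  then have "open {w :: nat \<Rightarrow> 'w. empirical n w \<in> G}"
    using assms by (simp add: continuous_map_def)
  from sample_vimage_sets[OF this] show ?thesis
    using empirical_cong[OF n] unfolding emp_def by (metis (mono_tags, lifting) Collect_cong mem_Collect_eq)
qed

lemma emp_closed_sets:
  assumes "openin weak_top G"
  shows "{\<omega> \<in> space M. emp \<omega> \<notin> G} \<in> events"
proof -
  have "{\<omega> \<in> space M. emp \<omega> \<notin> G} = space M - {\<omega> \<in> space M. emp \<omega> \<in> G}" by auto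
  then show ?thesis using emp_open_sets[OF assms] by simp
qed

lemma distr_law:
  fixes f :: "'w \<Rightarrow> real"
  assumes "i < n" "f \<in> borel_measurable borel"
  shows "(\<integral>\<omega>. f (W i \<omega>) \<partial>M) = (\<integral>z. f z \<partial>\<mu>)"
  using integral_distr[OF W_measurable[OF assms(1)] assms(2)] law[OF assms(1)] by simp

text \<open>Exponential Markov inequality with the tilting parameter absorbed into \<open>f\<close>.
  Measurability of \<open>f\<close> is enough, as indicators of complements of compact sets will be
  inserted.\<close>

lemma chernoff:
  assumes f: "f \<in> borel_measurable borel" and B: "\<And>x. \<bar>f x\<bar> \<le> B"
  shows "{\<omega> \<in> space M. (\<integral>z. f z \<partial>emp \<omega>) \<ge> c} \<in> events"
    and "prob {\<omega> \<in> space M. (\<integral>z. f z \<partial>emp \<omega>) \<ge> c} \<le> exp (- real n * c) * (\<integral>z. exp (f z) \<partial>\<mu>) ^ n"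
proof -
  let ?X = "\<lambda>i \<omega>. exp (f (W i \<omega>))"
  have m: "(\<lambda>\<omega>. f (W i \<omega>)) \<in> borel_measurable M" if "i < n" for i
    using measurable_compose[OF W_measurable[OF that] f] .
  have eq: "{\<omega> \<in> space M. (\<integral>z. f z \<partial>emp \<omega>) \<ge> c} = {\<omega> \<in> space M. (\<Sum>i<n. f (W i \<omega>)) \<ge> real n * c}"
    unfolding integral_emp[OF f] using n by (auto simp: field_simps)
  have S: "(\<lambda>\<omega>. \<Sum>i<n. f (W i \<omega>)) \<in> borel_measurable M"
    using m by (intro borel_measurable_sum) auto
  show sets: "{\<omega> \<in> space M. (\<integral>z. f z \<partial>emp \<omega>) \<ge> c} \<in> events"
    unfolding eq using S by measurable
  let ?A = "{\<omega> \<in> space M. (\<Sum>i<n. f (W i \<omega>)) \<ge> real n * c}"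
  have ind: "indep_vars (\<lambda>_. borel) ?X {..<n}"
    using f by (intro indep_vars_compose2[OF indep]) auto
  have intX: "integrable M (?X i)" if "i \<in> {..<n}" for i
    using m[of i] that B by (intro integrable_const_bound[of _ "exp B"]) (auto simp: abs_le_iff)
  have "(\<integral>\<omega>. (\<Prod>i<n. ?X i \<omega>) \<partial>M) = (\<Prod>i<n. \<integral>\<omega>. ?X i \<omega> \<partial>M)"
    by (rule indep_vars_lebesgue_integral[OF _ ind intX]) auto
  also have "\<dots> = (\<Prod>i<n. \<integral>z. exp (f z) \<partial>\<mu>)"
    using f by (intro prod.cong refl distr_law) auto
  finally have E: "(\<integral>\<omega>. (\<Prod>i<n. ?X i \<omega>) \<partial>M) = (\<integral>z. exp (f z) \<partial>\<mu>) ^ n" by simp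
  have "(\<integral>\<omega>. exp (real n * c) * indicator ?A \<omega> \<partial>M) \<le> (\<integral>\<omega>. (\<Prod>i<n. ?X i \<omega>) \<partial>M)"
  proof (rule integral_mono)
    show "integrable M (\<lambda>\<omega>. exp (real n * c) * indicator ?A \<omega>)"
      using sets unfolding eq by (auto simp: emeasure_eq_measure)
    show "integrable M (\<lambda>\<omega>. \<Prod>i<n. ?X i \<omega>)"
      by (rule indep_vars_integrable[OF _ ind intX]) auto
    show "exp (real n * c) * indicator ?A \<omega> \<le> (\<Prod>i<n. ?X i \<omega>)" for \<omega>
      by (auto simp: indicator_def exp_sum[symmetric] intro!: prod_nonneg)
  qed
  also have "(\<integral>\<omega>. exp (real n * c) * indicator ?A \<omega> \<partial>M) = exp (real n * c) * prob ?A"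
    using sets unfolding eq by simp
  finally show "prob {\<omega> \<in> space M. (\<integral>z. f z \<partial>emp \<omega>) \<ge> c} \<le> exp (- real n * c) * (\<integral>z. exp (f z) \<partial>\<mu>) ^ n"
    unfolding eq E by (simp add: exp_minus field_simps)
qed

lemma hoeffding:
  assumes f: "f \<in> Cb" and B: "\<And>x. \<bar>f x\<bar> \<le> B" "B > 0" and r: "r \<ge> 0"
  shows "prob {\<omega> \<in> space M. \<bar>(\<integral>z. f z \<partial>emp \<omega>) - (\<integral>z. f z \<partial>\<mu>)\<bar> \<ge> r} \<le> 2 * exp (- real n * (r\<^sup>2 / (2 * B\<^sup>2)))"
proof -
  note fm = Cb_measurable[OF f]
  interpret X: Hoeffding_ineq M "{..<n}" "\<lambda>i \<omega>. f (W i \<omega>)" "\<lambda>_. - B" "\<lambda>_. B" "\<Sum>i<n. \<integral>\<omega>. f (W i \<omega>) \<partial>M"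
  proof unfold_locales
    show "indep_vars (\<lambda>_. borel) (\<lambda>i \<omega>. f (W i \<omega>)) {..<n}"
      using fm by (intro indep_vars_compose2[OF indep]) auto
    show "AE x in M. f (W i x) \<in> {- B..B}" for i
      using B(1) by (intro AE_I2) (auto simp: abs_le_iff minus_le_iff)
  qed auto
  have mu: "(\<Sum>i<n. \<integral>\<omega>. f (W i \<omega>) \<partial>M) = real n * (\<integral>z. f z \<partial>\<mu>)"
    using distr_law[OF _ fm] by simp
  have eq: "{\<omega> \<in> space M. \<bar>(\<integral>z. f z \<partial>emp \<omega>) - (\<integral>z. f z \<partial>\<mu>)\<bar> \<ge> r} =
    {\<omega> \<in> space M. \<bar>(\<Sum>i<n. f (W i \<omega>)) - real n * (\<integral>z. f z \<partial>\<mu>)\<bar> \<ge> real n * r}"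
  proof -
    have "\<bar>s / real n - m\<bar> \<ge> r \<longleftrightarrow> \<bar>s - real n * m\<bar> \<ge> real n * r" for s m
    proof -
      have "s / real n - m = (s - real n * m) / real n" using n by (simp add: field_simps)
      then show ?thesis using n by (simp add: field_simps)
    qed
    then show ?thesis unfolding integral_emp[OF fm] by simp
  qed
  have "(\<Sum>i<n. (B - - B)\<^sup>2) = real n * (4 * B\<^sup>2)" by (simp add: power2_eq_square)
  moreover have "- 2 * (real n * r)\<^sup>2 / (real n * (4 * B\<^sup>2)) = - real n * (r\<^sup>2 / (2 * B\<^sup>2))"
    using n B(2) by (simp add: power2_eq_square field_simps)
  moreover have "real n * (4 * B\<^sup>2) > 0" using n B(2) by simp
  ultimately show ?thesis
    using X.Hoeffding_ineq_abs_ge[of "real n * r"] r unfolding mu eq by simp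
qed

end

section \<open>Sanov's theorem\<close>

text \<open>A Dini argument on the compact \<open>\<Gamma> j\<close> makes \<open>h k\<close>
  uniformly small there; off \<open>\<Gamma> j\<close> the bound \<open>B\<close> of
  \<open>h 0\<close> is paid on a mass of at most \<open>1 / Suc j\<close>.\<close>

lemma uniformly_daniell_tight:
  fixes \<Gamma> :: "nat \<Rightarrow> 'a::metric_space set"
  assumes \<Gamma>: "\<And>j. compact (\<Gamma> j)"
  shows "uniformly_daniell {\<nu> \<in> Prob_space. \<forall>j. measure \<nu> (- \<Gamma> j) \<le> 1 / real (Suc j)}"
  unfolding uniformly_daniell_def
proof (intro conjI allI impI)
  fix h :: "nat \<Rightarrow> 'a \<Rightarrow> real" and e :: real
  assume h: "\<forall>k. h k \<in> Cb" "\<forall>x. decseq (\<lambda>k. h k x)" "\<forall>x. (\<lambda>k. h k x) \<longlonglongrightarrow> 0" and e: "0 < e"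
  have nonneg: "0 \<le> h k x" for k x using decseq_ge[OF h(2)[rule_format] h(3)[rule_format]] .
  obtain B where B: "B \<ge> 0" "\<And>x. \<bar>h 0 x\<bar> \<le> B" using Cb_bound[OF h(1)[rule_format, of 0]] by blast
  have mono: "h k x \<le> h j x" if "j \<le> k" for j k x
    using decseqD[OF h(2)[rule_format] that] .
  have hB: "h k x \<le> B" for k x
    using B(2)[of x] mono[of 0 k x] by simp
  obtain j where j: "inverse (real (Suc j)) < e / (2 * (B + 1))"
    using reals_Archimedean[of "e / (2 * (B + 1))"] e B(1) by auto
  define U where "U k = {x. h k x < e / 2}" for k
  have U: "open (U k)" for k
    unfolding U_def using Cb_continuous[OF h(1)[rule_format]] by (intro open_Collect_less continuous_intros) auto
  have "\<Gamma> j \<subseteq> (\<Union>k\<in>UNIV. U k)"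
  proof
    fix x
    have "eventually (\<lambda>k. h k x < e / 2) sequentially"
      by (rule order_tendstoD(2)[OF h(3)[rule_format]]) (use e in simp)
    then show "x \<in> (\<Union>k\<in>UNIV. U k)" by (auto simp: U_def eventually_sequentially)
  qed
  then obtain C where C: "finite C" "\<Gamma> j \<subseteq> (\<Union>k\<in>C. U k)"
    by (rule compactE_image[OF \<Gamma> U])
  define k where "k = Max (insert 0 C)"
  have k: "h k x \<le> e / 2" if x: "x \<in> \<Gamma> j" for x
  proof -
    obtain i where "i \<in> C" "h i x < e / 2" using C(2) x unfolding U_def by blast
    moreover have "i \<le> k" using C(1) \<open>i \<in> C\<close> by (simp add: k_def)
    ultimately show ?thesis using mono[of i k x] by simp
  qed
  have "(\<integral>x. h k x \<partial>\<nu>) \<le> e" if \<nu>: "\<nu> \<in> Prob_space" "measure \<nu> (- \<Gamma> j) \<le> 1 / real (Suc j)" for \<nu>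
  proof -
    interpret prob_space \<nu> using Prob_spaceD[OF \<nu>(1)] by simp
    have s: "- \<Gamma> j \<in> sets \<nu>"
      using \<Gamma>[THEN compact_imp_closed, of j] Prob_spaceD[OF \<nu>(1)] by (simp add: borel_open open_Compl)
    have ii: "integrable \<nu> (indicator (- \<Gamma> j) :: 'a \<Rightarrow> real)"
      using s by (intro integrable_real_indicator) (simp_all add: emeasure_eq_measure)
    have "(\<integral>x. h k x \<partial>\<nu>) \<le> (\<integral>x. e / 2 + B * indicator (- \<Gamma> j) x \<partial>\<nu>)"
    proof (rule integral_mono)
      show "integrable \<nu> (h k)" by (rule Cb_integrable[OF \<nu>(1) h(1)[rule_format]])
      show "integrable \<nu> (\<lambda>x. e / 2 + B * indicator (- \<Gamma> j) x)"
        using ii by simp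
      show "h k x \<le> e / 2 + B * indicator (- \<Gamma> j) x" for x
        using k[of x] hB[of k x] e by (auto simp: indicator_def)
    qed
    also have "\<dots> = e / 2 + B * measure \<nu> (- \<Gamma> j)"
      using ii s by (simp add: Prob_space_measure_UNIV[OF \<nu>(1)] Prob_spaceD(3)[OF \<nu>(1)])
    also have "\<dots> \<le> e / 2 + (B + 1) * inverse (real (Suc j))"
      using \<nu>(2) B(1) by (intro add_left_mono mult_mono) (auto simp: inverse_eq_divide)
    also have "\<dots> \<le> e / 2 + (B + 1) * (e / (2 * (B + 1)))"
      using j B(1) by (intro add_left_mono mult_left_mono) auto
    also have "\<dots> = e" using B(1) by (simp add: field_simps)
    finally show ?thesis .
  qed
  then show "\<exists>k. \<forall>m\<in>{\<nu> \<in> Prob_space. \<forall>j. measure \<nu> (- \<Gamma> j) \<le> 1 / real (Suc j)}. (\<integral>x. h k x \<partial>m) \<le> e"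
    by blast
qed auto

text \<open>The compact sets are fixed before the sample and before \<open>n\<close>, so the
  exponential bound is uniform. The exceptional event is a union over all \<open>j\<close>, each
  part bounded by \<open>chernoff\<close> for a multiple of the indicator of
  \<open>- \<Gamma> j\<close>.\<close>

lemma exponential_tightness:
  fixes \<mu> :: "'w::polish_space measure"
  assumes \<mu>: "\<mu> \<in> Prob_space"
  obtains \<Gamma> where "\<And>j. compact (\<Gamma> j)"
    "\<And>(M :: 'o measure) W n. iid_sample M W n \<mu> \<Longrightarrow>
       \<exists>N \<in> sets M. {\<omega> \<in> space M. \<exists>j. measure (iid_sample.emp W n \<omega>) (- \<Gamma> j) > 1 / real (Suc j)} \<subseteq> N \<and>
         measure M N \<le> exp (- real n * a)"
proof -
  \<comment> \<open>Mass above \<open>1 / Suc j\<close> outside \<open>\<Gamma> j\<close> forces the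
    integral of \<open>t j\<close> times the indicator to reach
    \<open>\<bar>a\<bar> + j + 2\<close>. Here \<open>\<bar>a\<bar>\<close> pays for the rate, one
    unit for the exponential moment (at most \<open>exp 1\<close>), and \<open>j + 1\<close> for
    summability over \<open>j\<close>.\<close>
  define t where "t j = real (Suc j) * (\<bar>a\<bar> + real j + 2)" for j
  have "\<exists>K. compact K \<and> measure \<mu> (- K) < exp (- t j)" for j
    using inner_regular_approx[OF \<mu>, of UNIV "exp (- t j)"] by (auto simp: Compl_eq_Diff_UNIV)
  then obtain \<Gamma> where \<Gamma>: "\<And>j. compact (\<Gamma> j)" "\<And>j. measure \<mu> (- \<Gamma> j) < exp (- t j)" by metis
  have t0: "t j \<ge> 0" for j by (simp add: t_def)
  interpret mu: prob_space \<mu> using Prob_spaceD[OF \<mu>] by simp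
  show thesis
  proof (rule that[OF \<Gamma>(1)])
    fix M :: "'o measure" and W n
    assume "iid_sample M W n \<mu>"
    then interpret iid_sample M W n \<mu> .
    define f where "f j z = t j * indicator (- \<Gamma> j) z" for j z
    have G: "- \<Gamma> j \<in> sets borel" for j
      using \<Gamma>(1)[THEN compact_imp_closed, of j] by (simp add: borel_open open_Compl)
    have fm: "f j \<in> borel_measurable borel" for j unfolding f_def using G by measurable
    have fB: "\<bar>f j x\<bar> \<le> t j" for j x using t0 by (auto simp: f_def indicator_def)
    have fi: "(\<integral>z. f j z \<partial>m) = t j * measure m (- \<Gamma> j)" if "m \<in> Prob_space" for m j
      using Prob_spaceD[OF that] G by (simp add: f_def)
    define A where "A j = {\<omega> \<in> space M. (\<integral>z. f j z \<partial>emp \<omega>) \<ge> \<bar>a\<bar> + real j + 2}" for j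
    have As: "A j \<in> events" for j unfolding A_def by (rule chernoff(1)[OF fm fB])
    have sub: "{\<omega> \<in> space M. \<exists>j. measure (emp \<omega>) (- \<Gamma> j) > 1 / real (Suc j)} \<subseteq> (\<Union>j. A j)"
    proof safe
      fix \<omega> j assume \<omega>: "\<omega> \<in> space M" "measure (emp \<omega>) (- \<Gamma> j) > 1 / real (Suc j)"
      have "t j * (1 / real (Suc j)) \<le> t j * measure (emp \<omega>) (- \<Gamma> j)"
        using \<omega>(2) t0[of j] by (intro mult_left_mono) auto
      moreover have "t j * (1 / real (Suc j)) = \<bar>a\<bar> + real j + 2" by (simp add: t_def del: of_nat_Suc)
      ultimately show "\<omega> \<in> (\<Union>j. A j)" using \<omega>(1) fi[OF emp_Prob_space] by (auto simp: A_def)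
    qed
    have mgf: "(\<integral>z. exp (f j z) \<partial>\<mu>) \<le> exp 1" for j
    proof -
      have "(\<integral>z. exp (f j z) \<partial>\<mu>) \<le> (\<integral>z. 1 + exp (t j) * indicator (- \<Gamma> j) z \<partial>\<mu>)"
      proof (rule integral_mono[OF exp_integral_pos(1)[OF \<mu> fm fB]])
        show "integrable \<mu> (\<lambda>z. 1 + exp (t j) * indicator (- \<Gamma> j) z)"
          using G Prob_spaceD[OF \<mu>] by (auto simp: mu.emeasure_eq_measure)
        show "exp (f j z) \<le> 1 + exp (t j) * indicator (- \<Gamma> j) z" for z
          by (auto simp: f_def indicator_def)
      qed
      also have "\<dots> = 1 + exp (t j) * measure \<mu> (- \<Gamma> j)"
        using G Prob_spaceD[OF \<mu>] mu.prob_space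
        by (subst Bochner_Integration.integral_add) (auto simp: mu.emeasure_eq_measure)
      also have "\<dots> \<le> 1 + exp (t j) * exp (- t j)"
        using \<Gamma>(2)[of j] by (intro add_left_mono mult_left_mono) auto
      also have "\<dots> = 1 + 1" by (simp flip: exp_add)
      also have "\<dots> \<le> exp 1" by (rule exp_ge_add_one_self)
      finally show ?thesis .
    qed
    have pA: "prob (A j) \<le> exp (- real n * a) * (1 / 2) ^ Suc j" for j
    proof -
      have "prob (A j) \<le> exp (- real n * (\<bar>a\<bar> + real j + 2)) * (\<integral>z. exp (f j z) \<partial>\<mu>) ^ n"
        unfolding A_def by (rule chernoff(2)[OF fm fB])
      also have "\<dots> \<le> exp (- real n * (\<bar>a\<bar> + real j + 2)) * exp 1 ^ n"
        using exp_integral_pos(2)[OF \<mu> fm fB, of j] by (intro mult_left_mono power_mono mgf) auto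
      also have "\<dots> = exp (- real n * \<bar>a\<bar>) * exp (- (real n * real (Suc j)))"
        by (simp add: exp_of_nat_mult[symmetric] exp_add[symmetric] algebra_simps)
      also have "\<dots> \<le> exp (- real n * a) * exp (- (1 * real (Suc j)))"
      proof (intro mult_mono)
        show "exp (- (real n * real (Suc j))) \<le> exp (- (1 * real (Suc j)))"
          unfolding exp_le_cancel_iff neg_le_iff_le using n by (intro mult_right_mono) auto
      qed (auto simp: mult_left_mono)
      also have "exp (- (1 * real (Suc j))) = exp (- 1) ^ Suc j"
        by (subst exp_of_nat_mult[symmetric]) simp
      also have "exp (- real n * a) * \<dots> \<le> exp (- real n * a) * (1 / 2) ^ Suc j"
      proof (intro mult_left_mono power_mono)
        have "2 \<le> exp (1::real)" using exp_ge_add_one_self[of "1::real"] by simp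
        then show "exp (- 1) \<le> 1 / (2::real)" by (simp add: exp_minus field_simps)
      qed auto
      finally show ?thesis .
    qed
    have s: "(\<lambda>j. exp (- real n * a) * (1 / 2) ^ Suc j) sums (exp (- real n * a) * 1)"
      by (intro sums_mult power_half_series)
    have summ: "summable (\<lambda>j. prob (A j))"
      by (rule summable_comparison_test'[OF sums_summable[OF s]]) (use pA in auto)
    have "prob (\<Union>j. A j) \<le> (\<Sum>j. prob (A j))"
      by (rule finite_measure_subadditive_countably[OF _ summ]) (use As in auto)
    also have "\<dots> \<le> exp (- real n * a)"
      using suminf_le[OF pA summ sums_summable[OF s]] sums_unique[OF s] by simp
    finally show "\<exists>N\<in>events. {\<omega> \<in> space M. \<exists>j. measure (emp \<omega>) (- \<Gamma> j) > 1 / real (Suc j)} \<subseteq> N \<and>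
         prob N \<le> exp (- real n * a)"
      using As sub by (intro bexI[of _ "\<Union>j. A j"]) auto
  qed
qed

text \<open>By Donsker--Varadhan the half spaces \<open>\<integral>g > a + ln \<integral>e\<^sup>g d\<mu>\<close> cover the complement of the
  sublevel set, and each is hit with probability at most \<open>e\<close> to the power \<open>- n a\<close>; tightness leaves
  finitely many of them.\<close>

lemma sanov_upper:
  fixes \<mu> :: "'w::polish_space measure"
  assumes \<mu>: "\<mu> \<in> Prob_space" and G: "openin weak_top G"
    and sub: "{\<nu> \<in> Prob_space. rel_entropy \<nu> \<mu> \<le> ereal a} \<subseteq> G"
  shows "\<exists>c. \<forall>(M :: 'o measure) W n. iid_sample M W n \<mu> \<longrightarrow>
    measure M {\<omega> \<in> space M. empirical n (\<lambda>i. W i \<omega>) \<notin> G} \<le> c * exp (- real n * a)"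
proof -
  obtain \<Gamma> where \<Gamma>: "\<And>j. compact (\<Gamma> j)"
    "\<And>(M :: 'o measure) W n. iid_sample M W n \<mu> \<Longrightarrow>
       \<exists>N \<in> sets M. {\<omega> \<in> space M. \<exists>j. measure (iid_sample.emp W n \<omega>) (- \<Gamma> j) > 1 / real (Suc j)} \<subseteq> N \<and>
         measure M N \<le> exp (- real n * a)"
    by (rule exponential_tightness[OF \<mu>, of a]) (rule that)
  define K where "K = {\<nu> \<in> Prob_space. \<forall>j. measure \<nu> (- \<Gamma> j) \<le> 1 / real (Suc j)}"
  define U where "U g = {\<nu> \<in> Prob_space. (\<integral>z. g z \<partial>\<nu>) \<in> {a + ln (\<integral>z. exp (g z) \<partial>\<mu>)<..}}" for g :: "'w \<Rightarrow> real"
  have "\<exists>\<F>. finite \<F> \<and> \<F> \<subseteq> U ` Cb \<and> (topspace weak_top - G) \<inter> K \<subseteq> \<Union>\<F>"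
  proof (rule uniformly_daniell_finite_subcover)
    show "uniformly_daniell K" unfolding K_def by (rule uniformly_daniell_tight[OF \<Gamma>(1)])
    show "closedin weak_top (topspace weak_top - G)" using G by blast
    show "openin weak_top V" if "V \<in> U ` Cb" for V
      using that openin_weak_top_vimage[OF _ open_greaterThan] unfolding U_def by blast
    show "topspace weak_top - G \<subseteq> \<Union> (U ` Cb)"
    proof
      fix \<nu> :: "'w measure" assume "\<nu> \<in> topspace weak_top - G"
      then have \<nu>: "\<nu> \<in> Prob_space" "\<nu> \<notin> G" by auto
      then have "rel_entropy \<nu> \<mu> > ereal a" using sub by (auto simp: not_le[symmetric])
      from donsker_varadhan_gt[OF \<mu> \<nu>(1) this] show "\<nu> \<in> \<Union> (U ` Cb)" using \<nu>(1) by (auto simp: U_def)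
    qed
  qed
  then obtain \<F> where \<F>: "finite \<F>" "\<F> \<subseteq> U ` Cb" "(Prob_space - G) \<inter> K \<subseteq> \<Union>\<F>" by auto
  then obtain gs where gs: "finite gs" "gs \<subseteq> Cb" "\<F> = U ` gs"
    using finite_subset_image by metis
  show ?thesis
  \<comment> \<open>One term for the failure of tightness and one for each half space; the count
    does not depend on \<open>n\<close>.\<close>
  proof (rule exI[of _ "1 + real (card gs)"], intro allI impI)
    fix M :: "'o measure" and W n
    assume iid: "iid_sample M W n \<mu>"
    then interpret iid_sample M W n \<mu> .
    obtain N where N: "N \<in> events" "{\<omega> \<in> space M. \<exists>j. measure (emp \<omega>) (- \<Gamma> j) > 1 / real (Suc j)} \<subseteq> N"
      "prob N \<le> exp (- real n * a)" using \<Gamma>(2)[OF iid] by blast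
    define A where "A g = {\<omega> \<in> space M. (\<integral>z. g z \<partial>emp \<omega>) \<ge> a + ln (\<integral>z. exp (g z) \<partial>\<mu>)}" for g
    have A: "A g \<in> events" "prob (A g) \<le> exp (- real n * a)" if "g \<in> gs" for g
    proof -
      have g: "g \<in> Cb" using that gs(2) by blast
      obtain B where B: "\<And>x. \<bar>g x\<bar> \<le> B" using Cb_bound[OF g] by blast
      note ch = chernoff[OF Cb_measurable[OF g] B, of "a + ln (\<integral>z. exp (g z) \<partial>\<mu>)", folded A_def]
      show "A g \<in> events" by (rule ch(1))
      define Z where "Z = (\<integral>z. exp (g z) \<partial>\<mu>)"
      have Z: "Z > 0" unfolding Z_def by (rule exp_integral_pos(2)[OF \<mu> Cb_measurable[OF g] B])
      have "exp (- real n * (a + ln Z)) * Z ^ n = exp (- real n * a) * exp (- (real n * ln Z)) * exp (ln Z) ^ n"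
        using Z by (simp add: exp_add[symmetric] algebra_simps)
      also have "\<dots> = exp (- real n * a) * (exp (- (real n * ln Z)) * exp (real n * ln Z))"
        by (simp add: exp_of_nat_mult)
      also have "\<dots> = exp (- real n * a)" by (simp flip: exp_add)
      finally show "prob (A g) \<le> exp (- real n * a)" using ch(2) by (simp add: Z_def)
    qed
    have "{\<omega> \<in> space M. emp \<omega> \<notin> G} \<subseteq> N \<union> (\<Union>g\<in>gs. A g)"
    proof
      fix \<omega> assume "\<omega> \<in> {\<omega> \<in> space M. emp \<omega> \<notin> G}"
      then have \<omega>: "\<omega> \<in> space M" "emp \<omega> \<in> Prob_space - G" using emp_Prob_space by auto
      show "\<omega> \<in> N \<union> (\<Union>g\<in>gs. A g)"
      proof (cases "emp \<omega> \<in> K")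
        case True
        with \<F>(3) \<omega>(2) gs(3) obtain g where "g \<in> gs" "emp \<omega> \<in> U g" by blast
        with \<omega>(1) show ?thesis by (auto simp: U_def A_def intro: less_imp_le)
      next
        case False
        then have "\<exists>j. measure (emp \<omega>) (- \<Gamma> j) > 1 / real (Suc j)"
          using emp_Prob_space by (auto simp: K_def not_le)
        with N(2) \<omega>(1) show ?thesis by blast
      qed
    qed
    then have "prob {\<omega> \<in> space M. emp \<omega> \<notin> G} \<le> prob (N \<union> (\<Union>g\<in>gs. A g))"
      using N(1) A(1) gs(1) by (intro finite_measure_mono) auto
    also have "\<dots> \<le> prob N + prob (\<Union>g\<in>gs. A g)"
      using N(1) A(1) gs(1) by (intro measure_Un_le) auto
    also have "prob (\<Union>g\<in>gs. A g) \<le> (\<Sum>g\<in>gs. prob (A g))"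
      using A(1) gs(1) by (intro finite_measure_subadditive_finite) auto
    also have "\<dots> \<le> (\<Sum>g\<in>gs. exp (- real n * a))" by (intro sum_mono A(2))
    finally show "prob {\<omega> \<in> space M. empirical n (\<lambda>i. W i \<omega>) \<notin> G} \<le> (1 + real (card gs)) * exp (- real n * a)"
      using N(3) by (simp add: emp_def algebra_simps)
  qed
qed

section \<open>Product measures and the lower bound\<close>

lemma iid_sample_PiM:
  fixes \<nu> :: "'w::{second_countable_topology, metric_space} measure"
  assumes "\<nu> \<in> Prob_space" "n \<ge> 1"
  shows "iid_sample (PiM {..<n} (\<lambda>_. \<nu>)) (\<lambda>i x. x i) n \<nu>"
proof -
  have pr: "prob_space \<nu>" and s: "sets \<nu> = sets borel" using assms Prob_spaceD by auto
  interpret prob_space "PiM {..<n} (\<lambda>_. \<nu>)" by (rule prob_space_PiM) (rule pr)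
  have m: "(\<lambda>x. x i) \<in> PiM {..<n} (\<lambda>_. \<nu>) \<rightarrow>\<^sub>M \<nu>" if "i < n" for i
    using that by (intro measurable_component_singleton) auto
  have m': "(\<lambda>x. x i) \<in> PiM {..<n} (\<lambda>_. \<nu>) \<rightarrow>\<^sub>M borel" if "i < n" for i
    using m[OF that] by (simp add: measurable_cong_sets[OF refl s])
  have l: "distr (PiM {..<n} (\<lambda>_. \<nu>)) borel (\<lambda>x. x i) = \<nu>" if "i < n" for i
    using distr_PiM_component[of "{..<n}" "\<lambda>_. \<nu>" i] that pr
    by (simp add: distr_cong[OF refl s[symmetric], of "PiM {..<n} (\<lambda>_. \<nu>)"])
  have ps: "sets (PiM {..<n} (\<lambda>_. borel)) = sets (PiM {..<n} (\<lambda>_. \<nu>))"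
    by (intro sets_PiM_cong) (simp_all add: s)
  \<comment> \<open>Independence of the coordinates amounts to the restriction map, which is the
    identity on the product space, reproducing the product measure.\<close>
  have "distr (PiM {..<n} (\<lambda>_. \<nu>)) (PiM {..<n} (\<lambda>_. borel)) (\<lambda>x. \<lambda>i\<in>{..<n}. x i)
     = distr (PiM {..<n} (\<lambda>_. \<nu>)) (PiM {..<n} (\<lambda>_. \<nu>)) (\<lambda>x. x)"
    by (intro distr_cong ps refl) (auto simp: space_PiM PiE_def extensional_restrict)
  also have "\<dots> = PiM {..<n} (\<lambda>i. distr (PiM {..<n} (\<lambda>_. \<nu>)) borel (\<lambda>x. x i))"
    by (auto simp: l distr_id intro!: PiM_cong)
  finally have "indep_vars (\<lambda>_. borel) (\<lambda>i x. x i) {..<n}"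
    using assms(2) m' by (subst indep_vars_iff_distr_eq_PiM') (auto simp: lessThan_empty_iff)
  then show ?thesis using assms(2) l by unfold_locales auto
qed

text \<open>The change of measure takes place on the product space; this carries probabilities of
  the abstract sample over to it.\<close>

lemma (in iid_sample) distr_sample:
  "distr M (PiM {..<n} (\<lambda>_. \<mu>)) (\<lambda>\<omega>. \<lambda>i\<in>{..<n}. W i \<omega>) = PiM {..<n} (\<lambda>_. \<mu>)"
proof -
  have ps: "sets (PiM {..<n} (\<lambda>_. \<mu>)) = sets (PiM {..<n} (\<lambda>_. borel))"
    by (intro sets_PiM_cong) (simp_all add: Prob_spaceD(2)[OF mu_Prob_space])
  have "distr M (PiM {..<n} (\<lambda>_. borel)) (\<lambda>\<omega>. \<lambda>i\<in>{..<n}. W i \<omega>) = PiM {..<n} (\<lambda>i. distr M borel (W i))"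
    using indep n W_measurable by (subst indep_vars_iff_distr_eq_PiM'[symmetric]) (auto simp: lessThan_empty_iff)
  also have "\<dots> = PiM {..<n} (\<lambda>_. \<mu>)" by (intro PiM_cong) (auto simp: law)
  finally show ?thesis using distr_cong[OF refl ps, of M] by simp
qed

text \<open>Rectangles determine a product measure, and on a rectangle both sides factor.\<close>

lemma PiM_density:
  fixes D :: "'w \<Rightarrow> real"
  assumes \<mu>: "prob_space \<mu>" and D: "D \<in> borel_measurable \<mu>" "\<And>z. 0 \<le> D z"
    and \<nu>: "prob_space (density \<mu> (\<lambda>z. ennreal (D z)))"
  shows "PiM {..<n::nat} (\<lambda>_. density \<mu> (\<lambda>z. ennreal (D z)))
     = density (PiM {..<n} (\<lambda>_. \<mu>)) (\<lambda>x. ennreal (\<Prod>i<n. D (x i)))" (is "?L = ?R")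
proof -
  interpret mu: product_sigma_finite "\<lambda>_::nat. \<mu>"
    by (intro product_sigma_finite.intro prob_space_imp_sigma_finite \<mu>)
  interpret nu: product_sigma_finite "\<lambda>_::nat. density \<mu> (\<lambda>z. ennreal (D z))"
    by (intro product_sigma_finite.intro prob_space_imp_sigma_finite \<nu>)
  have "?R = ?L"
  proof (rule nu.PiM_eqI)
    show "sets ?R = sets ?L" by (simp cong: sets_PiM_cong)
    fix A assume A: "\<And>i. i \<in> {..<n} \<Longrightarrow> A i \<in> sets (density \<mu> (\<lambda>z. ennreal (D z)))"
    have m: "(\<lambda>x. \<Prod>i<n. D (x i)) \<in> borel_measurable (PiM {..<n} (\<lambda>_. \<mu>))"
      using D(1) by measurable
    have ind: "indicator (Pi\<^sub>E {..<n} A) x = (\<Prod>i<n. indicator (A i) (x i) :: ennreal)"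
      if x: "x \<in> space (PiM {..<n} (\<lambda>_. \<mu>))" for x
    proof (cases "x \<in> Pi\<^sub>E {..<n} A")
      case True
      then show ?thesis by (auto simp: PiE_iff)
    next
      case False
      then obtain i where "i < n" "x i \<notin> A i" using x by (auto simp: space_PiM PiE_iff)
      then have "(\<Prod>i<n. indicator (A i) (x i) :: ennreal) = 0"
        by (intro prod_zero bexI[of _ i]) auto
      with False show ?thesis by simp
    qed
    have "emeasure ?R (Pi\<^sub>E {..<n} A) = (\<integral>\<^sup>+ x. ennreal (\<Prod>i<n. D (x i)) * indicator (Pi\<^sub>E {..<n} A) x \<partial>PiM {..<n} (\<lambda>_. \<mu>))"
      using m A by (subst emeasure_density) (auto intro!: sets_PiM_I_finite)
    also have "\<dots> = (\<integral>\<^sup>+ x. (\<Prod>i<n. ennreal (D (x i)) * indicator (A i) (x i)) \<partial>PiM {..<n} (\<lambda>_. \<mu>))"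
      by (intro nn_integral_cong) (simp add: ind prod.distrib prod_ennreal D(2))
    also have "\<dots> = (\<Prod>i<n. \<integral>\<^sup>+ z. ennreal (D z) * indicator (A i) z \<partial>\<mu>)"
      using A D(1) by (intro mu.product_nn_integral_prod) auto
    also have "\<dots> = (\<Prod>i<n. emeasure (density \<mu> (\<lambda>z. ennreal (D z))) (A i))"
      using A D(1) by (intro prod.cong refl emeasure_density[symmetric]) auto
    finally show "emeasure ?R (Pi\<^sub>E {..<n} A) = (\<Prod>i<n. emeasure (density \<mu> (\<lambda>z. ennreal (D z))) (A i))" .
  qed simp
  then show ?thesis by simp
qed

text \<open>Change of measure. With \<open>g = ln (dQ/dP)\<close> the tangent line bound
  \<open>exp (- g) \<ge> exp (- c) (1 + c - g)\<close> is integrated over \<open>A\<close>; the choice of \<open>c\<close> makes the right hand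
  side equal to \<open>exp (- c) Q A\<close>.\<close>

lemma change_of_measure_lower:
  fixes g :: "'b \<Rightarrow> real"
  assumes P: "prob_space P" and Q: "prob_space Q" and Qd: "Q = density P (\<lambda>x. ennreal (L x))"
    and L: "L \<in> borel_measurable P" and g: "g \<in> borel_measurable P"
    and Lg: "\<And>x. exp (- g x) * L x \<le> 1" "\<And>x. 0 \<le> L x"
    and gi: "integrable Q g" "(\<integral>x. g x \<partial>Q) = h" and A: "A \<in> sets P" and q: "measure Q A > 0"
  shows "measure P A \<ge> measure Q A * exp (- (h + 1) / measure Q A)"
proof -
  interpret P: prob_space P by fact
  interpret Q: prob_space Q by fact
  define q where "q = measure Q A"
  define c where "c = (h + 1) / q"
  have q0: "q > 0" using q by (simp add: q_def)
  have cq: "c * q = h + 1" using q0 by (simp add: c_def)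
  have sQ: "sets Q = sets P" by (simp add: Qd)
  have gQ: "g \<in> borel_measurable Q" using g by (simp add: Qd)
  have AQ: "A \<in> sets Q" using A sQ by simp
  \<comment> \<open>\<open>exp (- g)\<close> is at most \<open>1 / L\<close> where
    \<open>L > 0\<close>, so \<open>Q\<close> weighted by \<open>exp (- g)\<close> is dominated by
    \<open>P\<close>. Only an inequality is available, as \<open>L\<close> may vanish.\<close>
  have key: "(\<integral>\<^sup>+ x. ennreal (exp (- g x)) * indicator S x \<partial>Q) \<le> emeasure P S" if S: "S \<in> sets P" for S
  proof -
    have "(\<integral>\<^sup>+ x. ennreal (exp (- g x)) * indicator S x \<partial>Q)
      = (\<integral>\<^sup>+ x. ennreal (L x) * (ennreal (exp (- g x)) * indicator S x) \<partial>P)"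
      unfolding Qd using L g S by (intro nn_integral_density) auto
    also have "\<dots> \<le> (\<integral>\<^sup>+ x. indicator S x \<partial>P)"
    proof (intro nn_integral_mono)
      fix x
      have "ennreal (L x) * ennreal (exp (- g x)) \<le> 1"
        using Lg[of x] by (simp add: ennreal_mult[symmetric] mult.commute ennreal_le_1)
      then show "ennreal (L x) * (ennreal (exp (- g x)) * indicator S x) \<le> indicator S x"
        by (auto simp: indicator_def)
    qed
    also have "\<dots> = emeasure P S" using S by simp
    finally show ?thesis .
  qed
  have "(\<integral>\<^sup>+ x. ennreal (exp (- g x)) \<partial>Q) = (\<integral>\<^sup>+ x. ennreal (exp (- g x)) * indicator (space P) x \<partial>Q)"
    by (intro nn_integral_cong) (simp add: Qd)
  also have "\<dots> \<le> 1" using key[of "space P"] by (simp add: P.emeasure_space_1)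
  finally have n1: "(\<integral>\<^sup>+ x. ennreal (exp (- g x)) \<partial>Q) \<le> 1" .
  have ei: "integrable Q (\<lambda>x. exp (- g x))"
    by (rule integrableI_nonneg) (use gQ n1 in \<open>auto intro: le_less_trans\<close>)
  have eiS: "integrable Q (\<lambda>x. exp (- g x) * indicator A x)"
    using ei AQ by (intro integrable_real_mult_indicator)
  have giS: "integrable Q (\<lambda>x. g x * indicator A x)"
    using gi(1) AQ by (intro integrable_real_mult_indicator)
  have iA: "integrable Q (indicator A :: 'b \<Rightarrow> real)"
    using AQ by (simp add: integrable_indicator_iff Q.emeasure_eq_measure)
  have intA: "(\<integral>x. indicator A x \<partial>Q) = q"
    using AQ sets.sets_into_space[OF AQ] by (simp add: q_def Int_absorb2)
  have "ennreal (\<integral>x. exp (- g x) \<partial>Q) \<le> ennreal 1"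
    using n1 by (subst nn_integral_eq_integral[OF ei, symmetric]) auto
  then have e1: "(\<integral>x. exp (- g x) \<partial>Q) \<le> 1" by (simp add: ennreal_le_1)
  have "ennreal (\<integral>x. exp (- g x) * indicator A x \<partial>Q) \<le> ennreal (measure P A)"
  proof (subst nn_integral_eq_integral[OF eiS, symmetric])
    show "(\<integral>\<^sup>+ x. ennreal (exp (- g x) * indicator A x) \<partial>Q) \<le> ennreal (measure P A)"
      using key[OF A] by (simp add: ennreal_mult' P.emeasure_eq_measure ennreal_indicator)
  qed auto
  then have eA: "(\<integral>x. exp (- g x) * indicator A x \<partial>Q) \<le> measure P A" by simp
  \<comment> \<open>Discarding the complement of \<open>A\<close> costs at most 1: there
    \<open>- g \<le> exp (- g)\<close>, whose integral under \<open>Q\<close> is at most 1. This is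
    the \<open>+ 1\<close> in the exponent.\<close>
  have "(\<integral>x. g x * indicator A x - g x \<partial>Q) \<le> (\<integral>x. exp (- g x) \<partial>Q)"
  proof (rule integral_mono)
    show "integrable Q (\<lambda>x. g x * indicator A x - g x)" using giS gi(1) by simp
    show "g x * indicator A x - g x \<le> exp (- g x)" for x
      using exp_ge_add_one_self[of "- g x"] by (auto simp: indicator_def intro: less_imp_le)
  qed (rule ei)
  then have gA: "(\<integral>x. g x * indicator A x \<partial>Q) \<le> h + 1" using e1 giS gi by simp
  have "exp (- c) * q \<le> exp (- c) * ((1 + c) * q - (\<integral>x. g x * indicator A x \<partial>Q))"
    using gA cq by (intro mult_left_mono) (auto simp: algebra_simps)
  also have "\<dots> = (\<integral>x. exp (- c) * ((1 + c) * indicator A x - g x * indicator A x) \<partial>Q)"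
    using iA giS intA by simp
  also have "\<dots> \<le> (\<integral>x. exp (- g x) * indicator A x \<partial>Q)"
  proof (rule integral_mono[OF _ eiS])
    show "integrable Q (\<lambda>x. exp (- c) * ((1 + c) * indicator A x - g x * indicator A x))"
      using iA giS by simp
    fix x
    have "exp (- c) * (1 + (c - g x)) \<le> exp (- c) * exp (c - g x)"
      by (intro mult_left_mono exp_ge_add_one_self) auto
    then show "exp (- c) * ((1 + c) * indicator A x - g x * indicator A x) \<le> exp (- g x) * indicator A x"
      by (auto simp: indicator_def exp_add[symmetric] algebra_simps)
  qed
  also note eA
  finally have "q * exp (- c) \<le> measure P A" by (simp add: mult.commute)
  moreover have "- c = - (h + 1) / q" by (simp only: c_def minus_divide_left)
  ultimately show ?thesis by (simp only: q_def)
qed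

text \<open>A weak neighbourhood contains one given by finitely many bounded test functions, and
  \<open>hoeffding\<close> for each makes the exceptional probability vanish. Convergence in
  probability is the right notion, since the product space changes with \<open>n\<close>.\<close>

lemma empirical_LLN:
  fixes \<nu> :: "'w::{second_countable_topology, metric_space} measure"
  assumes \<nu>: "\<nu> \<in> Prob_space" and G: "openin weak_top G" "\<nu> \<in> G"
  shows "(\<lambda>n. measure (PiM {..<n} (\<lambda>_. \<nu>)) {x \<in> space (PiM {..<n} (\<lambda>_. \<nu>)). empirical n x \<in> G}) \<longlonglongrightarrow> 1"
    (is "?q \<longlonglongrightarrow> 1")
proof -
  from weak_top_nbhd[OF G] obtain \<Phi> r where \<Phi>: "finite \<Phi>" "\<Phi> \<subseteq> Cb" "r > 0"
    "\<forall>m\<in>Prob_space. (\<forall>f\<in>\<Phi>. \<bar>(\<integral>z. f z \<partial>m) - (\<integral>z. f z \<partial>\<nu>)\<bar> < r) \<longrightarrow> m \<in> G"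
    by blast
  have "\<forall>f\<in>\<Phi>. \<exists>B. B > 0 \<and> (\<forall>x. \<bar>f x\<bar> \<le> B)"
  proof
    fix f assume "f \<in> \<Phi>"
    then obtain B where "B \<ge> 0" "\<forall>x. \<bar>f x\<bar> \<le> B" using Cb_bound \<Phi>(2) by blast
    then show "\<exists>B. B > 0 \<and> (\<forall>x. \<bar>f x\<bar> \<le> B)"
      by (intro exI[of _ "B + 1"]) (auto intro: add_increasing2)
  qed
  from bchoice[OF this] obtain B where B: "\<And>f. f \<in> \<Phi> \<Longrightarrow> B f > 0" "\<And>f x. f \<in> \<Phi> \<Longrightarrow> \<bar>f x\<bar> \<le> B f"
    by blast
  have ge: "1 - (\<Sum>f\<in>\<Phi>. 2 * exp (- real n * (r\<^sup>2 / (2 * (B f)\<^sup>2)))) \<le> ?q n" if n: "n \<ge> 1" for n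
  proof -
    interpret iid_sample "PiM {..<n} (\<lambda>_. \<nu>)" "\<lambda>i x. x i" n \<nu> by (rule iid_sample_PiM[OF \<nu> n])
    let ?M = "PiM {..<n} (\<lambda>_. \<nu>)"
    have e: "emp x = empirical n x" for x by (simp add: emp_def)
    define A where "A f = {x \<in> space ?M. \<bar>(\<integral>z. f z \<partial>emp x) - (\<integral>z. f z \<partial>\<nu>)\<bar> \<ge> r}" for f
    have As: "A f \<in> events" if "f \<in> \<Phi>" for f
    proof -
      have f: "f \<in> Cb" using that \<Phi>(2) by blast
      have "openin weak_top {m \<in> Prob_space. (\<integral>z. f z \<partial>m) \<in> ball (\<integral>z. f z \<partial>\<nu>) r}"
        by (rule openin_weak_top_vimage[OF f open_ball])
      from emp_closed_sets[OF this] show ?thesis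
        using emp_Prob_space by (simp add: A_def dist_real_def not_less abs_minus_commute[of "\<integral>z. f z \<partial>\<nu>"])
    qed
    have "1 - ?q n = prob {x \<in> space ?M. emp x \<notin> G}"
    proof -
      have "{x \<in> space ?M. emp x \<notin> G} = space ?M - {x \<in> space ?M. empirical n x \<in> G}" by (auto simp: e)
      then show ?thesis using prob_compl[OF emp_open_sets[OF G(1)]] by (simp add: e)
    qed
    also have "\<dots> \<le> prob (\<Union>f\<in>\<Phi>. A f)"
    proof (rule finite_measure_mono)
      show "{x \<in> space ?M. emp x \<notin> G} \<subseteq> (\<Union>f\<in>\<Phi>. A f)"
      proof
        fix x assume x: "x \<in> {x \<in> space ?M. emp x \<notin> G}"
        then have "\<not> (\<forall>f\<in>\<Phi>. \<bar>(\<integral>z. f z \<partial>emp x) - (\<integral>z. f z \<partial>\<nu>)\<bar> < r)"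
          using \<Phi>(4) emp_Prob_space by blast
        then show "x \<in> (\<Union>f\<in>\<Phi>. A f)" using x by (auto simp: A_def not_less)
      qed
      show "(\<Union>f\<in>\<Phi>. A f) \<in> events" using As \<Phi>(1) by blast
    qed
    also have "\<dots> \<le> (\<Sum>f\<in>\<Phi>. prob (A f))"
      using As \<Phi>(1) by (intro finite_measure_subadditive_finite) auto
    also have "\<dots> \<le> (\<Sum>f\<in>\<Phi>. 2 * exp (- real n * (r\<^sup>2 / (2 * (B f)\<^sup>2))))"
      unfolding A_def using \<Phi>(2,3) B by (intro sum_mono hoeffding) auto
    finally show ?thesis by simp
  qed
  have lim: "(\<lambda>n. 1 - (\<Sum>f\<in>\<Phi>. 2 * exp (- real n * (r\<^sup>2 / (2 * (B f)\<^sup>2))))) \<longlonglongrightarrow> 1 - (\<Sum>f\<in>\<Phi>. 2 * 0)"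
  proof (intro tendsto_diff tendsto_const tendsto_sum tendsto_mult)
    fix f assume "f \<in> \<Phi>"
    define d where "d = r\<^sup>2 / (2 * (B f)\<^sup>2)"
    have d: "d > 0" using B(1)[OF \<open>f \<in> \<Phi>\<close>] \<Phi>(3) by (simp add: d_def)
    have "(\<lambda>n. exp (- d) ^ n) \<longlonglongrightarrow> 0" using d by (intro LIMSEQ_realpow_zero) auto
    then show "(\<lambda>n. exp (- real n * (r\<^sup>2 / (2 * (B f)\<^sup>2)))) \<longlonglongrightarrow> 0"
      by (simp add: d_def[symmetric] exp_of_nat_mult[symmetric])
  qed
  show ?thesis
  proof (rule tendsto_sandwich)
    show "(\<lambda>n. 1 - (\<Sum>f\<in>\<Phi>. 2 * exp (- real n * (r\<^sup>2 / (2 * (B f)\<^sup>2))))) \<longlonglongrightarrow> 1"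
      using lim by simp
    show "eventually (\<lambda>n. 1 - (\<Sum>f\<in>\<Phi>. 2 * exp (- real n * (r\<^sup>2 / (2 * (B f)\<^sup>2)))) \<le> ?q n) sequentially"
      using eventually_ge_at_top[of 1] by eventually_elim (rule ge)
    show "eventually (\<lambda>n. ?q n \<le> 1) sequentially"
      by (intro always_eventually allI prob_space.prob_le_1 prob_space_PiM Prob_spaceD(1)[OF \<nu>])
  qed simp
qed

text \<open>Under the product of \<open>\<nu>\<close> the event has probability \<open>q n\<close>
  near 1, and \<open>change_of_measure_lower\<close> with entropy \<open>n * h\<close> brings it
  back to \<open>\<mu>\<close>. Since \<open>q\<close> depends on \<open>\<nu>\<close> and
  \<open>G\<close> only, it can be obtained before the sample.\<close>

lemma sanov_lower:
  fixes \<mu> \<nu> :: "'w::{second_countable_topology, metric_space} measure"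
  assumes P: "\<mu> \<in> Prob_space" "\<nu> \<in> Prob_space" and H: "rel_entropy \<nu> \<mu> = ereal h"
    and G: "openin weak_top G" "\<nu> \<in> G"
  obtains q where "q \<longlonglongrightarrow> 1"
    "\<And>(M :: 'o measure) W n. iid_sample M W n \<mu> \<Longrightarrow> q n > 0 \<Longrightarrow>
      measure M {\<omega> \<in> space M. empirical n (\<lambda>i. W i \<omega>) \<in> G} \<ge> q n * exp (- (real n * h + 1) / q n)"
proof -
  define Q where "Q n = PiM {..<n} (\<lambda>_. \<nu>)" for n :: nat
  define q where "q n = measure (Q n) {x \<in> space (Q n). empirical n x \<in> G}" for n
  show thesis
  proof (rule that)
    show "q \<longlonglongrightarrow> 1" unfolding q_def Q_def using empirical_LLN[OF P(2) G] by simp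
    fix M :: "'o measure" and W n
    assume "iid_sample M W n \<mu>" and qn: "q n > 0"
    then interpret S: iid_sample M W n \<mu> by simp
    interpret P: iid_sample "PiM {..<n} (\<lambda>_. \<mu>)" "\<lambda>i x. x i" n \<mu> by (rule iid_sample_PiM[OF P(1) S.n])
    interpret Q: iid_sample "Q n" "\<lambda>i x. x i" n \<nu> unfolding Q_def by (rule iid_sample_PiM[OF P(2) S.n])
    have "rel_entropy \<nu> \<mu> < \<infinity>" using H by simp
    then obtain D where D: "D \<in> borel_measurable borel" "\<And>z. 0 \<le> D z" "\<nu> = density \<mu> (\<lambda>z. ennreal (D z))"
      "integrable \<mu> (\<lambda>z. D z * ln (D z))" "rel_entropy \<nu> \<mu> = ereal (\<integral>z. D z * ln (D z) \<partial>\<mu>)"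
      by (rule rel_entropy_finite[OF P]) (rule that)
    have Dm: "D \<in> borel_measurable \<mu>" using D(1) by (simp add: Prob_space_measurable[OF P(1)])
    have lDm: "(\<lambda>z. ln (D z)) \<in> borel_measurable borel" using D(1) by measurable
    have lDmu: "(\<lambda>z. ln (D z)) \<in> borel_measurable \<mu>" using Dm by measurable
    have hh: "(\<integral>z. D z * ln (D z) \<partial>\<mu>) = h" using H unfolding D(5) by simp
    have "integrable (density \<mu> (\<lambda>z. ennreal (D z))) (\<lambda>z. ln (D z))"
      using D(4) by (subst integrable_density[OF lDmu Dm]) (auto simp: D(2))
    then have hD1: "integrable \<nu> (\<lambda>z. ln (D z))" unfolding D(3)[symmetric] .
    have "(\<integral>z. ln (D z) \<partial>density \<mu> (\<lambda>z. ennreal (D z))) = h"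
      using hh by (subst integral_density[OF lDmu Dm]) (auto simp: D(2))
    then have hD2: "(\<integral>z. ln (D z) \<partial>\<nu>) = h" unfolding D(3)[symmetric] .
    let ?P = "PiM {..<n} (\<lambda>_. \<mu>)"
    define L where "L x = (\<Prod>i<n. D (x i))" for x
    define g where "g x = (\<Sum>i<n. ln (D (x i)))" for x
    have Qd: "Q n = density ?P (\<lambda>x. ennreal (L x))"
      unfolding Q_def L_def
      by (subst D(3), rule PiM_density[OF _ Dm D(2)]) (use P D(3) Prob_spaceD(1) in auto)
    have gint: "integrable (Q n) (\<lambda>x. ln (D (x i)))" "(\<integral>x. ln (D (x i)) \<partial>Q n) = h" if "i < n" for i
      using integrable_distr_eq[OF Q.W_measurable[OF that] lDm] hD1 hD2 Q.distr_law[OF that lDm]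
      unfolding Q.law[OF that] by (blast, metis)
    let ?A = "{x \<in> space ?P. empirical n x \<in> G}"
    have "measure ?P ?A \<ge> measure (Q n) ?A * exp (- (real n * h + 1) / measure (Q n) ?A)"
    proof (rule change_of_measure_lower[OF P.prob_space_axioms Q.prob_space_axioms Qd])
      show "L \<in> borel_measurable ?P" unfolding L_def using Dm by measurable
      show "g \<in> borel_measurable ?P" unfolding g_def using lDmu by measurable
      show L0: "0 \<le> L x" for x unfolding L_def by (intro prod_nonneg) (simp add: D(2))
      show "exp (- g x) * L x \<le> 1" for x
      \<comment> \<open>If some factor vanishes the bound is trivial; otherwise \<open>g\<close> is
        exactly \<open>ln L\<close>.\<close>
      proof (cases "L x = 0")
        case False
        then have "D (x i) > 0" if "i < n" for i
          using that D(2)[of "x i"] by (auto simp: L_def order_less_le)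
        then have "L x = exp (g x)" by (simp add: L_def g_def exp_sum)
        then show ?thesis by (simp add: exp_minus)
      qed simp
      show "integrable (Q n) g" unfolding g_def by (intro Bochner_Integration.integrable_sum gint) auto
      show "(\<integral>x. g x \<partial>Q n) = real n * h"
        unfolding g_def by (subst Bochner_Integration.integral_sum) (use gint in auto)
      show "?A \<in> sets ?P" using P.emp_open_sets[OF G(1)] by (simp add: P.emp_def)
      show "0 < measure (Q n) ?A" using qn by (simp add: q_def Qd)
    qed
    moreover have "measure (Q n) ?A = q n" by (simp add: q_def Qd)
    moreover have "measure ?P ?A = measure M {\<omega> \<in> space M. empirical n (\<lambda>i. W i \<omega>) \<in> G}"
    proof -
      let ?T = "\<lambda>\<omega>. \<lambda>i\<in>{..<n}. W i \<omega>"
      have T: "?T \<in> M \<rightarrow>\<^sub>M ?P"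
      proof (rule measurable_restrict)
        show "W i \<in> M \<rightarrow>\<^sub>M \<mu>" if "i \<in> {..<n}" for i
          using S.W_measurable that by (simp add: measurable_cong_sets[OF refl Prob_spaceD(2)[OF P(1)], of M])
      qed
      have "measure ?P ?A = measure (distr M ?P ?T) ?A" by (simp add: S.distr_sample)
      also have "\<dots> = measure M (?T -` ?A \<inter> space M)"
        using P.emp_open_sets[OF G(1)] by (intro measure_distr[OF T]) (simp add: P.emp_def)
      also have "?T -` ?A \<inter> space M = {\<omega> \<in> space M. empirical n (\<lambda>i. W i \<omega>) \<in> G}"
      proof -
        have "empirical n (?T \<omega>) = empirical n (\<lambda>i. W i \<omega>)" for \<omega> by (rule empirical_cong[OF S.n]) simp
        then show ?thesis using measurable_space[OF T] by auto
      qed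
      finally show ?thesis .
    qed
    ultimately show "measure M {\<omega> \<in> space M. empirical n (\<lambda>i. W i \<omega>) \<in> G} \<ge> q n * exp (- (real n * h + 1) / q n)"
      by simp
  qed
qed

section \<open>Mean field equilibria\<close>

text \<open>The tube lemma, used to show that a condition required for all actions is open in the
  types.\<close>

lemma closed_fst_image:
  fixes S :: "('a::topological_space \<times> 'b::topological_space) set"
  assumes "compact (UNIV :: 'b set)" "closed S"
  shows "closed (fst ` S)"
proof -
  have "compact_space (euclidean :: 'b topology)" using assms(1) by (simp add: compact_space_def)
  from Abstract_Topological_Spaces.closed_map_fst[OF this, of "euclidean :: 'a topology"]
  show ?thesis using assms(2) by (simp add: closed_map_def)
qed

lemma compact_UNIV_fun: "compact (UNIV :: 'b::topological_space set) \<Longrightarrow> compact (UNIV :: ('i \<Rightarrow> 'b) set)"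
  using compactin_PiE[of "\<lambda>_. euclidean :: 'b topology" UNIV "\<lambda>_ :: 'i. UNIV"]
  by (simp add: euclidean_product_topology)

text \<open>Second countability of the action space follows from compactness and is not part of its
  type class; balls of radius \<open>1 / Suc n\<close> around finite nets form the base.\<close>

lemma compact_metric_countable_base:
  assumes "compact (UNIV :: 'x::metric_space set)"
  shows "\<exists>\<B> :: 'x set set. countable \<B> \<and> (\<forall>U x. open U \<longrightarrow> x \<in> U \<longrightarrow> (\<exists>b\<in>\<B>. x \<in> b \<and> b \<subseteq> U))"
proof -
  have "\<exists>T. finite T \<and> (UNIV :: 'x set) \<subseteq> (\<Union>x\<in>T. ball x (1 / real (Suc n)))" for n
  proof -
    obtain T where "T \<subseteq> UNIV" "finite T" "(UNIV :: 'x set) \<subseteq> (\<Union>x\<in>T. ball x (1 / real (Suc n)))"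
      by (rule compactE_image[OF assms, of UNIV "\<lambda>x. ball x (1 / real (Suc n))"]) auto
    then show ?thesis by blast
  qed
  then obtain T where T: "\<And>n. finite (T n)" "\<And>n. (UNIV :: 'x set) \<subseteq> (\<Union>x\<in>T n. ball x (1 / real (Suc n)))"
    by metis
  define \<B> where "\<B> = (\<Union>n. (\<lambda>x. ball x (1 / real (Suc n))) ` T n)"
  have "countable \<B>" unfolding \<B>_def by (rule countable_UN) (auto intro: countable_finite T(1))
  moreover have "\<exists>b\<in>\<B>. x \<in> b \<and> b \<subseteq> U" if U: "open U" "x \<in> U" for U x
  proof -
    obtain e where e: "e > 0" "ball x e \<subseteq> U" using openE[OF U] by blast
    obtain n where n: "inverse (real (Suc n)) < e / 2" using reals_Archimedean[of "e / 2"] e(1) by auto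
    obtain z where z: "z \<in> T n" "x \<in> ball z (1 / real (Suc n))" using T(2) by blast
    have "ball z (1 / real (Suc n)) \<subseteq> ball x e"
    proof
      fix y assume "y \<in> ball z (1 / real (Suc n))"
      then show "y \<in> ball x e"
        using z(2) n dist_triangle[of x y z] by (simp add: dist_commute inverse_eq_divide)
    qed
    then show ?thesis using z e(2) by (intro bexI[of _ "ball z (1 / real (Suc n))"]) (auto simp: \<B>_def)
  qed
  ultimately show ?thesis by blast
qed

lemma weak_top_open_mass:
  fixes l :: "'a::metric_space measure"
  assumes "l \<in> Prob_space" "open S" "measure l S > c"
  shows "\<exists>V. openin weak_top V \<and> l \<in> V \<and> (\<forall>\<nu>\<in>V. measure \<nu> S > c)"
proof -
  have "\<exists>V. openin weak_top V \<and> l \<in> V \<and> (\<forall>\<nu>\<in>V. \<nu> \<in> {\<nu>. measure \<nu> S > c})"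
    using open_mass_positive[OF limitin_nhdsin assms(2,3)] assms(1) by (auto simp: eventually_nhdsin)
  then show ?thesis by simp
qed

lemma continuous_map_distr:
  fixes g :: "'a::topological_space \<Rightarrow> 'b::topological_space"
  assumes g: "continuous_on UNIV g"
  shows "continuous_map weak_top weak_top (\<lambda>m. distr m borel g)"
proof (rule continuous_map_into_weak_top)
  fix m :: "'a measure" assume "m \<in> topspace weak_top"
  then show "distr m borel g \<in> Prob_space" using distr_Prob_space[OF _ g] by simp
next
  fix f :: "'b \<Rightarrow> real" assume f: "f \<in> Cb"
  have "continuous_map weak_top euclideanreal (\<lambda>m. \<integral>z. f (g z) \<partial>m)"
    by (rule continuous_map_integral[OF Cb_compose[OF f g]])
  then show "continuous_map weak_top euclideanreal (\<lambda>m. \<integral>z. f z \<partial>distr m borel g)"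
    by (rule continuous_map_eq) (use integral_distr_continuous[OF _ g f] in auto)
qed

lemma limitin_distr:
  fixes g :: "'a::topological_space \<Rightarrow> 'b::topological_space"
  assumes g: "continuous_on UNIV g" and l: "limitin weak_top (\<lambda>x. x) l G"
  shows "limitin weak_top (\<lambda>m. distr m borel g) (distr l borel g) G"
  unfolding limitin_def
proof (intro conjI allI impI)
  have lP: "l \<in> Prob_space" using l by (simp add: limitin_weak_top_iff)
  then show "distr l borel g \<in> topspace weak_top" using distr_Prob_space[OF _ g] by simp
  fix U :: "'b measure set" assume U: "openin weak_top U \<and> distr l borel g \<in> U"
  then have "openin weak_top {m \<in> topspace weak_top. distr m borel g \<in> U}"
    using continuous_map_distr[OF g] unfolding continuous_map_def by blast
  from limitinD[OF l this] have "eventually (\<lambda>m. m \<in> {m \<in> topspace weak_top. distr m borel g \<in> U}) G"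
    using U lP by simp
  then show "eventually (\<lambda>m. distr m borel g \<in> U) G" by (rule eventually_mono) simp
qed

text \<open>A total variation bound tested on \<open>Cb\<close>. Being uniform in the test function,
  it puts \<open>m'\<close> into any prescribed weak neighbourhood of a limit once \<delta> is small
  and \<open>m\<close> is close.\<close>

definition near_measure :: "real \<Rightarrow> 'a::topological_space measure \<Rightarrow> 'a measure \<Rightarrow> bool" where
  "near_measure \<delta> m m' \<longleftrightarrow> m' \<in> Prob_space \<and>
     (\<forall>f\<in>Cb. \<forall>B. (\<forall>x. \<bar>f x\<bar> \<le> B) \<longrightarrow> \<bar>(\<integral>x. f x \<partial>m') - (\<integral>x. f x \<partial>m)\<bar> \<le> \<delta> * B)"

lemma near_measure_mono:
  assumes "near_measure \<delta> m m'" "\<delta> \<le> \<delta>'"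
  shows "near_measure \<delta>' m m'"
  unfolding near_measure_def
proof (intro conjI ballI allI impI)
  show "m' \<in> Prob_space" using assms(1) by (simp add: near_measure_def)
  fix f :: "'a \<Rightarrow> real" and B assume f: "f \<in> Cb" and B: "\<forall>x. \<bar>f x\<bar> \<le> B"
  have "\<bar>(\<integral>x. f x \<partial>m') - (\<integral>x. f x \<partial>m)\<bar> \<le> \<delta> * B"
    using assms(1) f B by (simp add: near_measure_def)
  also have "\<dots> \<le> \<delta>' * B"
    using assms(2) order_trans[OF abs_ge_zero B[rule_format, of undefined]] by (rule mult_right_mono)
  finally show "\<bar>(\<integral>x. f x \<partial>m') - (\<integral>x. f x \<partial>m)\<bar> \<le> \<delta>' * B" .
qed

lemma near_measure_refl: "m \<in> Prob_space \<Longrightarrow> 0 \<le> \<delta> \<Longrightarrow> near_measure \<delta> m m"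
  unfolding near_measure_def using order_trans[OF abs_ge_zero] by (auto intro!: mult_nonneg_nonneg)

locale mean_field_game =
  fixes F :: "('w::polish_space \<times> 'x::metric_space) measure \<Rightarrow> 'w \<Rightarrow> 'x \<Rightarrow> real"
    and C :: "'w \<Rightarrow> 'x set"
  assumes X_compact: "compact (UNIV :: 'x set)"
    and C_nonempty: "C w \<noteq> {}"
    and C_graph_closed: "closed {(w, x). x \<in> C w}"
    and C_lower: "ws \<longlonglongrightarrow> w \<Longrightarrow> x \<in> C w \<Longrightarrow>
          \<exists>r xs. strict_mono r \<and> (\<forall>k. xs k \<in> C (ws (r k))) \<and> xs \<longlonglongrightarrow> x"
    and F_bounded: "\<exists>B. \<forall>m\<in>Prob_space. \<forall>w x. \<bar>F m w x\<bar> \<le> B"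
    and F_cont: "continuous_map (prod_topology weak_top (prod_topology euclidean euclidean))
                   euclideanreal (\<lambda>(m, w, x). F m w x)"
begin

text \<open>Both kinds of equilibria satisfy this condition: for mean field equilibria take \<open>m' = m\<close>, and in
  the game with \<open>n\<close> players a deviation moves the empirical measure by \<open>2/n\<close> in total variation.\<close>

definition near_MFE :: "real \<Rightarrow> ('w \<times> 'x) measure \<Rightarrow> bool" where
  "near_MFE \<delta> m \<longleftrightarrow> (AE z in m. snd z \<in> C (fst z) \<and>
    (\<forall>y\<in>C (fst z). \<exists>m'. near_measure \<delta> m m' \<and> F m (fst z) (snd z) \<le> F m' (fst z) y + \<delta>))"

lemma near_MFE_mono:
  assumes "near_MFE \<delta> m" "\<delta> \<le> \<delta>'"
  shows "near_MFE \<delta>' m"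
  using assms(1) unfolding near_MFE_def
proof (rule eventually_mono)
  fix z
  assume z: "snd z \<in> C (fst z) \<and>
    (\<forall>y\<in>C (fst z). \<exists>m'. near_measure \<delta> m m' \<and> F m (fst z) (snd z) \<le> F m' (fst z) y + \<delta>)"
  have "\<exists>m'. near_measure \<delta>' m m' \<and> F m (fst z) (snd z) \<le> F m' (fst z) y + \<delta>'" if "y \<in> C (fst z)" for y
  proof -
    from z that obtain m' where "near_measure \<delta> m m'" "F m (fst z) (snd z) \<le> F m' (fst z) y + \<delta>" by blast
    with near_measure_mono[OF this(1) assms(2)] assms(2) show ?thesis by (intro exI[of _ m']) simp
  qed
  with z show "snd z \<in> C (fst z) \<and>
    (\<forall>y\<in>C (fst z). \<exists>m'. near_measure \<delta>' m m' \<and> F m (fst z) (snd z) \<le> F m' (fst z) y + \<delta>')" by blast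
qed

text \<open>Lower hemicontinuity in terms of open sets. The subsequence in \<open>C_lower\<close> is
  enough, because in the contradiction every member of the sequence misses \<open>U\<close>.\<close>

lemma C_lower_open:
  assumes "y \<in> C w" "open U" "y \<in> U"
  shows "\<exists>V. open V \<and> w \<in> V \<and> (\<forall>w'\<in>V. C w' \<inter> U \<noteq> {})"
proof (rule ccontr)
  assume neg: "\<not> ?thesis"
  have "\<exists>w'. dist w' w < inverse (real (Suc n)) \<and> C w' \<inter> U = {}" for n
  proof -
    have "\<exists>w'\<in>ball w (inverse (real (Suc n))). C w' \<inter> U = {}"
      using neg[unfolded not_ex, rule_format, of "ball w (inverse (real (Suc n)))"] by auto
    then show ?thesis by (auto simp: dist_commute)
  qed
  then obtain ws where ws: "\<And>n. dist (ws n) w < inverse (real (Suc n))" "\<And>n. C (ws n) \<inter> U = {}" by metis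
  have "ws \<longlonglongrightarrow> w"
    using tendsto_dist_iff[of ws w sequentially] ws(1)
      Lim_null_comparison[OF _ LIMSEQ_inverse_real_of_nat, of "\<lambda>n. dist (ws n) w"]
    by (simp add: less_imp_le)
  from C_lower[OF this assms(1)] obtain r xs where xs: "\<forall>k. xs k \<in> C (ws (r k))" "xs \<longlonglongrightarrow> y" by blast
  have "eventually (\<lambda>k. xs k \<in> U) sequentially" using topological_tendstoD[OF xs(2) assms(2,3)] .
  then obtain k where "xs k \<in> U" by (auto simp: eventually_sequentially)
  with xs(1) ws(2) show False by blast
qed

lemma F_nbhd:
  assumes "m \<in> Prob_space" "open S" "F m w x \<in> S"
  shows "\<exists>V U O'. openin weak_top V \<and> open U \<and> open O' \<and> m \<in> V \<and> w \<in> U \<and> x \<in> O' \<and>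
    (\<forall>m'\<in>V. \<forall>w'\<in>U. \<forall>x'\<in>O'. F m' w' x' \<in> S)"
proof -
  let ?T = "prod_topology weak_top (prod_topology euclidean euclidean) :: (('w \<times> 'x) measure \<times> 'w \<times> 'x) topology"
  let ?S = "{p \<in> topspace ?T. (case p of (m, w, x) \<Rightarrow> F m w x) \<in> S}"
  have op: "openin ?T ?S"
    by (rule openin_continuous_map_preimage[OF F_cont]) (use assms(2) in simp)
  have mem: "(m, w, x) \<in> ?S" using assms(1,3) by simp
  obtain V Q where VQ: "openin weak_top V" "openin (prod_topology euclidean euclidean) Q"
    "m \<in> V" "(w, x) \<in> Q" "V \<times> Q \<subseteq> ?S"
    using op[unfolded openin_prod_topology_alt[of weak_top], rule_format, OF mem] by (elim exE conjE) (rule that)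
  obtain U O' where UO: "openin euclidean U" "openin euclidean O'" "w \<in> U" "x \<in> O'" "U \<times> O' \<subseteq> Q"
    using VQ(2)[unfolded openin_prod_topology_alt, rule_format, OF VQ(4)] by (elim exE conjE) (rule that)
  have "F m' w' x' \<in> S" if "m' \<in> V" "w' \<in> U" "x' \<in> O'" for m' w' x'
  proof -
    have "(m', w', x') \<in> V \<times> Q" using that UO(5) by blast
    then have "(m', w', x') \<in> ?S" using VQ(5) by (rule subsetD[rotated])
    then show ?thesis by simp
  qed
  with VQ(1,3) UO(1-4) show ?thesis unfolding open_openin[symmetric] by blast
qed

text \<open>If the limit admitted a profitable deviation at a point of its support, the same deviation
  would be profitable, by a fixed margin, on a neighbourhood of positive mass for all nearby
  measures.\<close>

lemma limit_equilibrium: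
  assumes G: "G \<noteq> bot" and l: "limitin weak_top (\<lambda>x. x) l G"
    and near: "\<And>\<delta>. \<delta> > 0 \<Longrightarrow> eventually (near_MFE \<delta>) G"
  shows "AE z in l. snd z \<in> C (fst z) \<and> (\<forall>y\<in>C (fst z). F l (fst z) (snd z) \<le> F l (fst z) y)"
proof -
  have lP: "l \<in> Prob_space" using l by (simp add: limitin_weak_top_iff)
  interpret prob_space l using Prob_spaceD[OF lP] by simp
  have sl: "sets l = sets borel" using Prob_spaceD[OF lP] by simp
  have GP: "eventually (\<lambda>m. m \<in> Prob_space) G" using l by (simp add: limitin_weak_top_iff)
  define Gr where "Gr = {z :: 'w \<times> 'x. snd z \<in> C (fst z)}"
  have Gr: "closed Gr" using C_graph_closed unfolding Gr_def by (simp add: case_prod_unfold)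
  have "\<not> measure l (- Gr) > 0"
  proof
    assume "measure l (- Gr) > 0"
    then have "eventually (\<lambda>m. measure m (- Gr) > 0) G"
      using open_mass_positive[OF l] Gr by (simp add: open_Compl)
    with near[OF zero_less_one] GP have "eventually (\<lambda>m. False) G"
    proof eventually_elim
      case (elim m)
      have "AE z in m. z \<in> Gr" using elim(1) unfolding near_MFE_def by (rule eventually_mono) (simp add: Gr_def)
      then have "AE z in m. z \<notin> - Gr" by simp
      moreover have "- Gr \<in> sets m" using Gr Prob_spaceD[OF elim(2)] by (simp add: borel_open open_Compl)
      moreover have "{z \<in> space m. \<not> z \<notin> - Gr} = - Gr" using Prob_spaceD(3)[OF elim(2)] by auto
      ultimately have "measure m (- Gr) = 0"
        using AE_iff_measurable[of "- Gr" m "\<lambda>z. z \<notin> - Gr"] by (simp add: measure_def)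
      with elim(3) show False by simp
    qed
    with G show False by simp
  qed
  then have "emeasure l (- Gr) = 0" by (simp add: emeasure_eq_measure measure_nonneg not_less order_antisym)
  then have "- Gr \<in> null_sets l" using Gr sl by (simp add: null_sets_def borel_open open_Compl)
  from AE_not_in[OF this] have AE_Gr: "AE z in l. z \<in> Gr" by simp
  define D where "D = {z \<in> Gr. \<exists>y\<in>C (fst z). F l (fst z) y < F l (fst z) (snd z)}"
  have D: "\<exists>U O'. open U \<and> open O' \<and> w \<in> U \<and> x \<in> O' \<and> measure l (U \<times> O') = 0" if wx: "(w, x) \<in> D" for w x
  proof -
    obtain y where y: "y \<in> C w" "F l w y < F l w x" using wx by (auto simp: D_def)
    \<comment> \<open>The gain from deviating is \<open>4 * \<delta>\<close> and \<open>c\<close> is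
      the midpoint. The neighbourhoods keep both values more than \<delta> away from
      \<open>c\<close>, so their gap exceeds \<open>2 * \<delta>\<close>, beyond a tolerance of at
      most \<delta>.\<close>
    define \<delta> where "\<delta> = (F l w x - F l w y) / 4"
    define c where "c = (F l w x + F l w y) / 2"
    have \<delta>: "\<delta> > 0" using y(2) by (simp add: \<delta>_def)
    have c: "F l w x \<in> {c + \<delta><..}" "F l w y \<in> {..<c - \<delta>}" using y(2) by (auto simp: c_def \<delta>_def field_simps)
    obtain V1 U1 O1 where 1: "openin weak_top V1" "open U1" "open O1" "l \<in> V1" "w \<in> U1" "x \<in> O1"
      "\<forall>m'\<in>V1. \<forall>w'\<in>U1. \<forall>x'\<in>O1. F m' w' x' \<in> {c + \<delta><..}"
      using F_nbhd[OF lP open_greaterThan c(1)] by blast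
    obtain V2 U2 O2 where 2: "openin weak_top V2" "open U2" "open O2" "l \<in> V2" "w \<in> U2" "y \<in> O2"
      "\<forall>m'\<in>V2. \<forall>w'\<in>U2. \<forall>x'\<in>O2. F m' w' x' \<in> {..<c - \<delta>}"
      using F_nbhd[OF lP open_lessThan c(2)] by blast
    obtain U3 where 3: "open U3" "w \<in> U3" "\<forall>w'\<in>U3. C w' \<inter> O2 \<noteq> {}"
      using C_lower_open[OF y(1) 2(3,6)] by blast
    define U where "U = U1 \<inter> U2 \<inter> U3"
    have UO: "open U" "w \<in> U" "open (U \<times> O1)" using 1 2 3 by (auto simp: U_def intro: open_Times)
    have "\<not> measure l (U \<times> O1) > 0"
    proof
      assume "measure l (U \<times> O1) > 0"
      then have pos: "eventually (\<lambda>m. measure m (U \<times> O1) > 0) G" by (rule open_mass_positive[OF l UO(3)])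
      obtain \<Phi> r where \<Phi>: "finite \<Phi>" "\<Phi> \<subseteq> Cb" "r > 0"
        "\<forall>m\<in>Prob_space. (\<forall>f\<in>\<Phi>. \<bar>(\<integral>z. f z \<partial>m) - (\<integral>z. f z \<partial>l)\<bar> < r) \<longrightarrow> m \<in> V2"
        using weak_top_nbhd[OF 2(1,4)] by blast
      have "\<forall>f\<in>\<Phi>. \<exists>B\<ge>0. \<forall>x. \<bar>f x\<bar> \<le> B" using Cb_bound \<Phi>(2) by blast
      from bchoice[OF this] obtain B where B: "\<forall>f\<in>\<Phi>. B f \<ge> 0 \<and> (\<forall>x. \<bar>f x\<bar> \<le> B f)" by blast
      define S where "S = 1 + (\<Sum>f\<in>\<Phi>. B f)"
      have S: "S > 0" "\<And>f. f \<in> \<Phi> \<Longrightarrow> B f \<le> S"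
      proof -
        have "0 \<le> (\<Sum>f\<in>\<Phi>. B f)" using B by (intro sum_nonneg) blast
        then show "S > 0" by (simp add: S_def)
        show "B f \<le> S" if "f \<in> \<Phi>" for f
          using member_le_sum[OF that, of B] B \<Phi>(1) by (auto simp: S_def intro: add_increasing)
      qed
      \<comment> \<open>With total variation error \<open>\<eta>\<close> the integrals under
        \<open>m'\<close> and \<open>m\<close> differ by at most \<open>r / 2\<close> for every
        \<open>f\<close> in \<open>\<Phi>\<close>; the other half is left for \<open>m\<close>
        against \<open>l\<close>.\<close>
      define \<eta> where "\<eta> = min \<delta> (r / (2 * S))"
      have \<eta>: "\<eta> > 0" using \<delta> \<Phi>(3) S(1) by (simp add: \<eta>_def)
      have close: "eventually (\<lambda>m. \<forall>f\<in>\<Phi>. \<bar>(\<integral>z. f z \<partial>m) - (\<integral>z. f z \<partial>l)\<bar> < r / 2) G"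
      proof (rule eventually_ball_finite[OF \<Phi>(1)], rule ballI)
        fix f assume "f \<in> \<Phi>"
        then have "((\<lambda>m. \<integral>z. f z \<partial>m) \<longlongrightarrow> (\<integral>z. f z \<partial>l)) G" using l \<Phi>(2) by (auto simp: limitin_weak_top_iff)
        from tendstoD[OF this, of "r / 2"] show "eventually (\<lambda>m. \<bar>(\<integral>z. f z \<partial>m) - (\<integral>z. f z \<partial>l)\<bar> < r / 2) G"
          using \<Phi>(3) by (simp add: dist_real_def)
      qed
      have "eventually (\<lambda>m. m \<in> V1) G" by (rule limitinD[OF l 1(1,4)])
      with pos close near[OF \<eta>] GP have "eventually (\<lambda>m. False) G"
      proof (eventually_elim)
        case (elim m)
        have sm: "U \<times> O1 \<in> sets m" "space m = UNIV" using UO(3) Prob_spaceD[OF elim(4)] by (auto intro: borel_open)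
        \<comment> \<open>An almost sure property cannot fail throughout a box of positive
          mass.\<close>
        have "\<exists>z\<in>U \<times> O1. snd z \<in> C (fst z) \<and>
          (\<forall>y\<in>C (fst z). \<exists>m'. near_measure \<eta> m m' \<and> F m (fst z) (snd z) \<le> F m' (fst z) y + \<eta>)"
        proof (rule ccontr)
          assume "\<not> ?thesis"
          then have "AE z in m. z \<notin> U \<times> O1"
            using elim(3) unfolding near_MFE_def by (elim eventually_mono) blast
          then have "emeasure m (U \<times> O1) = 0"
            using AE_iff_measurable[OF sm(1), of "\<lambda>z. z \<notin> U \<times> O1"] sm(2) by simp
          then show False using elim(1) by (simp add: measure_def)
        qed
        then obtain w' x' where z: "w' \<in> U" "x' \<in> O1"
          "\<forall>y\<in>C w'. \<exists>m'. near_measure \<eta> m m' \<and> F m w' x' \<le> F m' w' y + \<eta>" by (elim bexE SigmaE) simp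
        obtain y' where y': "y' \<in> C w'" "y' \<in> O2" using 3(3) z(1) by (auto simp: U_def)
        from z(3) y'(1) obtain m' where m': "m' \<in> Prob_space"
          "\<forall>f\<in>Cb. \<forall>B. (\<forall>x. \<bar>f x\<bar> \<le> B) \<longrightarrow> \<bar>(\<integral>x. f x \<partial>m') - (\<integral>x. f x \<partial>m)\<bar> \<le> \<eta> * B"
          "F m w' x' \<le> F m' w' y' + \<eta>" unfolding near_measure_def by blast
        have "\<bar>(\<integral>z. f z \<partial>m') - (\<integral>z. f z \<partial>l)\<bar> < r" if f: "f \<in> \<Phi>" for f
        proof -
          have "\<bar>(\<integral>x. f x \<partial>m') - (\<integral>x. f x \<partial>m)\<bar> \<le> \<eta> * B f" using m'(2) f \<Phi>(2) B by blast
          also have "\<dots> \<le> (r / (2 * S)) * S"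
            using S B f \<eta> \<Phi>(3) by (intro mult_mono) (auto simp: \<eta>_def)
          also have "\<dots> = r / 2" using S(1) by simp
          finally show ?thesis using elim(2)[rule_format, OF f] by linarith
        qed
        then have "m' \<in> V2" using \<Phi>(4) m'(1) by blast
        then have "F m' w' y' < c - \<delta>" using 2(7) z(1) y'(2) by (auto simp: U_def)
        moreover have "F m w' x' > c + \<delta>" using 1(7) elim(5) z(1,2) by (auto simp: U_def)
        moreover have "\<eta> \<le> \<delta>" by (simp add: \<eta>_def)
        ultimately show False using m'(3) \<delta> by linarith
      qed
      with G show False by simp
    qed
    then have "measure l (U \<times> O1) = 0" by (simp add: measure_nonneg not_less order_antisym)
    with UO 1 show ?thesis by blast
  qed
  obtain \<B>2 :: "'x set set" where B2: "countable \<B>2" "\<And>U x. open U \<Longrightarrow> x \<in> U \<Longrightarrow> \<exists>b\<in>\<B>2. x \<in> b \<and> b \<subseteq> U"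
    using compact_metric_countable_base[OF X_compact] by blast
  obtain \<B>1 :: "'w set set" where B1: "countable \<B>1" "topological_basis \<B>1"
    using ex_countable_basis by blast
  \<comment> \<open>The set \<open>D\<close> is not known to be measurable. Boxes from the two
    countable bases cover it, and each is enclosed in a null set, so \<open>D\<close> lies in a
    countable union of null sets.\<close>
  define \<N> where "\<N> = {(b1, b2). b1 \<in> \<B>1 \<and> b2 \<in> \<B>2 \<and> (\<exists>N\<in>null_sets l. b1 \<times> b2 \<subseteq> N)}"
  have "\<forall>p\<in>\<N>. \<exists>N. N \<in> null_sets l \<and> fst p \<times> snd p \<subseteq> N" by (auto simp: \<N>_def)
  from bchoice[OF this] obtain N where N: "\<forall>p\<in>\<N>. N p \<in> null_sets l \<and> fst p \<times> snd p \<subseteq> N p" by blast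
  have "countable \<N>" by (rule countable_subset[of _ "\<B>1 \<times> \<B>2"]) (use B1 B2 in \<open>auto simp: \<N>_def\<close>)
  then have null: "(\<Union>p\<in>\<N>. N p) \<in> null_sets l" using N by (intro null_sets_UN') auto
  have "D \<subseteq> (\<Union>p\<in>\<N>. N p)"
  proof
    fix z assume "z \<in> D"
    then obtain w x where wx: "z = (w, x)" "(w, x) \<in> D" by (cases z) auto
    obtain U O' where UO: "open U" "open O'" "w \<in> U" "x \<in> O'" "measure l (U \<times> O') = 0" using D[OF wx(2)] by blast
    obtain b1 where b1: "b1 \<in> \<B>1" "w \<in> b1" "b1 \<subseteq> U" using topological_basisE[OF B1(2) UO(1,3)] by blast
    obtain b2 where b2: "b2 \<in> \<B>2" "x \<in> b2" "b2 \<subseteq> O'" using B2(2)[OF UO(2,4)] by blast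
    have "U \<times> O' \<in> null_sets l"
      using UO sl by (simp add: null_sets_def emeasure_eq_measure borel_open open_Times)
    moreover have "b1 \<times> b2 \<subseteq> U \<times> O'" using b1(3) b2(3) by blast
    ultimately have "(b1, b2) \<in> \<N>" using b1(1) b2(1) unfolding \<N>_def by blast
    moreover from this N have "b1 \<times> b2 \<subseteq> N (b1, b2)" by fastforce
    ultimately show "z \<in> (\<Union>p\<in>\<N>. N p)" using b1(2) b2(2) wx(1) by blast
  qed
  then have "AE z in l. z \<notin> D" by (intro eventually_mono[OF AE_not_in[OF null]]) blast
  with AE_Gr show ?thesis
    by eventually_elim (auto simp: D_def Gr_def not_less)
qed

lemma F_bdd_below: "m \<in> Prob_space \<Longrightarrow> bdd_below ((\<lambda>y. F m w y) ` A)"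
  using F_bounded by (auto simp: bdd_below_def abs_le_iff minus_le_iff)

text \<open>The real infimum behaves as intended because \<open>C w\<close> is nonempty and
  \<open>F m\<close> is bounded. The pointwise form is the one that passes to limits.\<close>

lemma MFE_iff:
  "m \<in> MFE F C lam \<longleftrightarrow> m \<in> Prob_space \<and> distr m borel fst = lam \<and>
    (AE z in m. snd z \<in> C (fst z) \<and> (\<forall>y\<in>C (fst z). F m (fst z) (snd z) \<le> F m (fst z) y))"
proof (cases "m \<in> Prob_space")
  case True
  have "F m w x = (INF y\<in>C w. F m w y) \<longleftrightarrow> (\<forall>y\<in>C w. F m w x \<le> F m w y)" if "x \<in> C w" for w x
  proof -
    have "F m w x \<le> (INF y\<in>C w. F m w y) \<longleftrightarrow> (\<forall>y\<in>C w. F m w x \<le> F m w y)"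
      by (rule le_cINF_iff[OF C_nonempty F_bdd_below[OF True]])
    moreover have "(INF y\<in>C w. F m w y) \<le> F m w x"
      by (rule cINF_lower[OF F_bdd_below[OF True] that])
    ultimately show ?thesis by auto
  qed
  then have "(snd z \<in> C (fst z) \<and> F m (fst z) (snd z) = (INF y\<in>C (fst z). F m (fst z) y)) \<longleftrightarrow>
     (snd z \<in> C (fst z) \<and> (\<forall>y\<in>C (fst z). F m (fst z) (snd z) \<le> F m (fst z) y))" for z
    by blast
  then show ?thesis unfolding MFE_def mem_Collect_eq by (simp only:)
qed (simp add: MFE_def)

lemma MFE_near: "m \<in> MFE F C lam \<Longrightarrow> \<delta> > 0 \<Longrightarrow> near_MFE \<delta> m"
proof -
  assume m: "m \<in> MFE F C lam" and \<delta>: "\<delta> > 0"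
  then have mP: "m \<in> Prob_space" by (simp add: MFE_iff)
  have "AE z in m. snd z \<in> C (fst z) \<and> (\<forall>y\<in>C (fst z). F m (fst z) (snd z) \<le> F m (fst z) y)"
    using m by (simp add: MFE_iff)
  then show ?thesis unfolding near_MFE_def
  proof (rule eventually_mono)
    fix z assume z: "snd z \<in> C (fst z) \<and> (\<forall>y\<in>C (fst z). F m (fst z) (snd z) \<le> F m (fst z) y)"
    show "snd z \<in> C (fst z) \<and>
      (\<forall>y\<in>C (fst z). \<exists>m'. near_measure \<delta> m m' \<and> F m (fst z) (snd z) \<le> F m' (fst z) y + \<delta>)"
    proof (intro conjI ballI exI[of _ m])
      show "near_measure \<delta> m m" using near_measure_refl[OF mP] \<delta> by simp
      show "F m (fst z) (snd z) \<le> F m (fst z) y + \<delta>" if "y \<in> C (fst z)" for y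
        using z that \<delta> by fastforce
    qed (use z in blast)
  qed
qed

lemma closedin_MFE: "closedin weak_top (MFE F C lam)"
proof (rule closedin_by_limits)
  show "MFE F C lam \<subseteq> topspace weak_top" by (auto simp: MFE_def)
  fix l G assume G: "G \<noteq> bot" "limitin weak_top (\<lambda>x. x) l G" "eventually (\<lambda>x. x \<in> MFE F C lam) G"
  have lP: "l \<in> Prob_space" using G(2) by (simp add: limitin_weak_top_iff)
  have ev: "eventually (\<lambda>m. distr m borel fst = lam) G" using G(3) by (rule eventually_mono) (simp add: MFE_def)
  \<comment> \<open>An equilibrium taken along the proper filter shows that \<open>lam\<close> is a
    probability measure, which is not assumed.\<close>
  then obtain m where m: "m \<in> MFE F C lam" "distr m borel fst = lam"
    using eventually_happens'[OF G(1) G(3)] by (auto simp: MFE_def)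
  have lamP: "lam \<in> Prob_space"
    using distr_Prob_space[of m fst] m by (auto simp: MFE_def continuous_on_fst)
  have "limitin weak_top (\<lambda>m. distr m borel fst) (distr l borel fst) G"
    by (rule limitin_distr[OF continuous_on_fst[OF continuous_on_id] G(2)])
  moreover have "limitin weak_top (\<lambda>m. distr m borel fst) lam G"
    using lamP by (intro limitin_eventually[OF _ ev]) simp
  ultimately have "distr l borel fst = lam"
    by (rule limitin_Hausdorff_unique[OF _ _ G(1) Hausdorff_weak_top])
  moreover have "AE z in l. snd z \<in> C (fst z) \<and> (\<forall>y\<in>C (fst z). F l (fst z) (snd z) \<le> F l (fst z) y)"
    by (rule limit_equilibrium[OF G(1,2)]) (use G(3) in \<open>auto elim: eventually_mono intro: MFE_near\<close>)
  ultimately show "l \<in> MFE F C lam" using lP by (simp add: MFE_iff)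
qed

end

section \<open>Upper hemicontinuity of equilibria\<close>

lemma empirical_limitin:
  fixes z :: "'k \<Rightarrow> nat \<Rightarrow> 'a::topological_space"
  assumes n: "n \<ge> 1" and lim: "\<And>i. i < n \<Longrightarrow> ((\<lambda>k. z k i) \<longlongrightarrow> l i) G"
  shows "limitin weak_top (\<lambda>k. empirical n (z k)) (empirical n l) G"
  unfolding limitin_weak_top_iff
proof (intro conjI ballI)
  show "empirical n l \<in> Prob_space" by (rule empirical_Prob_space[OF n])
  show "eventually (\<lambda>k. empirical n (z k) \<in> Prob_space) G"
    by (intro always_eventually allI empirical_Prob_space[OF n])
  fix f :: "'a \<Rightarrow> real" assume f: "f \<in> Cb"
  have "((\<lambda>k. f (z k i)) \<longlongrightarrow> f (l i)) G" if "i < n" for i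
    by (rule continuous_on_tendsto_compose[OF Cb_continuous[OF f] lim[OF that]]) auto
  then show "((\<lambda>k. \<integral>x. f x \<partial>empirical n (z k)) \<longlongrightarrow> (\<integral>x. f x \<partial>empirical n l)) G"
    unfolding integral_empirical[OF n Cb_measurable[OF f]]
    by (intro tendsto_divide tendsto_sum tendsto_const) (use n in auto)
qed

lemma filter_of_directed_sets:
  assumes base: "\<And>i j. i \<in> I \<Longrightarrow> j \<in> I \<Longrightarrow> \<exists>k\<in>I. S k \<subseteq> S i \<inter> S j" and ne: "I \<noteq> {}" "\<And>i. i \<in> I \<Longrightarrow> S i \<noteq> {}"
  obtains F where "F \<noteq> bot" "\<And>i. i \<in> I \<Longrightarrow> eventually (\<lambda>x. x \<in> S i) F"
proof
  let ?F = "INF i\<in>I. principal (S i)"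
  have ev: "eventually P ?F \<longleftrightarrow> (\<exists>i\<in>I. \<forall>x\<in>S i. P x)" for P
  proof (subst eventually_INF_base)
    show "\<exists>k\<in>I. principal (S k) \<le> inf (principal (S i)) (principal (S j))" if "i \<in> I" "j \<in> I" for i j
      using base[OF that] by simp
  qed (use ne in \<open>auto simp: eventually_principal\<close>)
  show "?F \<noteq> bot" using ne(2) unfolding trivial_limit_def ev by blast
  show "eventually (\<lambda>x. x \<in> S i) ?F" if "i \<in> I" for i using that unfolding ev by blast
qed

context mean_field_game
begin

text \<open>Limit points of measures whose first marginals converge exist without any tightness
  hypothesis: as \<open>X\<close> is compact, \<open>{w. \<forall>x. h k (w, x) < e}\<close> is open and increases to the whole space
  when \<open>h k\<close> decreases to 0.\<close>

lemma marginal_daniell: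
  fixes h :: "nat \<Rightarrow> 'w \<times> 'x \<Rightarrow> real"
  assumes lam: "lam \<in> Prob_space"
    and h: "\<And>k. h k \<in> Cb" "\<And>z. decseq (\<lambda>k. h k z)" "\<And>z. (\<lambda>k. h k z) \<longlonglongrightarrow> 0" and e: "e > 0"
  shows "\<exists>k V. openin weak_top V \<and> lam \<in> V \<and>
    (\<forall>m\<in>Prob_space. distr m borel fst \<in> V \<longrightarrow> (\<integral>z. h k z \<partial>m) \<le> e)"
proof -
  interpret prob_space lam using Prob_spaceD[OF lam] by simp
  have nonneg: "0 \<le> h k z" for k z using decseq_ge[OF h(2,3)] .
  obtain B where B: "B \<ge> 0" "\<And>z. \<bar>h 0 z\<bar> \<le> B" using Cb_bound[OF h(1)[of 0]] by blast
  have mono: "h k z \<le> h j z" if "j \<le> k" for j k z using decseqD[OF h(2) that] .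
  have hB: "h k z \<le> B" for k z using B(2)[of z] mono[of 0 k z] by simp
  define U where "U k = {w. \<forall>x. h k (w, x) < e / 2}" for k
  have U: "open (U k)" for k
  proof -
    have "closed {z. e / 2 \<le> h k z}"
      using Cb_continuous[OF h(1)] by (intro closed_Collect_le continuous_on_const)
    then have "closed (fst ` {z. e / 2 \<le> h k z})" by (rule closed_fst_image[OF X_compact])
    moreover have "U k = - (fst ` {z. e / 2 \<le> h k z})"
      unfolding U_def by (rule set_eqI) (simp add: image_iff not_le)
    ultimately show ?thesis by (simp add: open_Compl)
  qed
  have "incseq U"
  proof (rule monoI, rule subsetI)
    fix j k w assume jk: "j \<le> k" and w: "w \<in> U j"
    have "h k (w, x) < e / 2" for x
    proof -
      have "h j (w, x) < e / 2" using w unfolding U_def by blast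
      with mono[OF jk, of "(w, x)"] show ?thesis by linarith
    qed
    then show "w \<in> U k" by (simp add: U_def)
  qed
  moreover have "(\<Union>k. U k) = UNIV"
  proof (rule set_eqI)
    fix w
    have op: "open {x. h k (w, x) < e / 2}" for k
    proof (rule open_Collect_less)
      show "continuous_on UNIV (\<lambda>x. h k (w, x))"
        by (rule continuous_on_compose2[OF Cb_continuous[OF h(1)]]) (auto intro!: continuous_intros)
    qed auto
    have "UNIV \<subseteq> (\<Union>k\<in>UNIV. {x. h k (w, x) < e / 2})"
    proof
      fix x
      have "eventually (\<lambda>k. h k (w, x) < e / 2) sequentially"
        by (rule order_tendstoD(2)[OF h(3)]) (use e in simp)
      then show "x \<in> (\<Union>k\<in>UNIV. {x. h k (w, x) < e / 2})" by (auto simp: eventually_sequentially)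
    qed
    then obtain T where T: "finite T" "UNIV \<subseteq> (\<Union>k\<in>T. {x. h k (w, x) < e / 2})"
      by (rule compactE_image[OF X_compact op])
    have "h (Max (insert 0 T)) (w, x) < e / 2" for x
    proof -
      have "x \<in> (\<Union>k\<in>T. {x. h k (w, x) < e / 2})" using T(2) by blast
      then obtain i where i: "i \<in> T" "h i (w, x) < e / 2" by blast
      then have "i \<le> Max (insert 0 T)" using T(1) by simp
      from mono[OF this, of "(w, x)"] i(2) show ?thesis by simp
    qed
    then show "w \<in> (\<Union>k. U k) \<longleftrightarrow> w \<in> UNIV" by (auto simp: U_def)
  qed
  moreover have "range U \<subseteq> sets lam" using U Prob_spaceD[OF lam] by auto
  ultimately have "(\<lambda>k. measure lam (U k)) \<longlonglongrightarrow> 1"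
    using finite_Lim_measure_incseq[of U] Prob_space_measure_UNIV[OF lam] by simp
  \<comment> \<open>Outside \<open>U k\<close> the integrand is at most \<open>B\<close>, so a
    missing mass below \<open>e / (2 * (B + 1))\<close> contributes at most
    \<open>e / 2\<close>.\<close>
  moreover define c where "c = 1 - e / (2 * (B + 1))"
  have c: "c < 1" using e B(1) by (simp add: c_def)
  ultimately have "eventually (\<lambda>k. measure lam (U k) > c) sequentially" by (rule order_tendstoD(1))
  then obtain k where k: "measure lam (U k) > c" by (auto simp: eventually_sequentially)
  obtain V where V: "openin weak_top V" "lam \<in> V" "\<forall>\<nu>\<in>V. measure \<nu> (U k) > c"
    using weak_top_open_mass[OF lam U k] by blast
  have "(\<integral>z. h k z \<partial>m) \<le> e" if m: "m \<in> Prob_space" "distr m borel fst \<in> V" for m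
  proof -
    interpret m: prob_space m using Prob_spaceD[OF m(1)] by simp
    define S :: "('w \<times> 'x) set" where "S = fst -` U k"
    have "S \<in> sets borel" unfolding S_def by (rule borel_open[OF open_vimage_fst[OF U]])
    then have S: "S \<in> sets m" using Prob_spaceD(2)[OF m(1)] by simp
    have "fst \<in> borel_measurable m"
      unfolding Prob_space_measurable[OF m(1)]
      by (rule borel_measurable_continuous_onI[OF continuous_on_fst[OF continuous_on_id]])
    from measure_distr[OF this borel_open[OF U]]
    have "measure (distr m borel fst) (U k) = measure m S"
      by (simp add: S_def Prob_spaceD(3)[OF m(1)])
    then have mS: "measure m S > c" using V(3) m(2) by auto
    have iS: "integrable m (indicator S :: 'w \<times> 'x \<Rightarrow> real)"
      using S by (intro integrable_real_indicator) (simp_all add: m.emeasure_eq_measure)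
    have "(\<integral>z. h k z \<partial>m) \<le> (\<integral>z. e / 2 + B * (1 - indicator S z) \<partial>m)"
    proof (rule integral_mono[OF Cb_integrable[OF m(1) h(1)]])
      show "integrable m (\<lambda>z. e / 2 + B * (1 - indicator S z))" using iS by simp
      show "h k z \<le> e / 2 + B * (1 - indicator S z)" for z
      proof (cases "z \<in> S")
        case True
        then have "h k (fst z, snd z) < e / 2" unfolding S_def U_def by blast
        with True show ?thesis by simp
      next
        case False
        then show ?thesis using hB[of k z] e by simp
      qed
    qed
    also have "\<dots> = e / 2 + B * (1 - measure m S)"
      using iS S by (simp add: Prob_space_measure_UNIV[OF m(1)] Prob_spaceD(3)[OF m(1)])
    also have "\<dots> \<le> e / 2 + (B + 1) * (e / (2 * (B + 1)))"
      using mS B(1) e m.prob_le_1[of S] by (intro add_left_mono mult_mono) (auto simp: c_def)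
    also have "\<dots> = e" using B(1) by (simp add: field_simps)
    finally show ?thesis .
  qed
  with V show ?thesis by blast
qed

text \<open>Failure for every pair of a neighbourhood and a tolerance gives a directed family of
  nonempty sets, whose filter has a cluster point by \<open>marginal_daniell\<close>. Its marginal
  is \<open>lam\<close> and it is an exact equilibrium, so it lies in \<open>E\<close>, while the
  filter stays outside this open set. Quantifying over all near equilibria covers \<open>MFE\<close>
  of nearby laws and finite games together.\<close>

lemma MFE_upper_hemicontinuous:
  assumes lam: "lam \<in> Prob_space" and E: "openin weak_top E" "MFE F C lam \<subseteq> E"
  shows "\<exists>V \<delta>. openin weak_top V \<and> lam \<in> V \<and> \<delta> > 0 \<and>
    (\<forall>m\<in>Prob_space. distr m borel fst \<in> V \<longrightarrow> near_MFE \<delta> m \<longrightarrow> m \<in> E)"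
proof (rule ccontr)
  assume neg: "\<not> ?thesis"
  define I where "I = {p :: 'w measure set \<times> real. openin weak_top (fst p) \<and> lam \<in> fst p \<and> snd p > 0}"
  define S where "S p = {m \<in> Prob_space. distr m borel fst \<in> fst p \<and> near_MFE (snd p) m \<and> m \<notin> E}" for p
  have ne: "S p \<noteq> {}" if "p \<in> I" for p
  proof
    assume "S p = {}"
    then have "\<forall>m\<in>Prob_space. distr m borel fst \<in> fst p \<longrightarrow> near_MFE (snd p) m \<longrightarrow> m \<in> E"
      unfolding S_def by blast
    with that neg show False unfolding I_def by blast
  qed
  have I: "(Prob_space, 1) \<in> I" using lam openin_topspace[of weak_top] by (simp add: I_def)
  have base: "\<exists>k\<in>I. S k \<subseteq> S i \<inter> S j" if ij: "i \<in> I" "j \<in> I" for i j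
  proof
    show "(fst i \<inter> fst j, min (snd i) (snd j)) \<in> I" using ij openin_Int[of weak_top "fst i" "fst j"] by (simp add: I_def)
    show "S (fst i \<inter> fst j, min (snd i) (snd j)) \<subseteq> S i \<inter> S j"
      using near_MFE_mono[of "min (snd i) (snd j)"] unfolding S_def by auto
  qed
  obtain \<F> where F: "\<F> \<noteq> bot" "\<And>p. p \<in> I \<Longrightarrow> eventually (\<lambda>m. m \<in> S p) \<F>"
    using filter_of_directed_sets[of I S, OF base _ ne] I by blast
  have FP: "eventually (\<lambda>m. m \<in> Prob_space) \<F>" "eventually (\<lambda>m. m \<notin> E) \<F>"
    using F(2)[OF I] by (auto elim: eventually_mono simp: S_def)
  have FV: "eventually (\<lambda>m. m \<in> Prob_space \<and> distr m borel fst \<in> V) \<F>" if "openin weak_top V" "lam \<in> V" for V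
  proof -
    have "(V, 1) \<in> I" using that by (simp add: I_def)
    from F(2)[OF this] show ?thesis by (rule eventually_mono) (simp add: S_def)
  qed
  have D: "\<exists>k. eventually (\<lambda>m. (\<integral>x. h k x \<partial>m) \<le> e) \<F>"
    if h: "\<And>k. h k \<in> Cb" "\<And>x. decseq (\<lambda>k. h k x)" "\<And>x. (\<lambda>k. h k x) \<longlonglongrightarrow> 0" "e > 0"
    for h :: "nat \<Rightarrow> 'w \<times> 'x \<Rightarrow> real" and e
  proof -
    obtain k V where kV: "openin weak_top V" "lam \<in> V"
      "\<forall>m\<in>Prob_space. distr m borel fst \<in> V \<longrightarrow> (\<integral>z. h k z \<partial>m) \<le> e"
      using marginal_daniell[OF lam h] by blast
    have "eventually (\<lambda>m. (\<integral>x. h k x \<partial>m) \<le> e) \<F>"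
      using FV[OF kV(1,2)] by (rule eventually_mono) (use kV(3) in blast)
    then show ?thesis ..
  qed
  obtain l G where lG: "l \<in> Prob_space" "G \<le> \<F>" "G \<noteq> bot" "limitin weak_top (\<lambda>x. x) l G"
    by (rule weak_cluster[OF F(1) FP(1) D])
  have "limitin weak_top (\<lambda>m. distr m borel fst) (distr l borel fst) G"
    by (rule limitin_distr[OF continuous_on_fst[OF continuous_on_id] lG(4)])
  moreover have "limitin weak_top (\<lambda>m. distr m borel fst) lam G"
    unfolding limitin_def
  proof (intro conjI allI impI)
    show "lam \<in> topspace weak_top" using lam by simp
    fix V :: "'w measure set" assume "openin weak_top V \<and> lam \<in> V"
    then have "eventually (\<lambda>m. m \<in> Prob_space \<and> distr m borel fst \<in> V) G"
      using FV filter_leD[OF lG(2)] by blast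
    then show "eventually (\<lambda>m. distr m borel fst \<in> V) G" by (rule eventually_mono) simp
  qed
  ultimately have "distr l borel fst = lam"
    by (rule limitin_Hausdorff_unique[OF _ _ lG(3) Hausdorff_weak_top])
  moreover have "AE z in l. snd z \<in> C (fst z) \<and> (\<forall>y\<in>C (fst z). F l (fst z) (snd z) \<le> F l (fst z) y)"
  proof (rule limit_equilibrium[OF lG(3,4)])
    fix \<delta> :: real assume "\<delta> > 0"
    then have "(Prob_space, \<delta>) \<in> I" using lam openin_topspace[of weak_top] by (simp add: I_def)
    from filter_leD[OF lG(2) F(2)[OF this]] show "eventually (near_MFE \<delta>) G"
      by (rule eventually_mono) (simp add: S_def)
  qed
  ultimately have "l \<in> E" using lG(1) E(2) by (auto simp: MFE_iff)
  from limitinD[OF lG(4) E(1) this] filter_leD[OF lG(2) FP(2)]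
  have "eventually (\<lambda>m. False) G" by eventually_elim simp
  with lG(3) show False by simp
qed

section \<open>Approximate equilibria of the game with n players\<close>

lemma eps_Nash_iff:
  assumes n: "n \<ge> 1"
  shows "eps_Nash F C \<epsilon> n w x \<longleftrightarrow> (\<forall>i<n. x i \<in> C (w i) \<and> (\<forall>y\<in>C (w i).
    F (empirical n (\<lambda>k. (w k, x k))) (w i) (x i) \<le> F (empirical n (\<lambda>k. (w k, (x(i := y)) k))) (w i) y + \<epsilon>))"
proof -
  obtain B where B: "\<forall>m\<in>Prob_space. \<forall>w x. \<bar>F m w x\<bar> \<le> B" using F_bounded by blast
  have "a - (INF y\<in>C (w i). F (empirical n (\<lambda>k. (w k, (x(i := y)) k))) (w i) y) \<le> \<epsilon> \<longleftrightarrow>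
      (\<forall>y\<in>C (w i). a \<le> F (empirical n (\<lambda>k. (w k, (x(i := y)) k))) (w i) y + \<epsilon>)" for a i
  proof -
    have "bdd_below ((\<lambda>y. F (empirical n (\<lambda>k. (w k, (x(i := y)) k))) (w i) y) ` C (w i))"
    proof (rule bdd_belowI2)
      show "- B \<le> F (empirical n (\<lambda>k. (w k, (x(i := y)) k))) (w i) y" for y
        using B empirical_Prob_space[OF n] by (meson abs_le_D2 minus_le_iff)
    qed
    from le_cINF_iff[OF C_nonempty this, of "a - \<epsilon>"] show ?thesis by (simp add: algebra_simps)
  qed
  then show ?thesis unfolding eps_Nash_def by blast
qed

lemma Nash_near_MFE:
  assumes n: "n \<ge> 1" and N: "eps_Nash F C \<epsilon> n w x" and \<delta>: "\<epsilon> \<le> \<delta>" "2 / real n \<le> \<delta>"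
  shows "near_MFE \<delta> (empirical n (\<lambda>k. (w k, x k)))"
  unfolding near_MFE_def
proof (rule AE_empirical[OF n], simp only: fst_conv snd_conv, intro conjI ballI)
  fix i assume i: "i < n"
  note Ni = N[unfolded eps_Nash_iff[OF n], rule_format, OF i]
  show "x i \<in> C (w i)" using Ni by blast
  fix y assume y: "y \<in> C (w i)"
  let ?m' = "empirical n (\<lambda>k. (w k, (x(i := y)) k))"
  show "\<exists>m'. near_measure \<delta> (empirical n (\<lambda>k. (w k, x k))) m' \<and>
        F (empirical n (\<lambda>k. (w k, x k))) (w i) (x i) \<le> F m' (w i) y + \<delta>"
    unfolding near_measure_def
  proof (intro exI[of _ ?m'] conjI ballI allI impI)
    show "?m' \<in> Prob_space" by (rule empirical_Prob_space[OF n])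
    show "F (empirical n (\<lambda>k. (w k, x k))) (w i) (x i) \<le> F ?m' (w i) y + \<delta>"
      using Ni y \<delta>(1) by fastforce
    fix f :: "'w \<times> 'x \<Rightarrow> real" and B assume f: "f \<in> Cb" and B: "\<forall>x. \<bar>f x\<bar> \<le> B"
    have B0: "B \<ge> 0" using order_trans[OF abs_ge_zero B[rule_format, of undefined]] .
    \<comment> \<open>Only the summand of the deviating player changes, by at most
      \<open>2 * B\<close>.\<close>
    have "(\<Sum>k<n. f (w k, (x(i := y)) k)) - (\<Sum>k<n. f (w k, x k))
        = (\<Sum>k<n. if k = i then f (w i, y) - f (w i, x i) else 0)"
      unfolding sum_subtractf[symmetric] by (intro sum.cong) auto
    also have "\<dots> = f (w i, y) - f (w i, x i)" using i by simp
    finally have "(\<integral>x. f x \<partial>?m') - (\<integral>x. f x \<partial>empirical n (\<lambda>k. (w k, x k))) = (f (w i, y) - f (w i, x i)) / real n"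
      unfolding integral_empirical[OF n Cb_measurable[OF f]] by (simp add: diff_divide_distrib[symmetric])
    moreover have "\<bar>f (w i, y) - f (w i, x i)\<bar> \<le> 2 * B"
      using B[rule_format, of "(w i, y)"] B[rule_format, of "(w i, x i)"] by linarith
    then have "\<bar>(f (w i, y) - f (w i, x i)) / real n\<bar> \<le> 2 / real n * B"
      using n by (simp add: field_simps)
    moreover have "2 / real n * B \<le> \<delta> * B" using \<delta>(2) B0 by (rule mult_right_mono)
    ultimately show "\<bar>(\<integral>x. f x \<partial>?m') - (\<integral>x. f x \<partial>empirical n (\<lambda>k. (w k, x k)))\<bar> \<le> \<delta> * B" by simp
  qed
qed

lemma F_tendsto:
  assumes "limitin weak_top m l G" "(w \<longlongrightarrow> w') G" "(x \<longlongrightarrow> x') G"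
  shows "((\<lambda>k. F (m k) (w k) (x k)) \<longlongrightarrow> F l w' x') G"
proof (rule topological_tendstoI)
  fix S assume S: "open S" "F l w' x' \<in> S"
  have "l \<in> Prob_space" using assms(1) by (simp add: limitin_weak_top_iff)
  from F_nbhd[OF this S] obtain V U O' where V: "openin weak_top V" "open U" "open O'" "l \<in> V" "w' \<in> U" "x' \<in> O'"
    "\<forall>m'\<in>V. \<forall>w'\<in>U. \<forall>x'\<in>O'. F m' w' x' \<in> S" by (elim exE conjE) (rule that)
  from limitinD[OF assms(1) V(1,4)] topological_tendstoD[OF assms(2) V(2,5)] topological_tendstoD[OF assms(3) V(3,6)]
  show "eventually (\<lambda>k. F (m k) (w k) (x k) \<in> S) G" by eventually_elim (use V(7) in blast)
qed

text \<open>A deviation \<open>y\<close> at the limit is approached by deviations feasible along a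
  subsequence, by \<open>C_lower\<close>, and the equilibrium inequality passes to the limit since
  \<open>F\<close> is jointly continuous.\<close>

lemma closed_Nash_graph:
  assumes n: "n \<ge> 1"
  shows "closed {(w, x). eps_Nash F C \<epsilon> n w x}"
  unfolding closed_sequential_limits
proof (intro allI impI, elim conjE)
  fix p :: "nat \<Rightarrow> (nat \<Rightarrow> 'w) \<times> (nat \<Rightarrow> 'x)" and l
  assume p: "\<forall>k. p k \<in> {(w, x). eps_Nash F C \<epsilon> n w x}" and lim: "p \<longlonglongrightarrow> l"
  define w x w' x' where "w k = fst (p k)" and "x k = snd (p k)" and "w' = fst l" and "x' = snd l" for k
  have N: "eps_Nash F C \<epsilon> n (w k) (x k)" for k using p by (simp add: w_def x_def case_prod_unfold)
  have wl: "(\<lambda>k. w k i) \<longlonglongrightarrow> w' i" for i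
    unfolding w_def w'_def
    by (rule continuous_on_tendsto_compose[OF continuous_on_product_coordinates tendsto_fst[OF lim]]) auto
  have xl: "(\<lambda>k. x k i) \<longlonglongrightarrow> x' i" for i
    unfolding x_def x'_def
    by (rule continuous_on_tendsto_compose[OF continuous_on_product_coordinates tendsto_snd[OF lim]]) auto
  have "eps_Nash F C \<epsilon> n w' x'"
    unfolding eps_Nash_iff[OF n]
  proof (intro allI impI conjI ballI)
    fix i assume i: "i < n"
    note Ni = N[unfolded eps_Nash_iff[OF n], rule_format, OF i]
    have "(w' i, x' i) \<in> {(w, x). x \<in> C w}"
      using Ni by (intro closed_sequentially[OF C_graph_closed _ tendsto_Pair[OF wl xl]]) simp
    then show "x' i \<in> C (w' i)" by simp
    fix y assume "y \<in> C (w' i)"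
    from C_lower[OF wl this] obtain r ys where r: "strict_mono r" "\<forall>k. ys k \<in> C (w (r k) i)" "ys \<longlonglongrightarrow> y" by blast
    have wr: "(\<lambda>k. w (r k) j) \<longlonglongrightarrow> w' j" and xr: "(\<lambda>k. x (r k) j) \<longlonglongrightarrow> x' j" for j
      using LIMSEQ_subseq_LIMSEQ[OF wl r(1)] LIMSEQ_subseq_LIMSEQ[OF xl r(1)] by (simp_all add: o_def)
    have "(\<lambda>k. F (empirical n (\<lambda>j. (w (r k) j, x (r k) j))) (w (r k) i) (x (r k) i))
        \<longlonglongrightarrow> F (empirical n (\<lambda>j. (w' j, x' j))) (w' i) (x' i)"
      by (intro F_tendsto empirical_limitin[OF n] tendsto_Pair wr xr)
    moreover have "(\<lambda>k. F (empirical n (\<lambda>j. (w (r k) j, ((x (r k))(i := ys k)) j))) (w (r k) i) (ys k) + \<epsilon>)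
        \<longlonglongrightarrow> F (empirical n (\<lambda>j. (w' j, (x'(i := y)) j))) (w' i) y + \<epsilon>"
    proof (intro tendsto_add[OF _ tendsto_const] F_tendsto empirical_limitin[OF n] tendsto_Pair wr r(3))
      show "(\<lambda>k. ((x (r k))(i := ys k)) j) \<longlonglongrightarrow> (x'(i := y)) j" for j
        using xr[of j] r(3) by (cases "j = i") simp_all
    qed
    ultimately show "F (empirical n (\<lambda>j. (w' j, x' j))) (w' i) (x' i)
        \<le> F (empirical n (\<lambda>j. (w' j, (x'(i := y)) j))) (w' i) y + \<epsilon>"
      by (rule LIMSEQ_le) (use Ni r(2) in blast)
  qed
  then show "l \<in> {(w, x). eps_Nash F C \<epsilon> n w x}" by (simp add: w'_def x'_def case_prod_unfold)
qed

lemma continuous_map_profile: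
  assumes n: "n \<ge> 1"
  shows "continuous_map euclidean weak_top (\<lambda>p :: (nat \<Rightarrow> 'w) \<times> (nat \<Rightarrow> 'x). empirical n (\<lambda>k. (fst p k, snd p k)))"
proof (rule continuous_map_empirical[OF n])
  fix i
  have "continuous_on UNIV (\<lambda>p :: (nat \<Rightarrow> 'w) \<times> (nat \<Rightarrow> 'x). fst p i)"
    by (rule continuous_on_compose2[OF continuous_on_product_coordinates]) (auto intro: continuous_intros)
  moreover have "continuous_on UNIV (\<lambda>p :: (nat \<Rightarrow> 'w) \<times> (nat \<Rightarrow> 'x). snd p i)"
    by (rule continuous_on_compose2[OF continuous_on_product_coordinates]) (auto intro: continuous_intros)
  ultimately show "continuous_map euclidean euclidean (\<lambda>p :: (nat \<Rightarrow> 'w) \<times> (nat \<Rightarrow> 'x). (fst p i, snd p i))"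
    by (simp add: continuous_on_Pair)
qed

text \<open>Profiles are infinite sequences of which only \<open>n\<close> entries matter. The space
  of all of them is still compact, so the fibre over \<open>w\<close> has a compact image, which is
  closed as \<open>weak_top\<close> is Hausdorff.\<close>

lemma closedin_Nash_set:
  assumes n: "n \<ge> 1"
  shows "closedin weak_top (Nash_set F C \<epsilon> n w)"
proof -
  have "closed ({w} \<times> UNIV \<inter> {(w, x). eps_Nash F C \<epsilon> n w x})"
    using closed_Nash_graph[OF n] by (intro closed_Int closed_Times) auto
  then have "compact ({w} \<times> UNIV \<inter> ({w} \<times> UNIV \<inter> {(w, x). eps_Nash F C \<epsilon> n w x}))"
    by (intro compact_Int_closed compact_Times compact_UNIV_fun X_compact) auto
  then have "compactin euclidean ({w} \<times> UNIV \<inter> {(w, x). eps_Nash F C \<epsilon> n w x})"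
    by (simp add: Int_assoc[symmetric])
  from image_compactin[OF this continuous_map_profile[OF n]]
  have "compactin weak_top ((\<lambda>p. empirical n (\<lambda>k. (fst p k, snd p k))) ` ({w} \<times> UNIV \<inter> {(w, x). eps_Nash F C \<epsilon> n w x}))" .
  moreover have "(\<lambda>p. empirical n (\<lambda>k. (fst p k, snd p k))) ` ({w} \<times> UNIV \<inter> {(w, x). eps_Nash F C \<epsilon> n w x}) = Nash_set F C \<epsilon> n w"
    unfolding Nash_set_def by (force simp: image_iff)
  ultimately show ?thesis using compactin_imp_closedin[OF Hausdorff_weak_top] by simp
qed

text \<open>The complement is the projection of a closed set along the compact space of profiles.
  This openness gives the measurability of the random set of equilibria.\<close>

lemma open_Nash_subset:
  assumes n: "n \<ge> 1" and E: "openin weak_top E"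
  shows "open {w. Nash_set F C \<epsilon> n w \<subseteq> E}"
proof -
  let ?R = "{(w, x). eps_Nash F C \<epsilon> n w x}"
  let ?e = "\<lambda>p :: (nat \<Rightarrow> 'w) \<times> (nat \<Rightarrow> 'x). empirical n (\<lambda>k. (fst p k, snd p k))"
  have "openin euclidean {p \<in> topspace euclidean. ?e p \<in> E}"
    by (rule openin_continuous_map_preimage[OF continuous_map_profile[OF n] E])
  then have "open {p. ?e p \<in> E}" by simp
  then have "closed (?R \<inter> - {p. ?e p \<in> E})"
    by (intro closed_Int closed_Nash_graph[OF n] closed_Compl)
  then have "closed (fst ` (?R \<inter> - {p. ?e p \<in> E}))"
    by (rule closed_fst_image[OF compact_UNIV_fun[OF X_compact]])
  moreover have "{w. Nash_set F C \<epsilon> n w \<subseteq> E} = - (fst ` (?R \<inter> - {p. ?e p \<in> E}))"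
    unfolding Nash_set_def by (force simp: image_iff)
  ultimately show ?thesis by (simp add: open_Compl)
qed

lemma Nash_set_cong:
  assumes n: "n \<ge> 1" and eq: "\<And>i. i < n \<Longrightarrow> w i = w' i"
  shows "Nash_set F C \<epsilon> n w = Nash_set F C \<epsilon> n w'"
proof -
  have e: "empirical n (\<lambda>k. (w k, x k)) = empirical n (\<lambda>k. (w' k, x k))" for x :: "nat \<Rightarrow> 'x"
    by (rule empirical_cong[OF n]) (simp add: eq)
  have "eps_Nash F C \<epsilon> n w x \<longleftrightarrow> eps_Nash F C \<epsilon> n w' x" for x
    unfolding eps_Nash_iff[OF n] e using eq by auto
  then show ?thesis unfolding Nash_set_def e by simp
qed

end

section \<open>Large deviations in the upper Vietoris topology\<close>

lemma topspace_upper_vietoris: "topspace upper_vietoris = closed_sets_P"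
proof -
  have "\<And>A. A \<in> closed_sets_P \<Longrightarrow> A \<subseteq> topspace weak_top" by (simp add: closed_sets_P_def closedin_def)
  then have "closed_sets_P \<in> {{A \<in> closed_sets_P. A \<subseteq> E} | E. openin weak_top E}"
    using openin_topspace[of weak_top] by (intro CollectI exI[of _ "topspace weak_top"]) auto
  then show ?thesis unfolding upper_vietoris_def topology_generated_by_topspace by auto
qed

text \<open>Inclusion in \<open>E\<close> and in \<open>E'\<close> is inclusion in
  \<open>E \<inter> E'\<close>, so the generating family is closed under finite intersections and
  hence a base.\<close>

lemma upper_vietoris_basis:
  assumes "openin upper_vietoris \<V>" "A \<in> \<V>"
  shows "\<exists>E. openin weak_top E \<and> A \<subseteq> E \<and> (\<forall>B\<in>closed_sets_P. B \<subseteq> E \<longrightarrow> B \<in> \<V>)"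
proof -
  have "generate_topology_on {{A \<in> closed_sets_P. A \<subseteq> E} | E. openin weak_top E} \<V>"
    using assms(1) by (simp add: upper_vietoris_def openin_topology_generated_by_iff)
  then show ?thesis using assms(2)
  proof (induction rule: generate_topology_on.induct)
    case (Int a b)
    from Int.prems have "A \<in> a" "A \<in> b" by auto
    from Int.IH(1)[OF this(1)] Int.IH(2)[OF this(2)]
    obtain E E' where E: "openin weak_top E" "A \<subseteq> E" "\<forall>B\<in>closed_sets_P. B \<subseteq> E \<longrightarrow> B \<in> a"
      "openin weak_top E'" "A \<subseteq> E'" "\<forall>B\<in>closed_sets_P. B \<subseteq> E' \<longrightarrow> B \<in> b" by (elim exE conjE) (rule that)
    show ?case
      by (rule exI[of _ "E \<inter> E'"]) (use E openin_Int[OF E(1,4)] in simp)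
  next
    case (UN K)
    then obtain X where X: "X \<in> K" "A \<in> X" by blast
    from UN.IH[OF X] obtain E where E: "openin weak_top E" "A \<subseteq> E" "\<forall>B\<in>closed_sets_P. B \<subseteq> E \<longrightarrow> B \<in> X"
      by (elim exE conjE) (rule that)
    show ?case by (rule exI[of _ E]) (use E X(1) in blast)
  next
    case (Basis s)
    then obtain E where E: "s = {A \<in> closed_sets_P. A \<subseteq> E}" "openin weak_top E" by auto
    show ?case by (rule exI[of _ E]) (use E Basis(2) in simp)
  qed simp
qed

section \<open>Logarithmic rates\<close>

lemma limsup_logp_le:
  assumes "eventually (\<lambda>n. p n \<le> c * exp (- real n * a)) sequentially"
  shows "limsup (\<lambda>n. ereal (1 / real n) * logp (p n)) \<le> ereal (- a)"
proof -
  \<comment> \<open>\<open>c\<close> may be nonpositive; raising it to at least 1 makes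
    \<open>ln b\<close> meaningful, and a constant factor disappears after division by
    \<open>n\<close>.\<close>
  define b where "b = max c 1"
  have b: "b \<ge> 1" "c \<le> b" by (simp_all add: b_def)
  have "eventually (\<lambda>n. ereal (1 / real n) * logp (p n) \<le> ereal (ln b / real n - a)) sequentially"
    using assms eventually_ge_at_top[of 1]
  proof eventually_elim
    case (elim n)
    show ?case
    proof (cases "p n \<le> 0")
      case True
      then show ?thesis using elim(2) by (simp add: logp_def)
    next
      case False
      have "p n \<le> b * exp (- real n * a)"
        by (rule order_trans[OF elim(1) mult_right_mono[OF b(2)]]) simp
      then have "ln (p n) \<le> ln (b * exp (- real n * a))" using False b(1) by simp
      also have "\<dots> = ln b - real n * a" using b(1) by (simp add: ln_mult)
      finally have "ln (p n) / real n \<le> (ln b - real n * a) / real n" by (intro divide_right_mono) auto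
      also have "\<dots> = ln b / real n - a" using elim(2) by (simp add: diff_divide_distrib)
      finally show ?thesis using False by (simp add: logp_def)
    qed
  qed
  then have "limsup (\<lambda>n. ereal (1 / real n) * logp (p n)) \<le> limsup (\<lambda>n. ereal (ln b / real n - a))"
    by (rule Limsup_mono)
  also have "\<dots> = ereal (- a)"
  proof (rule lim_imp_Limsup)
    have "(\<lambda>n. ln b / real n - a) \<longlonglongrightarrow> 0 - a"
      by (intro tendsto_diff lim_const_over_n tendsto_const)
    then show "(\<lambda>n. ereal (ln b / real n - a)) \<longlonglongrightarrow> ereal (- a)" by simp
  qed simp
  finally show ?thesis .
qed

lemma liminf_logp_ge:
  assumes q: "q \<longlonglongrightarrow> 1"
    and p: "eventually (\<lambda>n. q n > 0 \<longrightarrow> q n * exp (- (real n * h + 1) / q n) \<le> p n) sequentially"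
  shows "ereal (- h) \<le> liminf (\<lambda>n. ereal (1 / real n) * logp (p n))"
proof -
  have "eventually (\<lambda>n. q n > 0) sequentially" using order_tendstoD(1)[OF q, of 0] by simp
  with p eventually_ge_at_top[of 1]
  have "eventually (\<lambda>n. ereal (ln (q n) * (1 / real n) - (h + 1 / real n) / q n) \<le> ereal (1 / real n) * logp (p n)) sequentially"
  proof eventually_elim
    case (elim n)
    have n: "real n > 0" using elim(2) by simp
    have le: "q n * exp (- (real n * h + 1) / q n) \<le> p n" using elim by blast
    have pos: "0 < q n * exp (- (real n * h + 1) / q n)" using elim(3) by simp
    with le have p0: "0 < p n" by linarith
    have "ln (q n) + - (real n * h + 1) / q n = ln (q n * exp (- (real n * h + 1) / q n))"
      using elim(3) by (subst ln_mult) auto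
    also have "\<dots> \<le> ln (p n)" using le pos p0 by (subst ln_le_cancel_iff)
    finally have "(ln (q n) + - (real n * h + 1) / q n) / real n \<le> ln (p n) / real n"
      using n by (intro divide_right_mono) auto
    moreover have "(ln (q n) + - (real n * h + 1) / q n) / real n = ln (q n) * (1 / real n) - (h + 1 / real n) / q n"
      using n elim(3) by (simp add: field_simps)
    ultimately show ?case using p0 by (simp add: logp_def)
  qed
  then have "liminf (\<lambda>n. ereal (ln (q n) * (1 / real n) - (h + 1 / real n) / q n)) \<le> liminf (\<lambda>n. ereal (1 / real n) * logp (p n))"
    by (rule Liminf_mono)
  moreover have "liminf (\<lambda>n. ereal (ln (q n) * (1 / real n) - (h + 1 / real n) / q n)) = ereal (- h)"
  proof (rule lim_imp_Liminf)
    have "(\<lambda>n. ln (q n) * (1 / real n) - (h + 1 / real n) / q n) \<longlonglongrightarrow> ln 1 * 0 - (h + 0) / 1"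
      by (intro tendsto_diff tendsto_mult tendsto_ln q tendsto_divide tendsto_add tendsto_const lim_const_over_n) auto
    then show "(\<lambda>n. ereal (ln (q n) * (1 / real n) - (h + 1 / real n) / q n)) \<longlonglongrightarrow> ereal (- h)" by simp
  qed simp
  ultimately show ?thesis by simp
qed

section \<open>Continuity and compactness in the upper Vietoris topology\<close>

context mean_field_game
begin

abbreviation J :: "'w measure \<Rightarrow> ('w \<times> 'x) measure set \<Rightarrow> ereal" where
  "J \<mu> A \<equiv> (INF lam\<in>{lam \<in> Prob_space. MFE F C lam = A}. rel_entropy lam \<mu>)"

lemma MFE_closed_sets: "MFE F C lam \<in> closed_sets_P"
  by (simp add: closed_sets_P_def closedin_MFE)

lemma J_MFE_le: "lam \<in> Prob_space \<Longrightarrow> J \<mu> (MFE F C lam) \<le> rel_entropy lam \<mu>"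
  by (rule INF_lower) simp

text \<open>The law is recovered from a nonempty set of equilibria as their common first marginal, so the
  infimum defining \<open>J\<close> is over at most one measure.\<close>

lemma J_le_imp_MFE:
  assumes "J \<mu> A \<le> ereal a" "A \<noteq> {}"
  shows "\<exists>lam\<in>Prob_space. MFE F C lam = A \<and> rel_entropy lam \<mu> \<le> ereal a"
proof -
  obtain m where m: "m \<in> A" using assms(2) by blast
  have eq: "lam = distr m borel fst" if "MFE F C lam = A" for lam
    using m that by (auto simp: MFE_def)
  have "{lam \<in> Prob_space. MFE F C lam = A} \<noteq> {}"
  proof
    assume e: "{lam \<in> Prob_space. MFE F C lam = A} = {}"
    show False using assms(1) unfolding e by (simp add: top_ereal_def)
  qed
  then obtain lam where lam: "lam \<in> Prob_space" "MFE F C lam = A" by blast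
  have "{lam \<in> Prob_space. MFE F C lam = A} = {lam}" using lam eq by auto
  with assms(1) lam show ?thesis by auto
qed

text \<open>A basic open set inside \<open>\<V>\<close> turns membership into inclusion in a weakly
  open \<open>E\<close>, where \<open>MFE_upper_hemicontinuous\<close> applies. The same
  \<open>G\<close> handles limit and finite games: the first half gives compactness of the sublevels
  of \<open>J\<close>, the second transfers probabilities.\<close>

lemma vietoris_continuity:
  assumes lam: "lam \<in> Prob_space" and V: "openin upper_vietoris \<V>" "MFE F C lam \<in> \<V>"
    and eps: "\<epsilon> \<longlonglongrightarrow> (0::real)"
  shows "\<exists>G N. openin weak_top G \<and> lam \<in> G \<and> (\<forall>lam'\<in>G. MFE F C lam' \<in> \<V>) \<and>
    (\<forall>n\<ge>N. \<forall>w. empirical n w \<in> G \<longrightarrow> Nash_set F C (\<epsilon> n) n w \<in> \<V>)"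
proof -
  obtain E where E: "openin weak_top E" "MFE F C lam \<subseteq> E" "\<forall>B\<in>closed_sets_P. B \<subseteq> E \<longrightarrow> B \<in> \<V>"
    using upper_vietoris_basis[OF V] by blast
  obtain G \<delta> where G: "openin weak_top G" "lam \<in> G" "\<delta> > 0"
    "\<forall>m\<in>Prob_space. distr m borel fst \<in> G \<longrightarrow> near_MFE \<delta> m \<longrightarrow> m \<in> E"
    using MFE_upper_hemicontinuous[OF lam E(1,2)] by blast
  have "(\<lambda>n. 2 / real n) \<longlonglongrightarrow> 0" by (rule lim_const_over_n)
  from order_tendstoD(2)[OF this G(3)] order_tendstoD(2)[OF eps G(3)] eventually_ge_at_top[of 1]
  have "eventually (\<lambda>n. n \<ge> 1 \<and> \<epsilon> n \<le> \<delta> \<and> 2 / real n \<le> \<delta>) sequentially"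
    by eventually_elim simp
  then obtain N where N: "\<forall>n\<ge>N. n \<ge> 1 \<and> \<epsilon> n \<le> \<delta> \<and> 2 / real n \<le> \<delta>"
    unfolding eventually_sequentially by blast
  have 1: "MFE F C lam' \<in> \<V>" if "lam' \<in> G" for lam'
  proof -
    have "MFE F C lam' \<subseteq> E"
    proof
      fix m assume m: "m \<in> MFE F C lam'"
      then have "m \<in> Prob_space" "distr m borel fst \<in> G" using that by (auto simp: MFE_def)
      with G(4) MFE_near[OF m G(3)] show "m \<in> E" by blast
    qed
    then show ?thesis using E(3) MFE_closed_sets by blast
  qed
  have 2: "Nash_set F C (\<epsilon> n) n w \<in> \<V>" if n: "n \<ge> N" and w: "empirical n w \<in> G" for n w
  proof -
    have Nn: "n \<ge> 1" "\<epsilon> n \<le> \<delta>" "2 / real n \<le> \<delta>" using N n by blast+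
    have "Nash_set F C (\<epsilon> n) n w \<subseteq> E"
    proof
      fix m assume "m \<in> Nash_set F C (\<epsilon> n) n w"
      then obtain x where x: "m = empirical n (\<lambda>k. (w k, x k))" "eps_Nash F C (\<epsilon> n) n w x"
        unfolding Nash_set_def by blast
      have "distr m borel fst = empirical n w"
        unfolding x(1) using distr_empirical[OF Nn(1) continuous_on_fst[OF continuous_on_id], of "\<lambda>k. (w k, x k)"]
        by simp
      moreover have "near_MFE \<delta> m" unfolding x(1) by (rule Nash_near_MFE[OF Nn(1) x(2) Nn(2,3)])
      moreover have "m \<in> Prob_space" unfolding x(1) by (rule empirical_Prob_space[OF Nn(1)])
      ultimately show "m \<in> E" using G(4) w by simp
    qed
    moreover have "Nash_set F C (\<epsilon> n) n w \<in> closed_sets_P"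
      using closedin_Nash_set[OF Nn(1)] by (simp add: closed_sets_P_def)
    ultimately show ?thesis using E(3) by blast
  qed
  show ?thesis
    by (rule exI[of _ G], rule exI[of _ N]) (intro conjI G(1,2) ballI allI impI 1 2)
qed

lemma open_Nash_vimage:
  assumes n: "n \<ge> 1" and V: "openin upper_vietoris \<V>"
  shows "open {w. Nash_set F C \<epsilon> n w \<in> \<V>}"
proof (subst open_subopen, rule ballI)
  fix w assume "w \<in> {w. Nash_set F C \<epsilon> n w \<in> \<V>}"
  then obtain E where E: "openin weak_top E" "Nash_set F C \<epsilon> n w \<subseteq> E" "\<forall>B\<in>closed_sets_P. B \<subseteq> E \<longrightarrow> B \<in> \<V>"
    using upper_vietoris_basis[OF V] by blast
  show "\<exists>T. open T \<and> w \<in> T \<and> T \<subseteq> {w. Nash_set F C \<epsilon> n w \<in> \<V>}"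
  proof (intro exI[of _ "{w. Nash_set F C \<epsilon> n w \<subseteq> E}"] conjI)
    show "open {w. Nash_set F C \<epsilon> n w \<subseteq> E}" by (rule open_Nash_subset[OF n E(1)])
    show "{w. Nash_set F C \<epsilon> n w \<subseteq> E} \<subseteq> {w. Nash_set F C \<epsilon> n w \<in> \<V>}"
      using E(3) closedin_Nash_set[OF n] by (auto simp: closed_sets_P_def)
  qed (use E(2) in simp)
qed

text \<open>Up to the empty set, the sublevel is the image of the compact entropy sublevel under
  \<open>MFE\<close>; covers are pulled back, which uses no separation property of the
  target.\<close>

lemma compactin_J_sublevel:
  assumes \<mu>: "\<mu> \<in> Prob_space"
  shows "compactin upper_vietoris {A \<in> topspace upper_vietoris. J \<mu> A \<le> ereal a}"
  unfolding compactin_def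
proof (intro conjI allI impI)
  let ?S = "{A \<in> topspace upper_vietoris. J \<mu> A \<le> ereal a}"
  let ?K = "{\<nu> \<in> Prob_space. rel_entropy \<nu> \<mu> \<le> ereal a}"
  show "?S \<subseteq> topspace upper_vietoris" by blast
  fix \<U> assume U: "Ball \<U> (openin upper_vietoris) \<and> ?S \<subseteq> \<Union>\<U>"
  define \<G> where "\<G> = {G. openin weak_top G \<and> (\<exists>\<V>\<in>\<U>. \<forall>lam\<in>G. MFE F C lam \<in> \<V>)}"
  have "compactin weak_top ?K"
    by (rule uniformly_daniell_compactin[OF uniformly_daniell_entropy_sublevel[OF \<mu>] closedin_entropy_sublevel[OF \<mu>]])
  moreover have "?K \<subseteq> \<Union>\<G>"
  proof
    fix lam assume lam: "lam \<in> ?K"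
    then have "J \<mu> (MFE F C lam) \<le> ereal a" using J_MFE_le[of lam \<mu>] order_trans by blast
    then have "MFE F C lam \<in> ?S" using MFE_closed_sets[of lam] by (simp add: topspace_upper_vietoris)
    then obtain \<V> where V: "\<V> \<in> \<U>" "MFE F C lam \<in> \<V>" using U by blast
    have "lam \<in> Prob_space" "openin upper_vietoris \<V>" using lam V(1) U by blast+
    from vietoris_continuity[OF this V(2) tendsto_const]
    obtain G where "openin weak_top G" "lam \<in> G" "\<forall>lam'\<in>G. MFE F C lam' \<in> \<V>" by blast
    with V(1) show "lam \<in> \<Union>\<G>" unfolding \<G>_def by blast
  qed
  moreover have "Ball \<G> (openin weak_top)" by (simp add: \<G>_def)
  ultimately obtain \<F> where F: "finite \<F>" "\<F> \<subseteq> \<G>" "?K \<subseteq> \<Union>\<F>"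
    unfolding compactin_def by meson
  have "\<forall>G\<in>\<F>. \<exists>\<V>. \<V> \<in> \<U> \<and> (\<forall>lam\<in>G. MFE F C lam \<in> \<V>)" using F(2) unfolding \<G>_def by blast
  from bchoice[OF this] obtain v where v: "\<forall>G\<in>\<F>. v G \<in> \<U> \<and> (\<forall>lam\<in>G. MFE F C lam \<in> v G)" by blast
  \<comment> \<open>The empty set has no element from which the law could be read off, so
    \<open>J_le_imp_MFE\<close> does not apply to it; one extra member of the cover takes care of
    it.\<close>
  have "\<exists>\<E>. finite \<E> \<and> \<E> \<subseteq> \<U> \<and> ({} \<in> ?S \<longrightarrow> {} \<in> \<Union>\<E>)"
  proof (cases "{} \<in> ?S")
    case True
    then obtain \<V> where "\<V> \<in> \<U>" "{} \<in> \<V>" using U by blast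
    then show ?thesis by (intro exI[of _ "{\<V>}"]) simp
  next
    case False
    then show ?thesis by (intro exI[of _ "{}"]) blast
  qed
  then obtain \<E> where E: "finite \<E>" "\<E> \<subseteq> \<U>" "{} \<in> ?S \<longrightarrow> {} \<in> \<Union>\<E>" by blast
  show "\<exists>\<F>. finite \<F> \<and> \<F> \<subseteq> \<U> \<and> ?S \<subseteq> \<Union>\<F>"
  proof (intro exI[of _ "v ` \<F> \<union> \<E>"] conjI subsetI)
    fix A assume A: "A \<in> ?S"
    show "A \<in> \<Union>(v ` \<F> \<union> \<E>)"
    proof (cases "A = {}")
      case True
      have "A \<in> \<Union>\<E>" using E(3) A unfolding True by (rule mp)
      then show ?thesis by blast
    next
      case False
      have "J \<mu> A \<le> ereal a" using A by simp
      from J_le_imp_MFE[OF this False] obtain lam where "lam \<in> ?K" "MFE F C lam = A" by blast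
      with F(3) v show ?thesis by blast
    qed
  next
    show "finite (v ` \<F> \<union> \<E>)" using F(1) E(1) by simp
    show "\<V> \<in> \<U>" if "\<V> \<in> v ` \<F> \<union> \<E>" for \<V> using that v E(2) by blast
  qed
qed

end

theorem theorem3p6:
  fixes F :: "('w::polish_space \<times> 'x::metric_space) measure \<Rightarrow> 'w \<Rightarrow> 'x \<Rightarrow> real"
    and C :: "'w \<Rightarrow> 'x set"
    and \<epsilon> :: "nat \<Rightarrow> real"
    and M :: "'o measure"
    and W :: "nat \<Rightarrow> 'o \<Rightarrow> 'w"
    and lam0 :: "'w measure"
  assumes X_compact: "compact (UNIV :: 'x set)"
    and C_nonempty: "\<And>w. C w \<noteq> {}"
    and C_closed: "\<And>w. closed (C w)"
    and C_graph_closed: "closed {(w, x). x \<in> C w}"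
    and C_lower: "\<And>ws w x. ws \<longlonglongrightarrow> w \<Longrightarrow> x \<in> C w \<Longrightarrow>
          \<exists>r xs. strict_mono r \<and> (\<forall>k. xs k \<in> C (ws (r k))) \<and> xs \<longlonglongrightarrow> x"
    and F_bounded: "\<exists>B. \<forall>m\<in>Prob_space. \<forall>w x. \<bar>F m w x\<bar> \<le> B"
    and F_cont: "continuous_map (prod_topology weak_top (prod_topology euclidean euclidean))
                   euclideanreal (\<lambda>(m, w, x). F m w x)"
    and Nash_exists: "\<And>n w. n \<ge> 1 \<Longrightarrow> \<exists>x. eps_Nash F C 0 n w x"
    and eps_nonneg: "\<And>n. \<epsilon> n \<ge> 0"
    and eps_lim: "\<epsilon> \<longlonglongrightarrow> 0"
    and M_prob: "prob_space M"
    and W_indep: "prob_space.indep_vars M (\<lambda>_. borel) W UNIV"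
    and W_law: "\<And>i. distr M borel (W i) = lam0"
  shows "LDP upper_vietoris M
           (\<lambda>n \<omega>. Nash_set F C (\<epsilon> n) n (\<lambda>i. W i \<omega>))
           (\<lambda>A. INF lam\<in>{lam \<in> Prob_space. MFE F C lam = A}. rel_entropy lam lam0)"
proof -
  interpret prob_space M by fact
  interpret mean_field_game F C
    using X_compact C_nonempty C_graph_closed C_lower F_bounded F_cont by unfold_locales
  let ?Z = "\<lambda>n \<omega>. Nash_set F C (\<epsilon> n) n (\<lambda>i. W i \<omega>)"
  have iid: "iid_sample M W n lam0" if "n \<ge> 1" for n
    using that indep_vars_subset[OF W_indep, of "{..<n}"] W_law by unfold_locales auto
  have \<mu>: "lam0 \<in> Prob_space" by (rule iid_sample.mu_Prob_space[OF iid[of 1]]) simp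
  have Z: "?Z n \<in> M \<rightarrow>\<^sub>M borel_of upper_vietoris" if n: "n \<ge> 1" for n
    unfolding borel_of_def
  proof (rule measurable_measure_of)
    show "{U. openin upper_vietoris U} \<subseteq> Pow (topspace upper_vietoris)"
      by (auto dest: openin_subset)
    show "?Z n \<in> space M \<rightarrow> topspace upper_vietoris"
      using closedin_Nash_set[OF n] by (simp add: topspace_upper_vietoris closed_sets_P_def)
    fix V :: "('w \<times> 'x) measure set set" assume "V \<in> {U. openin upper_vietoris U}"
    then have "openin upper_vietoris V" by simp
    have "{\<omega> \<in> space M. (\<lambda>i. W i \<omega>) \<in> {w. Nash_set F C (\<epsilon> n) n w \<in> V}} \<in> events"
    proof (rule iid_sample.sample_vimage_sets[OF iid[OF n] open_Nash_vimage[OF n \<open>openin upper_vietoris V\<close>]])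
      fix w w' :: "nat \<Rightarrow> 'w" assume "\<And>i. i < n \<Longrightarrow> w i = w' i"
      from Nash_set_cong[OF n this]
      show "w \<in> {w. Nash_set F C (\<epsilon> n) n w \<in> V} \<longleftrightarrow> w' \<in> {w. Nash_set F C (\<epsilon> n) n w \<in> V}" by simp
    qed
    then have "{\<omega> \<in> space M. ?Z n \<omega> \<in> V} \<in> events" by simp
    moreover have "?Z n -` V \<inter> space M = {\<omega> \<in> space M. ?Z n \<omega> \<in> V}" by blast
    ultimately show "?Z n -` V \<inter> space M \<in> events" by simp
  qed
  have Z_sets: "{\<omega> \<in> space M. ?Z n \<omega> \<in> U} \<in> events"
    if "n \<ge> 1" "U \<in> sets (borel_of upper_vietoris)" for n U
  proof -
    have "?Z n -` U \<inter> space M = {\<omega> \<in> space M. ?Z n \<omega> \<in> U}" by blast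
    then show ?thesis using measurable_sets[OF Z[OF that(1)] that(2)] by simp
  qed
  have upper: "limsup (\<lambda>n. ereal (1 / real n) * logp (prob {\<omega> \<in> space M. ?Z n \<omega> \<in> U}))
      \<le> - (INF A \<in> upper_vietoris closure_of U. J lam0 A)"
    if U: "U \<in> sets (borel_of upper_vietoris)" for U
  proof -
    let ?cl = "upper_vietoris closure_of U"
    have "U \<subseteq> topspace upper_vietoris"
      using sets.sets_into_space[OF U] by (simp add: borel_of_def space_measure_of_conv)
    then have Ucl: "U \<subseteq> ?cl" by (rule closure_of_subset)
    have op: "openin upper_vietoris (topspace upper_vietoris - ?cl)"
      by (intro openin_diff openin_topspace closedin_closure_of)
    \<comment> \<open>Arguing for every real \<open>a\<close> strictly below the infimum covers an
      infinite infimum as well. Compactness reduces the neighbourhoods of laws to finitely many, so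
      that one threshold in \<open>n\<close> suffices before \<open>sanov_upper\<close> is
      applied.\<close>
    have main: "limsup (\<lambda>n. ereal (1 / real n) * logp (prob {\<omega> \<in> space M. ?Z n \<omega> \<in> U})) \<le> ereal (- a)"
      if a: "ereal a < (INF A \<in> ?cl. J lam0 A)" for a
    proof -
      let ?K = "{\<nu> \<in> Prob_space. rel_entropy \<nu> lam0 \<le> ereal a}"
      define \<G> where "\<G> = {G. openin weak_top G \<and> (\<exists>N. \<forall>n\<ge>N. \<forall>w. empirical n w \<in> G \<longrightarrow> Nash_set F C (\<epsilon> n) n w \<notin> ?cl)}"
      have "?K \<subseteq> \<Union>\<G>"
      proof
        fix lam assume lam: "lam \<in> ?K"
        have "MFE F C lam \<notin> ?cl"
        proof
          assume "MFE F C lam \<in> ?cl"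
          then have "(INF A \<in> ?cl. J lam0 A) \<le> J lam0 (MFE F C lam)" by (rule INF_lower)
          also have "\<dots> \<le> rel_entropy lam lam0" using lam by (intro J_MFE_le) simp
          also have "\<dots> \<le> ereal a" using lam by simp
          finally show False using a by simp
        qed
        then have "MFE F C lam \<in> topspace upper_vietoris - ?cl"
          using MFE_closed_sets by (simp add: topspace_upper_vietoris)
        from vietoris_continuity[OF _ op this eps_lim] lam
        obtain G N where "openin weak_top G" "lam \<in> G"
          "\<forall>n\<ge>N. \<forall>w. empirical n w \<in> G \<longrightarrow> Nash_set F C (\<epsilon> n) n w \<in> topspace upper_vietoris - ?cl"
          by blast
        then show "lam \<in> \<Union>\<G>" unfolding \<G>_def by blast
      qed
      moreover have "Ball \<G> (openin weak_top)" by (simp add: \<G>_def)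
      moreover have "compactin weak_top ?K"
        by (rule uniformly_daniell_compactin[OF uniformly_daniell_entropy_sublevel[OF \<mu>] closedin_entropy_sublevel[OF \<mu>]])
      ultimately obtain \<F> where \<F>: "finite \<F>" "\<F> \<subseteq> \<G>" "?K \<subseteq> \<Union>\<F>"
        unfolding compactin_def by meson
      have "\<forall>G\<in>\<F>. eventually (\<lambda>n. \<forall>w. empirical n w \<in> G \<longrightarrow> Nash_set F C (\<epsilon> n) n w \<notin> ?cl) sequentially"
        using \<F>(2) unfolding \<G>_def eventually_sequentially by blast
      then have "eventually (\<lambda>n. \<forall>G\<in>\<F>. \<forall>w. empirical n w \<in> G \<longrightarrow> Nash_set F C (\<epsilon> n) n w \<notin> ?cl) sequentially"
        by (rule eventually_ball_finite[OF \<F>(1)])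
      then have ev: "eventually (\<lambda>n. \<forall>w. empirical n w \<in> \<Union>\<F> \<longrightarrow> Nash_set F C (\<epsilon> n) n w \<notin> ?cl) sequentially"
        by (rule eventually_mono) blast
      have opF: "openin weak_top (\<Union>\<F>)" using \<F>(2) by (intro openin_Union) (auto simp: \<G>_def)
      obtain c where c: "\<forall>(M :: 'o measure) W n. iid_sample M W n lam0 \<longrightarrow>
          measure M {\<omega> \<in> space M. empirical n (\<lambda>i. W i \<omega>) \<notin> \<Union>\<F>} \<le> c * exp (- real n * a)"
        using sanov_upper[OF \<mu> opF \<F>(3)] by blast
      have "eventually (\<lambda>n. prob {\<omega> \<in> space M. ?Z n \<omega> \<in> U} \<le> c * exp (- real n * a)) sequentially"
        using ev eventually_ge_at_top[of 1]
      proof eventually_elim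
        case (elim n)
        interpret S: iid_sample M W n lam0 by (rule iid[OF elim(2)])
        have "prob {\<omega> \<in> space M. ?Z n \<omega> \<in> U} \<le> prob {\<omega> \<in> space M. empirical n (\<lambda>i. W i \<omega>) \<notin> \<Union>\<F>}"
        proof (rule finite_measure_mono)
          show "{\<omega> \<in> space M. ?Z n \<omega> \<in> U} \<subseteq> {\<omega> \<in> space M. empirical n (\<lambda>i. W i \<omega>) \<notin> \<Union>\<F>}"
            using elim(1) Ucl by blast
          show "{\<omega> \<in> space M. empirical n (\<lambda>i. W i \<omega>) \<notin> \<Union>\<F>} \<in> events"
            using S.emp_closed_sets[OF opF] by (simp only: S.emp_def)
        qed
        also have "\<dots> \<le> c * exp (- real n * a)" using c S.iid_sample_axioms by blast
        finally show ?case .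
      qed
      then show ?thesis by (rule limsup_logp_le)
    qed
    let ?L = "limsup (\<lambda>n. ereal (1 / real n) * logp (prob {\<omega> \<in> space M. ?Z n \<omega> \<in> U}))"
    have "(INF A \<in> ?cl. J lam0 A) \<le> - ?L"
    proof (rule dense_le)
      fix y assume y: "y < (INF A \<in> ?cl. J lam0 A)"
      show "y \<le> - ?L"
      proof (cases y)
        case (real a)
        have "?L \<le> - y" using main[of a] y real by simp
        then show ?thesis using ereal_uminus_le_reorder[of y ?L] ereal_minus_le_minus[of "- y" ?L] by simp
      qed (use y in auto)
    qed
    then show ?thesis using ereal_minus_le_minus[of "- ?L" "INF A \<in> ?cl. J lam0 A"] by simp
  qed
  have lower: "- (INF A \<in> upper_vietoris interior_of U. J lam0 A)
      \<le> liminf (\<lambda>n. ereal (1 / real n) * logp (prob {\<omega> \<in> space M. ?Z n \<omega> \<in> U}))"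
    if U: "U \<in> sets (borel_of upper_vietoris)" for U
  proof -
    let ?int = "upper_vietoris interior_of U"
    let ?L = "liminf (\<lambda>n. ereal (1 / real n) * logp (prob {\<omega> \<in> space M. ?Z n \<omega> \<in> U}))"
    \<comment> \<open>Laws are treated one at a time, and only those of finite entropy need an
      argument; the infimum over sets in the interior and over their laws is taken
      afterwards.\<close>
    have main: "- rel_entropy lam lam0 \<le> ?L" if lam: "lam \<in> Prob_space" "MFE F C lam \<in> ?int" for lam
    proof (cases "rel_entropy lam lam0 = \<infinity>")
      case False
      then have "rel_entropy lam lam0 < \<infinity>" by simp
      from rel_entropy_finite[OF \<mu> lam(1) this] obtain h where h: "rel_entropy lam lam0 = ereal h" by metis
      from vietoris_continuity[OF lam(1) openin_interior_of lam(2) eps_lim]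
      obtain G N where G: "openin weak_top G" "lam \<in> G"
        "\<forall>n\<ge>N. \<forall>w. empirical n w \<in> G \<longrightarrow> Nash_set F C (\<epsilon> n) n w \<in> ?int" by blast
      obtain q where q: "q \<longlonglongrightarrow> 1"
        "\<And>(M :: 'o measure) W n. iid_sample M W n lam0 \<Longrightarrow> q n > 0 \<Longrightarrow>
          measure M {\<omega> \<in> space M. empirical n (\<lambda>i. W i \<omega>) \<in> G} \<ge> q n * exp (- (real n * h + 1) / q n)"
        by (rule sanov_lower[OF \<mu> lam(1) h G(1,2)]) (rule that)
      have "eventually (\<lambda>n. q n > 0 \<longrightarrow> q n * exp (- (real n * h + 1) / q n) \<le> prob {\<omega> \<in> space M. ?Z n \<omega> \<in> U}) sequentially"
        using eventually_ge_at_top[of "max N 1"]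
      proof (rule eventually_mono, intro impI)
        fix n assume n: "max N 1 \<le> n" and qn: "q n > 0"
        then have n1: "n \<ge> 1" "n \<ge> N" by simp_all
        have "q n * exp (- (real n * h + 1) / q n) \<le> prob {\<omega> \<in> space M. empirical n (\<lambda>i. W i \<omega>) \<in> G}"
          by (rule q(2)[OF iid[OF n1(1)] qn])
        also have "\<dots> \<le> prob {\<omega> \<in> space M. ?Z n \<omega> \<in> U}"
        proof (rule finite_measure_mono[OF _ Z_sets[OF n1(1) U]])
          show "{\<omega> \<in> space M. empirical n (\<lambda>i. W i \<omega>) \<in> G} \<subseteq> {\<omega> \<in> space M. ?Z n \<omega> \<in> U}"
            using G(3) n1(2) interior_of_subset[of upper_vietoris U] by blast
        qed
        finally show "q n * exp (- (real n * h + 1) / q n) \<le> prob {\<omega> \<in> space M. ?Z n \<omega> \<in> U}" .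
      qed
      from liminf_logp_ge[OF q(1) this] show ?thesis by (simp add: h)
    qed simp
    have "- ?L \<le> (INF A \<in> ?int. J lam0 A)"
    proof (intro INF_greatest)
      fix A lam assume "A \<in> ?int" "lam \<in> {lam \<in> Prob_space. MFE F C lam = A}"
      then have "- rel_entropy lam lam0 \<le> ?L" by (intro main) auto
      then show "- ?L \<le> rel_entropy lam lam0" by (simp add: ereal_uminus_le_reorder)
    qed
    then show ?thesis by (simp add: ereal_uminus_le_reorder)
  qed
  show ?thesis
    unfolding LDP_def using compactin_J_sublevel[OF \<mu>] Z upper lower by blast
qed

end
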